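(* Fix an even positive integer $n$. The following four statements are equivalent: \begin{enumerate} \item The Alon–Tarsi conjecture holds for $n$: the number of Latin squares of size $n$ with sign $-1$ is not equal to the number of Latin squares of size $n$ with sign $+1$. \item The $GL_n$-module $S_{(n^n)}\mathbb{C}^n$ occurs in the homogeneous coordinate ring $\mathbb{C}[Ch_n(\mathbb{C}^n)]$ of the Chow variety. \item $\int_{g\in SU(n)} (\mathrm{perm}_n(g))^n\, d\mu\neq 0$, where $d\mu$ is Haar measure on $SU(n)$. \item Let $\mathbb{C}^{n^2}$ have coordinates $x^i_j$ and let the dual space have coordinates $y^i_j$ ($1\le i,j\le n$). Then $$\langle (\mathrm{perm}_n(y))^n,(\det\nolimits_n(x))^n\rangle \neq 0 .$$ \end{enumerate} Moreover, the following two statements are equivalent to each other, and they imply that statements (1)–(4) are true: (i) $\int_{g\in SU(n)} \prod_{1\leq i,j\leq n}g^i_j\, d\mu\neq 0$, where $d\mu$ is Haar measure and $g^i_j$ are the matrix entries of $g$. (ii) $\langle \prod_{1\le i,j\le n}y^i_j,\ (\det_n(x))^n\rangle\neq 0$.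
   Context: A Latin square of size $n$ is an $n\times n$ matrix such that each row and each column consists of the integers $\{1,\dots,n\}$. Each row and each column determines a permutation in $\mathfrak{S}_n$ by the order in which the integers appear; the sign of the Latin square is the product of the signs of all these $2n$ permutations. $\det_n(x)=\sum_{\sigma\in\mathfrak{S}_n}\mathrm{sgn}(\sigma)x^1_{\sigma(1)}\cdots x^n_{\sigma(n)}$ and $\mathrm{perm}_n(y)=\sum_{\sigma\in\mathfrak{S}_n}y^1_{\sigma(1)}\cdots y^n_{\sigma(n)}$ are the determinant and permanent polynomials of $n\times n$ matrices. The pairing $\langle\cdot,\cdot\rangle$ is the pairing between homogeneous differential operators (with constant coefficients) of order $n^2$ and homogeneous polynomials of degree $n^2$: the polynomial in $y$ is viewed as a differential operator via $y^i_j\mapsto \partial/\partial x^i_j$, and is applied to the polynomial in $x$. The Chow variety is $Ch_n(\mathbb{C}^n)=\{[z]\mid z=w_1\cdots w_n \text{ for some } w_j\}$ in the projectivization of the space of homogeneous polynomials of degree $n$ in $n$ variables. $\mathbb{C}[Ch_n(\mathbb{C}^n)]$ is its homogeneous coordinate ring, i.e. the quotient of the symmetric algebra on the dual of the space of degree $n$ forms by the ideal of the variety. For a partition $\pi$, $S_\pi\mathbb{C}^n$ is the irreducible polynomial $GL_n$-module indexed by $\pi$; here $(n^n)=(n,\dots,n)$ with $n$ parts, so that $S_{(n^n)}\mathbb{C}^n=(\Lambda^n\mathbb{C}^n)^{\otimes n}$. In (2), following the usual convention, one does not distinguish between $\mathbb{C}^n$ and its dual when naming the module: the assertion is that the module $S_{(n^n)}$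 of the vector space whose $n$-th symmetric power generates the coordinate ring occurs in the coordinate ring (it can only occur in degree $n$, the component that is a quotient of $S^n(S^n\mathbb{C}^n)$). *)

theory Defs
  imports "HOL-Analysis.Analysis" "HOL-Library.Poly_Mapping" "HOL-Algebra.QuotRing"
begin

text \<open>
  The finite type \<open>'n\<close> indexes rows, columns, Latin square symbols and the coordinates of
  \<open>\<complex>\<^sup>n\<close>; it stands for \<open>{1,\<dots>,n}\<close> with \<open>n = CARD('n)\<close>.
\<close>

section \<open>Latin squares\<close>

definition latin_square :: "'n^'n^'n \<Rightarrow> bool" where
  "latin_square L \<longleftrightarrow> (\<forall>i. bij (\<lambda>j. L $ i $ j)) \<and> (\<forall>j. bij (\<lambda>i. L $ i $ j))"

definition latin_sign :: "('n::finite)^'n^'n \<Rightarrow> int" where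
  "latin_sign L = (\<Prod>i\<in>UNIV. sign (\<lambda>j. L $ i $ j)) * (\<Prod>j\<in>UNIV. sign (\<lambda>i. L $ i $ j))"

section \<open>Permanent\<close>

definition perm :: "'a::comm_semiring_1^'n^'n \<Rightarrow> 'a" where
  "perm A = (\<Sum>p | p permutes UNIV. \<Prod>i\<in>UNIV. A $ i $ p i)"

section \<open>Complex polynomials\<close>

text \<open>
  A monomial in variables of type \<open>'v\<close> is its finitely supported exponent vector.
\<close>

type_synonym 'v monomial = "'v \<Rightarrow>\<^sub>0 nat"
type_synonym 'v cpoly = "'v monomial \<Rightarrow>\<^sub>0 complex"

definition const :: "complex \<Rightarrow> 'v cpoly" where
  "const c = Poly_Mapping.single 0 c"

definition Var :: "'v \<Rightarrow> 'v cpoly" where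
  "Var v = Poly_Mapping.single (Poly_Mapping.single v 1) 1"

definition mdeg :: "'v monomial \<Rightarrow> nat" where
  "mdeg m = (\<Sum>v\<in>Poly_Mapping.keys m. Poly_Mapping.lookup m v)"

definition homogeneous :: "nat \<Rightarrow> 'v cpoly \<Rightarrow> bool" where
  "homogeneous d p \<longleftrightarrow> (\<forall>m\<in>Poly_Mapping.keys p. mdeg m = d)"

definition eval_poly :: "('v \<Rightarrow> complex) \<Rightarrow> 'v cpoly \<Rightarrow> complex" where
  "eval_poly a p = (\<Sum>m\<in>Poly_Mapping.keys p.
     Poly_Mapping.lookup p m * (\<Prod>v\<in>Poly_Mapping.keys m. a v ^ Poly_Mapping.lookup m v))"

definition subst_poly :: "('v \<Rightarrow> 'w cpoly) \<Rightarrow> 'v cpoly \<Rightarrow> 'w cpoly" where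
  "subst_poly s p = (\<Sum>m\<in>Poly_Mapping.keys p.
     const (Poly_Mapping.lookup p m) * (\<Prod>v\<in>Poly_Mapping.keys m. s v ^ Poly_Mapping.lookup m v))"

section \<open>Constant coefficient differential operators\<close>

definition partial :: "'v \<Rightarrow> 'v cpoly \<Rightarrow> 'v cpoly" where
  "partial v p = (\<Sum>m\<in>Poly_Mapping.keys p.
     Poly_Mapping.single (m - Poly_Mapping.single v 1)
       (of_nat (Poly_Mapping.lookup m v) * Poly_Mapping.lookup p m))"

lemma partial_superset:
  assumes "finite A" "Poly_Mapping.keys p \<subseteq> A"
  shows "partial v p = (\<Sum>m\<in>A. Poly_Mapping.single (m - Poly_Mapping.single v 1)
       (of_nat (Poly_Mapping.lookup m v) * Poly_Mapping.lookup p m))"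
  unfolding partial_def using assms
  by (intro sum.mono_neutral_left) (auto simp: in_keys_iff)

lemma partial_add: "partial v (p + q) = partial v p + partial v q"
proof -
  let ?A = "Poly_Mapping.keys p \<union> Poly_Mapping.keys q"
  have "Poly_Mapping.keys (p + q) \<subseteq> ?A" by (rule Poly_Mapping.keys_add)
  then show ?thesis
    by (simp add: partial_superset[of ?A] lookup_add distrib_left single_add sum.distrib)
qed

lemma partial_zero [simp]: "partial v 0 = 0"
  by (simp add: partial_def)

lemma partial_sum: "partial v (\<Sum>i\<in>A. f i) = (\<Sum>i\<in>A. partial v (f i))"
  by (induction A rule: infinite_finite_induct) (simp_all add: partial_add)

lemma partial_single:
  "partial v (Poly_Mapping.single m c) =
     Poly_Mapping.single (m - Poly_Mapping.single v 1) (of_nat (Poly_Mapping.lookup m v) * c)"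
  by (subst partial_superset[of "{m}"]) auto

lemma partial_commute: "partial v (partial w p) = partial w (partial v p)"
proof -
  have "partial v (Poly_Mapping.single (m - Poly_Mapping.single w 1) (of_nat (Poly_Mapping.lookup m w) * c))
      = partial w (Poly_Mapping.single (m - Poly_Mapping.single v 1) (of_nat (Poly_Mapping.lookup m v) * c))"
    for m and c :: complex
    by (simp add: partial_single lookup_minus lookup_single when_def diff_right_commute algebra_simps)
  then show ?thesis
    by (subst (2 4) partial_def) (simp add: partial_sum)
qed

text \<open>
  The order in which the fold composes the partial derivatives is immaterial, since they commute
  (\<open>partial_commute\<close>).
\<close>

definition monomial_diff :: "'v monomial \<Rightarrow> 'v cpoly \<Rightarrow> 'v cpoly" where
  "monomial_diff m p =
     Finite_Set.fold (\<lambda>v. partial v ^^ Poly_Mapping.lookup m v) p (Poly_Mapping.keys m)"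

definition diff_op :: "'v cpoly \<Rightarrow> 'v cpoly \<Rightarrow> 'v cpoly" where
  "diff_op q p = (\<Sum>m\<in>Poly_Mapping.keys q. const (Poly_Mapping.lookup q m) * monomial_diff m p)"

text \<open>
  For \<open>q\<close> and \<open>p\<close> homogeneous of the same degree, \<open>diff_op q p\<close> is a constant polynomial; the
  pairing is that constant. The dual coordinate \<open>y\<^sup>i\<^sub>j\<close> and \<open>x\<^sup>i\<^sub>j\<close> are both the variable \<open>(i, j)\<close>.
\<close>

definition pairing :: "'v cpoly \<Rightarrow> 'v cpoly \<Rightarrow> complex" where
  "pairing q p = Poly_Mapping.lookup (diff_op q p) 0"

definition generic_matrix :: "(('n \<times> 'n) cpoly)^'n^'n" where
  "generic_matrix = (\<chi> i j. Var (i, j))"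

section \<open>Haar measure on the special unitary group\<close>

definition SU :: "(complex^'n^'n) set" where
  "SU = {A. A ** (\<chi> i j. cnj (A $ j $ i)) = mat 1 \<and> det A = 1}"

text \<open>
  Left Haar measure on a group \<open>G\<close> of matrices, unique up to a positive factor. Regularity is not
  listed: on the compact metric group \<open>SU\<close> it is automatic, as is right invariance.
\<close>

definition haar_measure :: "(complex^'n^'n) set \<Rightarrow> (complex^'n^'n) measure \<Rightarrow> bool" where
  "haar_measure G \<mu> \<longleftrightarrow>
     sets \<mu> = sets (restrict_space borel G) \<and>
     emeasure \<mu> G \<noteq> 0 \<and>
     (\<forall>K\<subseteq>G. compact K \<longrightarrow> emeasure \<mu> K < \<infinity>) \<and>
     (\<forall>g\<in>G. \<forall>A\<in>sets \<mu>. emeasure \<mu> ((\<lambda>x. g ** x) ` A) = emeasure \<mu> A)"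

section \<open>Modules over groups of matrices\<close>

record ('n, 'v) gmodule =
  vecs :: "'v set"
  vadd :: "'v \<Rightarrow> 'v \<Rightarrow> 'v"
  vscale :: "complex \<Rightarrow> 'v \<Rightarrow> 'v"
  gact :: "complex^'n^'n \<Rightarrow> 'v \<Rightarrow> 'v"

text \<open>\<open>M\<close> occurs in \<open>N\<close> if \<open>M\<close> is isomorphic to a submodule of \<open>N\<close>.\<close>

definition occurs_in ::
  "(complex^'n^'n) set \<Rightarrow> ('n, 'v) gmodule \<Rightarrow> ('n, 'w) gmodule \<Rightarrow> bool" where
  "occurs_in G M N \<longleftrightarrow> (\<exists>\<phi>. \<phi> \<in> vecs M \<rightarrow> vecs N \<and> inj_on \<phi> (vecs M) \<and>
     (\<forall>u\<in>vecs M. \<forall>v\<in>vecs M. \<phi> (vadd M u v) = vadd N (\<phi> u) (\<phi> v)) \<and>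
     (\<forall>c. \<forall>u\<in>vecs M. \<phi> (vscale M c u) = vscale N c (\<phi> u)) \<and>
     (\<forall>g\<in>G. \<forall>u\<in>vecs M. \<phi> (gact M g u) = gact N g (\<phi> u)))"

definition GL :: "(complex^'n^'n) set" where
  "GL = {g. invertible g}"

section \<open>Schur modules\<close>

text \<open>
  \<open>S\<^sub>\<pi>\<complex>\<^sup>n\<close> by Weyl's construction: the image of the Young symmetrizer on the tensor power of \<open>\<complex>\<^sup>n\<close>
  with one factor for each cell of the Young diagram of \<open>\<pi>\<close>. A tensor is its array of coefficients
  with respect to the basis indexed by the maps \<open>f\<close> from cells to \<open>'n\<close>.
\<close>

definition cells :: "nat list \<Rightarrow> (nat \<times> nat) set" where
  "cells \<pi> = {(i, j). i < length \<pi> \<and> j < \<pi> ! i}"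

abbreviation basis_maps :: "nat list \<Rightarrow> (nat \<times> nat \<Rightarrow> 'n) set" where
  "basis_maps \<pi> \<equiv> cells \<pi> \<rightarrow>\<^sub>E UNIV"

type_synonym 'n tensor = "(nat \<times> nat \<Rightarrow> 'n) \<Rightarrow> complex"

definition tensors :: "nat list \<Rightarrow> 'n tensor set" where
  "tensors \<pi> = {T. \<forall>f. f \<notin> basis_maps \<pi> \<longrightarrow> T f = 0}"

definition row_group :: "nat list \<Rightarrow> (nat \<times> nat \<Rightarrow> nat \<times> nat) set" where
  "row_group \<pi> = {p. p permutes cells \<pi> \<and> (\<forall>c\<in>cells \<pi>. fst (p c) = fst c)}"

definition column_group :: "nat list \<Rightarrow> (nat \<times> nat \<Rightarrow> nat \<times> nat) set" where
  "column_group \<pi> = {p. p permutes cells \<pi> \<and> (\<forall>c\<in>cells \<pi>. snd (p c) = snd c)}"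

text \<open>
  A permutation \<open>p\<close> of the cells moves the factor in cell \<open>c\<close> to cell \<open>p c\<close>, hence sends \<open>T\<close> to
  \<open>\<lambda>f. T (f \<circ> p)\<close>.
\<close>

definition young_symmetrizer :: "nat list \<Rightarrow> 'n tensor \<Rightarrow> 'n tensor" where
  "young_symmetrizer \<pi> T =
     (\<lambda>f. \<Sum>q\<in>column_group \<pi>. \<Sum>p\<in>row_group \<pi>. of_int (sign q) * T (f \<circ> q \<circ> p))"

definition tensor_act :: "nat list \<Rightarrow> complex^'n^'n \<Rightarrow> 'n tensor \<Rightarrow> 'n tensor" where
  "tensor_act \<pi> g T = (\<lambda>f. if f \<in> basis_maps \<pi>
     then \<Sum>h\<in>basis_maps \<pi>. (\<Prod>c\<in>cells \<pi>. g $ f c $ h c) * T h else 0)"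

definition schur_module :: "nat list \<Rightarrow> ('n::finite, 'n tensor) gmodule" where
  "schur_module \<pi> = \<lparr>vecs = young_symmetrizer \<pi> ` tensors \<pi>,
     vadd = (\<lambda>S T f. S f + T f), vscale = (\<lambda>c T f. c * T f), gact = tensor_act \<pi>\<rparr>"

section \<open>The coordinate ring of the Chow variety\<close>

text \<open>
  Forms of degree \<open>n\<close> are polynomial functions on \<open>\<complex>\<^sup>n\<close>. The affine cone over the Chow variety
  consists of the products of \<open>n\<close> linear forms.
\<close>

definition chow_cone :: "('n::finite) cpoly set" where
  "chow_cone = {z. \<exists>w. (\<forall>j. homogeneous 1 (w j)) \<and> z = (\<Prod>j\<in>(UNIV::'n set). w j)}"

text \<open>
  The symmetric algebra on the dual of the space of degree \<open>n\<close> forms is the polynomial ring in the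
  coordinates of such a form, i.e. in one variable for each monomial \<open>m\<close> of degree \<open>n\<close>, the
  variable \<open>m\<close> being the linear functional that takes the coefficient of \<open>m\<close>.
\<close>

definition form_sym_algebra :: "('n::finite) monomial cpoly ring" where
  "form_sym_algebra =
     \<lparr>carrier = {F. \<forall>\<mu>\<in>Poly_Mapping.keys F. \<forall>m\<in>Poly_Mapping.keys \<mu>. mdeg m = CARD('n)},
      mult = (*), one = 1, zero = 0, add = (+)\<rparr>"

definition eval_at_form :: "'n cpoly \<Rightarrow> 'n monomial cpoly \<Rightarrow> complex" where
  "eval_at_form z F = eval_poly (Poly_Mapping.lookup z) F"

text \<open>
  As the cone is closed under scaling, the polynomials vanishing on it form a homogeneous ideal,
  which is the ideal of the projective variety.
\<close>

definition chow_ideal :: "('n::finite) monomial cpoly set" where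
  "chow_ideal = {F \<in> carrier form_sym_algebra. \<forall>z\<in>chow_cone. eval_at_form z F = 0}"

definition chow_ring :: "('n::finite) monomial cpoly set ring" where
  "chow_ring = form_sym_algebra Quot chow_ideal"

text \<open>
  \<open>GL\<^sub>n\<close> acts on \<open>\<complex>\<^sup>n\<close> by \<open>x \<mapsto> g x\<close>, on forms by \<open>(g z) (x) = z (g\<^sup>-\<^sup>1 x)\<close> and on polynomials \<open>F\<close> in the
  coefficients of a form by \<open>(g F) (z) = F (g\<^sup>-\<^sup>1 z) = F (z \<circ> g)\<close>. Thus the degree \<open>1\<close> part of the
  symmetric algebra, the dual of the space of forms, is the module \<open>S\<^sup>n(\<complex>\<^sup>n)\<close> (not its dual).
\<close>

definition form_comp :: "('n::finite) cpoly \<Rightarrow> complex^'n^'n \<Rightarrow> 'n cpoly" where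
  "form_comp z g = subst_poly (\<lambda>j. \<Sum>k\<in>UNIV. const (g $ j $ k) * Var k) z"

text \<open>
  \<open>g\<close> sends the coordinate \<open>m\<close> to the linear functional taking \<open>z\<close> to the coefficient of \<open>m\<close> in
  \<open>z \<circ> g\<close>.
\<close>

definition sym_act :: "complex^'n^'n \<Rightarrow> ('n::finite) monomial cpoly \<Rightarrow> 'n monomial cpoly" where
  "sym_act g F = subst_poly
     (\<lambda>m. \<Sum>m' | mdeg m' = CARD('n).
        const (Poly_Mapping.lookup (form_comp (Poly_Mapping.single m' 1) g) m) * Var m') F"

definition monom_val where
  "monom_val a m = (\<Prod>v\<in>Poly_Mapping.keys m. (a v::'b::comm_ring_1) ^ Poly_Mapping.lookup m v)"

lemma monom_val_superset: "finite A \<Longrightarrow> Poly_Mapping.keys m \<subseteq> A \<Longrightarrow> monom_val a m = (\<Prod>v\<in>A. a v ^ Poly_Mapping.lookup m v)"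
  unfolding monom_val_def by (intro prod.mono_neutral_left) (auto simp: in_keys_iff)

lemma monom_val_add: "monom_val a (m + m') = monom_val a m * monom_val a m'"
proof -
  let ?A = "Poly_Mapping.keys m \<union> Poly_Mapping.keys m'"
  have "Poly_Mapping.keys (m + m') \<subseteq> ?A" by (rule Poly_Mapping.keys_add)
  then show ?thesis by (simp add: monom_val_superset[of ?A] lookup_add power_add prod.distrib)
qed

lemma eval_poly_superset: "finite A \<Longrightarrow> Poly_Mapping.keys p \<subseteq> A \<Longrightarrow>
  eval_poly a p = (\<Sum>m\<in>A. Poly_Mapping.lookup p m * monom_val a m)"
  unfolding eval_poly_def monom_val_def by (intro sum.mono_neutral_left) (auto simp: in_keys_iff)

lemma eval_poly_add: "eval_poly a (p + q) = eval_poly a p + eval_poly a q"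
proof -
  let ?A = "Poly_Mapping.keys p \<union> Poly_Mapping.keys q"
  have "Poly_Mapping.keys (p + q) \<subseteq> ?A" by (rule Poly_Mapping.keys_add)
  then show ?thesis by (simp add: eval_poly_superset[of ?A] lookup_add distrib_right sum.distrib)
qed
lemma eval_poly_zero[simp]: "eval_poly a 0 = 0" by (simp add: eval_poly_def)
lemma eval_poly_single: "eval_poly a (Poly_Mapping.single m c) = c * monom_val a m"
  by (subst eval_poly_superset[of "{m}"]) auto
lemma eval_poly_sum: "eval_poly a (\<Sum>i\<in>A. f i) = (\<Sum>i\<in>A. eval_poly a (f i))"
  by (induction A rule: infinite_finite_induct) (simp_all add: eval_poly_add)
lemma cpoly_decomp: "p = (\<Sum>m\<in>Poly_Mapping.keys p. Poly_Mapping.single m (Poly_Mapping.lookup p m))"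
  by (rule poly_mapping_eqI) (auto simp: lookup_sum lookup_single when_def in_keys_iff)
lemma eval_poly_mult: "eval_poly a (p * q) = eval_poly a p * eval_poly a q"
proof -
  let ?s = "\<lambda>r. \<Sum>m\<in>Poly_Mapping.keys r. Poly_Mapping.single m (Poly_Mapping.lookup r m)"
  have "eval_poly a (?s p * ?s q) = eval_poly a (?s p) * eval_poly a (?s q)"
    unfolding sum_product eval_poly_sum
    by (simp add: mult_single eval_poly_single monom_val_add algebra_simps)
  then show ?thesis by (simp flip: cpoly_decomp)
qed
lemma eval_poly_const[simp]: "eval_poly a (const c) = c"
  by (simp add: const_def eval_poly_single monom_val_def)
lemma eval_poly_one[simp]: "eval_poly a 1 = 1" using eval_poly_const[of a 1] by (simp add: const_def)
lemma eval_poly_power: "eval_poly a (p ^ k) = eval_poly a p ^ k" by (induction k) (auto simp: eval_poly_mult)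
lemma eval_poly_prod: "eval_poly a (\<Prod>i\<in>A. f i) = (\<Prod>i\<in>A. eval_poly a (f i))"
  by (induction A rule: infinite_finite_induct) (simp_all add: eval_poly_mult)
lemma eval_poly_Var[simp]: "eval_poly a (Var v) = a v"
  by (simp add: Var_def eval_poly_single monom_val_def)
lemma eval_poly_subst: "eval_poly a (subst_poly s p) = eval_poly (\<lambda>v. eval_poly a (s v)) p"
  by (simp add: subst_poly_def eval_poly_sum eval_poly_mult eval_poly_prod eval_poly_power) (simp add: eval_poly_def)

lemma eval_form_comp: "eval_poly a (form_comp z g) = eval_poly (\<lambda>j. \<Sum>k\<in>UNIV. g $ j $ k * a k) z"
  by (simp add: form_comp_def eval_poly_subst eval_poly_sum eval_poly_mult)

lemma form_comp_expand: "form_comp z g = (\<Sum>m\<in>Poly_Mapping.keys z. const (Poly_Mapping.lookup z m) * form_comp (Poly_Mapping.single m 1) g)"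
  by (simp add: form_comp_def subst_poly_def const_def single_one)

lemma finite_mdeg: "finite {m::('n::finite) monomial. mdeg m = d}"
proof -
  have "Poly_Mapping.lookup ` {m::'n monomial. mdeg m = d} \<subseteq> (UNIV \<rightarrow>\<^sub>E {..d})"
  proof (auto simp: mdeg_def)
    fix m :: "'n monomial" and x
    show "Poly_Mapping.lookup m x \<le> (\<Sum>v\<in>Poly_Mapping.keys m. Poly_Mapping.lookup m v)"
      by (cases "x \<in> Poly_Mapping.keys m") (auto intro: member_le_sum simp: in_keys_iff)
  qed
  then have "finite (Poly_Mapping.lookup ` {m::'n monomial. mdeg m = d})"
    by (rule finite_subset) (auto intro: finite_PiE)
  then show ?thesis by (rule finite_imageD) (auto simp: inj_on_def poly_mapping_eqI)
qed

lemma lookup_const_mult: "Poly_Mapping.lookup (const c * p) m = c * Poly_Mapping.lookup p m"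
  apply (subst cpoly_decomp[of p]) unfolding sum_distrib_left const_def
  by (auto simp: mult_single lookup_sum lookup_single when_def in_keys_iff)

text \<open>The defining property \<open>(g F) (z) = F (z \<circ> g)\<close> of the action.\<close>

lemma eval_sym_act:
  assumes "homogeneous CARD('n::finite) (z::'n cpoly)"
  shows "eval_at_form z (sym_act g F) = eval_at_form (form_comp z g) F"
proof -
  have "(\<Sum>m'\<in>{m'. mdeg m' = CARD('n)}. Poly_Mapping.lookup (form_comp (Poly_Mapping.single m' 1) g) m * Poly_Mapping.lookup z m')
     = Poly_Mapping.lookup (form_comp z g) m" for m
    apply (subst (2) form_comp_expand)
    using assms by (subst sum.mono_neutral_cong_right[OF finite_mdeg, of "Poly_Mapping.keys z"])
      (auto simp: in_keys_iff homogeneous_def lookup_sum lookup_const_mult)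
  then show ?thesis
    by (simp add: eval_at_form_def sym_act_def eval_poly_subst eval_poly_sum eval_poly_mult)
qed


text \<open>Elements of \<^const>\<open>chow_ring\<close> are cosets; \<open>g\<close> maps the coset of \<open>F\<close> to that of \<open>g F\<close>.\<close>

definition chow_module :: "('n::finite, 'n monomial cpoly set) gmodule" where
  "chow_module = \<lparr>vecs = carrier chow_ring,
     vadd = add chow_ring,
     vscale = (\<lambda>c X. (chow_ideal +>\<^bsub>form_sym_algebra\<^esub> const c) \<otimes>\<^bsub>chow_ring\<^esub> X),
     gact = (\<lambda>g X. sym_act g ` X)\<rparr>"

end

theory Submission
  imports Defs
begin

text \<open>
  Let \<open>c\<close> be the coefficient of \<open>\<Prod>\<^sub>i\<^sub>j x\<^sub>i\<^sub>j\<close> in \<open>det(x)\<^sup>n\<close>. Each of the statements amounts to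
  \<open>c \<noteq> 0\<close>.

  Integration over \<open>SU(n)\<close> of polynomials of degree \<open>n\<^sup>2\<close> is multiplied by \<open>det(T)\<^sup>n\<close> under translation
  by any matrix \<open>T\<close>: this holds for \<open>T \<in> SU(n)\<close>, for diagonal \<open>T\<close> (by invariance under the torus), and
  hence for all real \<open>T\<close>, as these are generated by matrices of both kinds. Therefore
  \<open>\<integral> (\<Sum> x\<^sub>i\<^sub>j g\<^sub>i\<^sub>j)\<^bsup>n\<^sup>2\<^esup> d\<mu>\<close> is a multiple of \<open>det(x)\<^sup>n\<close>, and comparing coefficients gives
  \<open>\<integral> f(g) d\<mu> = \<kappa> \<langle>f, det\<^sup>n\<rangle>\<close> with \<open>\<kappa> \<noteq> 0\<close>. In particular \<open>\<integral> \<Prod> g\<^sub>i\<^sub>j d\<mu> = \<kappa> c\<close>. As \<open>perm(g)\<^sup>n\<close> is the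
  coefficient of \<open>\<Prod> x\<^sub>i\<^sub>j\<close> in \<open>\<Prod> (g x)\<^sub>i\<^sub>j\<close>, whose integral is \<open>\<kappa> c det(x)\<^sup>n\<close>, also
  \<open>\<integral> perm(g)\<^sup>n d\<mu> = \<kappa> c\<^sup>2\<close>.

  Expanding \<open>det(x)\<^sup>n\<close> shows that \<open>c\<close> is the sum of the row signs of all Latin squares. Up to a constant
  sign, the product of the row and column signs of a Latin square is its symbol sign, which is the row
  sign of a conjugate square, so that \<open>c\<close> is up to sign the sum of the signs of all Latin squares.

  Finally, the Schur module is the line \<open>det\<^sup>n\<close>. If \<open>c \<noteq> 0\<close>, it is generated in the coordinate ring by
  \<open>z \<mapsto> \<integral> \<Prod>\<^sub>a z(g e\<^sub>a) d\<mu>\<close>, whose value at the product of the linear forms with matrix \<open>W\<close> is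
  \<open>\<kappa> c det(W)\<^sup>n\<close>. Conversely, a function \<open>F\<close> generating such a line is constant on \<open>SU(n)\<close>-orbits and
  of degree \<open>n\<close> on the cone, and if \<open>c = 0\<close> its average over each orbit of a product of linear forms
  vanishes.
\<close>

section \<open>Coefficients, monomials and the pairing\<close>

text \<open>Lagrange interpolation at the nodes 1, ..., d+1: the weight of a node is the coefficient
  of x^j in its basis polynomial. Interpolation reproduces every x^k with k \<le> d, and comparing
  coefficients of x^j gives the claim.\<close>

lemma ex_power_functional:
  "\<exists>u::nat \<Rightarrow> complex. \<forall>k\<le>d. (\<Sum>t\<in>{1..Suc d}. u t * of_nat t ^ k) = of_bool (k = j)"
proof -
  define N where "N = {1..Suc d}"
  define L :: "nat \<Rightarrow> complex poly" where
    "L t = (\<Prod>r\<in>N - {t}. smult (1 / (of_nat t - of_nat r)) [:- of_nat r, 1:])" for t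
  have fin: "finite N" and card: "card N = Suc d" by (auto simp: N_def)
  have deg: "degree (L t) \<le> d" if "t \<in> N" for t
  proof -
    have "degree (L t) \<le> (\<Sum>r\<in>N - {t}. degree (smult (1 / (of_nat t - of_nat r)) [:- of_nat r, 1 :: complex:]))"
      unfolding L_def using fin by (intro order.trans[OF degree_prod_sum_le]) auto
    also have "\<dots> \<le> (\<Sum>r\<in>N - {t}. 1)"
      by (intro sum_mono) (auto simp: degree_smult_le)
    also have "\<dots> = d" using that fin card by simp
    finally show ?thesis .
  qed
  have poly_L: "poly (L t) (of_nat r) = of_bool (r = t)" if "t \<in> N" "r \<in> N" for t r
  proof (cases "r = t")
    case True
    have "poly (smult (1 / (of_nat t - of_nat r)) [:- of_nat r, 1 :: complex:]) (of_nat t) = 1" if "t \<noteq> r" for r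
      using that by (simp flip: diff_divide_distrib)
    with True show ?thesis unfolding L_def poly_prod by (auto intro!: prod.neutral)
  next
    case False
    then show ?thesis unfolding L_def poly_prod using that fin
      by (auto intro!: prod_zero bexI[of _ r])
  qed
  have "(\<Sum>t\<in>N. coeff (L t) j * of_nat t ^ k) = of_bool (k = j)" if "k \<le> d" for k
  proof -
    have "(\<Sum>t\<in>N. smult (of_nat t ^ k) (L t)) = monom 1 k"
    proof (rule poly_eqI_degree[where A = "of_nat ` N"])
      fix x :: complex assume "x \<in> of_nat ` N"
      then obtain r where r: "r \<in> N" "x = of_nat r" by auto
      have "poly (\<Sum>t\<in>N. smult (of_nat t ^ k) (L t)) x = (\<Sum>t\<in>N. of_nat t ^ k * of_bool (r = t))"
        using r by (simp add: poly_sum poly_L)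
      also have "\<dots> = x ^ k" using r fin by (subst sum.remove[of _ r]) (auto intro!: sum.neutral)
      finally show "poly (\<Sum>t\<in>N. smult (of_nat t ^ k) (L t)) x = poly (monom 1 k) x"
        by (simp add: poly_monom)
    next
      have c: "card (of_nat ` N :: complex set) = Suc d"
        using card by (simp add: card_image inj_on_def)
      have "degree (\<Sum>t\<in>N. smult (of_nat t ^ k) (L t)) \<le> d"
        using deg by (intro degree_sum_le) (auto intro: order.trans[OF degree_smult_le] simp: fin)
      then show "degree (\<Sum>t\<in>N. smult (of_nat t ^ k) (L t)) < card (of_nat ` N :: complex set)"
        using c by simp
      show "degree (monom (1::complex) k) < card (of_nat ` N :: complex set)"
        using c that by (simp add: degree_monom_eq)
    qed
    then have "coeff (\<Sum>t\<in>N. smult (of_nat t ^ k) (L t)) j = of_bool (k = j)"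
      by (simp add: coeff_monom)
    then show ?thesis by (simp add: coeff_sum mult.commute)
  qed
  then show ?thesis unfolding N_def by (intro exI[of _ "\<lambda>t. coeff (L t) j"]) auto
qed

text \<open>
  Writing coefficients as combinations of values allows extracting them under an integral, and from
  identities that are known only at matrices with real entries.
\<close>

lemma ex_coeff_functional:
  fixes m :: "'v monomial"
  assumes V: "finite V" "Poly_Mapping.keys m \<subseteq> V"
  shows "\<exists>(S::('v \<Rightarrow> nat) set) w. finite S \<and>
    (\<forall>p. (\<forall>m'\<in>Poly_Mapping.keys p. Poly_Mapping.keys m' \<subseteq> V \<and> (\<forall>v. Poly_Mapping.lookup m' v \<le> d)) \<longrightarrow>
       Poly_Mapping.lookup p m = (\<Sum>s\<in>S. w s * eval_poly (\<lambda>v. of_nat (s v)) p))"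
proof -
  obtain u :: "nat \<Rightarrow> nat \<Rightarrow> complex" where
    u: "\<And>j k. k \<le> d \<Longrightarrow> (\<Sum>t\<in>{1..Suc d}. u j t * of_nat t ^ k) = of_bool (k = j)"
    using ex_power_functional[of d] by metis
  define S where "S = PiE V (\<lambda>_. {1..Suc d})"
  define w where "w s = (\<Prod>v\<in>V. u (Poly_Mapping.lookup m v) (s v))" for s
  \<comment> \<open>Nodes and weights form a product over the variables, so the sum over the grid
    factors into one-variable sums, each of which tests a single exponent.\<close>
  have key: "(\<Sum>s\<in>S. w s * monom_val (\<lambda>v. of_nat (s v)) m') = of_bool (m' = m)"
    if m': "Poly_Mapping.keys m' \<subseteq> V" "\<And>v. Poly_Mapping.lookup m' v \<le> d" for m'
  proof -
    have "(\<Sum>s\<in>S. w s * monom_val (\<lambda>v. of_nat (s v)) m')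
        = (\<Sum>s\<in>S. \<Prod>v\<in>V. u (Poly_Mapping.lookup m v) (s v) * of_nat (s v) ^ Poly_Mapping.lookup m' v)"
      by (simp add: w_def monom_val_superset[OF V(1) m'(1)] prod.distrib)
    also have "\<dots> = (\<Prod>v\<in>V. \<Sum>t\<in>{1..Suc d}. u (Poly_Mapping.lookup m v) t * of_nat t ^ Poly_Mapping.lookup m' v)"
      unfolding S_def using V by (subst prod_sum_PiE) auto
    also have "\<dots> = (\<Prod>v\<in>V. of_bool (Poly_Mapping.lookup m' v = Poly_Mapping.lookup m v))"
      using m' u by simp
    also have "\<dots> = of_bool (\<forall>v\<in>V. Poly_Mapping.lookup m' v = Poly_Mapping.lookup m v)"
      using V(1) by (induction V rule: finite_induct) auto
    also have "(\<forall>v\<in>V. Poly_Mapping.lookup m' v = Poly_Mapping.lookup m v) \<longleftrightarrow> m' = m"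
    proof
      assume *: "\<forall>v\<in>V. Poly_Mapping.lookup m' v = Poly_Mapping.lookup m v"
      show "m' = m"
      proof (rule poly_mapping_eqI)
        fix v show "Poly_Mapping.lookup m' v = Poly_Mapping.lookup m v"
          using * V(2) m'(1) by (metis in_keys_iff subsetD)
      qed
    qed auto
    finally show ?thesis .
  qed
  have "Poly_Mapping.lookup p m = (\<Sum>s\<in>S. w s * eval_poly (\<lambda>v. of_nat (s v)) p)"
    if p: "\<forall>m'\<in>Poly_Mapping.keys p. Poly_Mapping.keys m' \<subseteq> V \<and> (\<forall>v. Poly_Mapping.lookup m' v \<le> d)" for p
  proof -
    have "(\<Sum>s\<in>S. w s * eval_poly (\<lambda>v. of_nat (s v)) p)
      = (\<Sum>m'\<in>Poly_Mapping.keys p. Poly_Mapping.lookup p m' * (\<Sum>s\<in>S. w s * monom_val (\<lambda>v. of_nat (s v)) m'))"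
      by (simp add: eval_poly_superset[OF finite_keys subset_refl] sum_distrib_left mult_ac sum.swap[of _ S])
    also have "\<dots> = (\<Sum>m'\<in>Poly_Mapping.keys p. Poly_Mapping.lookup p m' * of_bool (m' = m))"
      using p key by simp
    also have "\<dots> = Poly_Mapping.lookup p m"
      by (cases "m \<in> Poly_Mapping.keys p") (auto simp: of_bool_def in_keys_iff if_distrib sum.delta cong: if_cong)
    finally show ?thesis by simp
  qed
  moreover have "finite S" unfolding S_def using V by (intro finite_PiE) auto
  ultimately show ?thesis by blast
qed

section \<open>Degrees of monomials and homogeneous polynomials\<close>

lemma mdeg_superset: "finite A \<Longrightarrow> Poly_Mapping.keys m \<subseteq> A \<Longrightarrow> mdeg m = (\<Sum>v\<in>A. Poly_Mapping.lookup m v)"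
  unfolding mdeg_def by (intro sum.mono_neutral_left) (auto simp: in_keys_iff)

lemma mdeg_add: "mdeg (m + m') = mdeg m + mdeg m'"
proof -
  let ?A = "Poly_Mapping.keys m \<union> Poly_Mapping.keys m'"
  have "Poly_Mapping.keys (m + m') \<subseteq> ?A" by (rule Poly_Mapping.keys_add)
  then show ?thesis by (simp add: mdeg_superset[of ?A] lookup_add sum.distrib)
qed

lemma mdeg_0 [simp]: "mdeg 0 = 0" by (simp add: mdeg_def)

lemma mdeg_single [simp]: "mdeg (Poly_Mapping.single v k) = k"
  by (subst mdeg_superset[of "{v}"]) auto

lemma mdeg_sum: "mdeg (\<Sum>x\<in>A. f x) = (\<Sum>x\<in>A. mdeg (f x))"
  by (induction A rule: infinite_finite_induct) (auto simp: mdeg_add)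

lemma lookup_le_mdeg: "Poly_Mapping.lookup m v \<le> mdeg m"
  unfolding mdeg_def by (cases "v \<in> Poly_Mapping.keys m") (auto intro: member_le_sum simp: in_keys_iff)

lemma mdeg_eq_0: "mdeg m = 0 \<longleftrightarrow> m = 0"
  using lookup_le_mdeg[of m] by (auto intro!: poly_mapping_eqI)

lemma ex_coeff_functional_homogeneous:
  fixes m :: "('v::finite) monomial"
  shows "\<exists>(S::('v \<Rightarrow> nat) set) w. finite S \<and>
    (\<forall>p. homogeneous d p \<longrightarrow>
       Poly_Mapping.lookup p m = (\<Sum>s\<in>S. w s * eval_poly (\<lambda>v. of_nat (s v)) p))"
proof -
  have "homogeneous d p \<Longrightarrow> \<forall>m'\<in>Poly_Mapping.keys p. Poly_Mapping.keys m' \<subseteq> UNIV \<and> (\<forall>v. Poly_Mapping.lookup m' v \<le> d)"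
    for p :: "'v cpoly"
    by (metis homogeneous_def lookup_le_mdeg subset_UNIV)
  then show ?thesis using ex_coeff_functional[of UNIV m d] by (meson finite subset_UNIV)
qed

lemma eval_poly_homogeneous:
  fixes p :: "('v::finite) cpoly"
  assumes "homogeneous d p"
  shows "eval_poly a p = (\<Sum>m | mdeg m = d. Poly_Mapping.lookup p m * monom_val a m)"
  using assms by (intro eval_poly_superset finite_mdeg) (auto simp: homogeneous_def)

lemma monom_val_0 [simp]: "monom_val a 0 = 1" by (simp add: monom_val_def)

lemma monom_val_single [simp]: "monom_val a (Poly_Mapping.single v k) = a v ^ k"
  by (subst monom_val_superset[of "{v}"]) auto

lemma monom_val_sum: "monom_val a (\<Sum>x\<in>A. f x) = (\<Prod>x\<in>A. monom_val a (f x))"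
  by (induction A rule: infinite_finite_induct) (auto simp: monom_val_add)

text \<open>One variable is split off for each element of \<open>A\<close>. With \<open>A\<close>
  the set of rows, this matches the factors of a degree n monomial with the rows of a
  matrix.\<close>

lemma ex_monomial_word:
  assumes "finite A" "mdeg m = card A"
  shows "\<exists>w. (\<forall>x\<in>A. w x \<in> Poly_Mapping.keys m) \<and> m = (\<Sum>x\<in>A. Poly_Mapping.single (w x) 1)"
  using assms
proof (induction A arbitrary: m rule: finite_induct)
  case empty
  then show ?case by (simp add: mdeg_eq_0)
next
  case (insert x A)
  then have "m \<noteq> 0" by auto
  then obtain v where v: "v \<in> Poly_Mapping.keys m" by (metis equals0I keys_eq_empty)
  define m' where "m' = m - Poly_Mapping.single v 1"
  have m: "m = m' + Poly_Mapping.single v 1"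
    using v by (intro poly_mapping_eqI) (auto simp: m'_def lookup_add lookup_minus lookup_single in_keys_iff when_def)
  then have "mdeg m' = card A" using insert by (simp add: mdeg_add)
  then obtain w where w: "\<forall>y\<in>A. w y \<in> Poly_Mapping.keys m'" "m' = (\<Sum>y\<in>A. Poly_Mapping.single (w y) 1)"
    using insert.IH by blast
  have sub: "Poly_Mapping.keys m' \<subseteq> Poly_Mapping.keys m"
    by (auto simp: m'_def in_keys_iff lookup_minus)
  have eq: "(\<Sum>y\<in>A. Poly_Mapping.single ((w(x := v)) y) (1::nat)) = (\<Sum>y\<in>A. Poly_Mapping.single (w y) 1)"
    using insert.hyps by (intro sum.cong) auto
  show ?case
    using insert.hyps w sub v m eq by (intro exI[of _ "w(x := v)"]) (auto simp: add.commute)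
qed

lemma homogeneous_add: "homogeneous d p \<Longrightarrow> homogeneous d q \<Longrightarrow> homogeneous d (p + q)"
  using Poly_Mapping.keys_add[of p q] by (auto simp: homogeneous_def)

lemma homogeneous_0 [simp]: "homogeneous d 0" by (simp add: homogeneous_def)

lemma homogeneous_sum: "(\<And>x. x \<in> A \<Longrightarrow> homogeneous d (f x)) \<Longrightarrow> homogeneous d (\<Sum>x\<in>A. f x)"
  by (induction A rule: infinite_finite_induct) (auto intro: homogeneous_add)

lemma homogeneous_mult: "homogeneous d p \<Longrightarrow> homogeneous e q \<Longrightarrow> homogeneous (d + e) (p * q)"
  using Poly_Mapping.keys_mult[of p q] by (fastforce simp: homogeneous_def mdeg_add)

lemma homogeneous_single: "mdeg m = d \<Longrightarrow> homogeneous d (Poly_Mapping.single m c)"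
  by (auto simp: homogeneous_def)

lemma homogeneous_const: "homogeneous 0 (const c)"
  by (simp add: const_def homogeneous_single)

lemma homogeneous_one: "homogeneous 0 1"
  using homogeneous_const[of 1] by (simp add: const_def)

lemma homogeneous_Var: "homogeneous 1 (Var v)"
  by (simp add: Var_def homogeneous_single)

lemma homogeneous_prod:
  "finite A \<Longrightarrow> (\<And>x. x \<in> A \<Longrightarrow> homogeneous (d x) (f x)) \<Longrightarrow> homogeneous (\<Sum>x\<in>A. d x) (\<Prod>x\<in>A. f x)"
  by (induction A rule: finite_induct) (auto intro: homogeneous_mult homogeneous_one)

lemma homogeneous_power: "homogeneous d p \<Longrightarrow> homogeneous (k * d) (p ^ k)"
  by (induction k) (auto intro: homogeneous_mult homogeneous_one)

lemma homogeneous_const_mult: "homogeneous d p \<Longrightarrow> homogeneous d (const c * p)"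
  using homogeneous_mult[OF homogeneous_const, of d p c] by simp

section \<open>Powers of linear forms\<close>

definition linear_form :: "('v \<Rightarrow> complex) \<Rightarrow> ('v::finite) cpoly" where
  "linear_form a = (\<Sum>v\<in>UNIV. const (a v) * Var v)"

lemma homogeneous_linear_form: "homogeneous 1 (linear_form a)"
  unfolding linear_form_def by (intro homogeneous_sum homogeneous_const_mult homogeneous_Var)

lemma eval_linear_form: "eval_poly x (linear_form a) = (\<Sum>v\<in>UNIV. a v * x v)"
  by (simp add: linear_form_def eval_poly_sum eval_poly_mult)

lemma lookup_Var_mult:
  "Poly_Mapping.lookup (Var v * p) m =
    (if Poly_Mapping.lookup m v = 0 then 0 else Poly_Mapping.lookup p (m - Poly_Mapping.single v 1))"
proof -
  have *: "Poly_Mapping.single v 1 + m' = m \<longleftrightarrow> Poly_Mapping.lookup m v \<noteq> 0 \<and> m' = m - Poly_Mapping.single v 1" for m'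
  proof
    assume "Poly_Mapping.single v 1 + m' = m"
    then show "Poly_Mapping.lookup m v \<noteq> 0 \<and> m' = m - Poly_Mapping.single v 1"
      by (auto simp: lookup_add)
  next
    assume "Poly_Mapping.lookup m v \<noteq> 0 \<and> m' = m - Poly_Mapping.single v 1"
    then show "Poly_Mapping.single v 1 + m' = m"
      by (intro poly_mapping_eqI) (auto simp: lookup_add lookup_minus lookup_single when_def)
  qed
  have "Poly_Mapping.lookup (Var v * p) m =
    (\<Sum>m'\<in>Poly_Mapping.keys p. Poly_Mapping.lookup p m' when Poly_Mapping.single v 1 + m' = m)"
    by (subst (1) cpoly_decomp[of p]) (simp add: Var_def sum_distrib_left mult_single lookup_sum lookup_single)
  also have "\<dots> = (\<Sum>m'\<in>Poly_Mapping.keys p. if m' = m - Poly_Mapping.single v 1 then (if Poly_Mapping.lookup m v = 0 then 0 else Poly_Mapping.lookup p m') else 0)"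
    unfolding * by (intro sum.cong) (auto simp: when_def)
  finally show ?thesis by (simp add: in_keys_iff)
qed

definition mfact :: "('v::finite) monomial \<Rightarrow> complex" where
  "mfact m = (\<Prod>v\<in>UNIV. fact (Poly_Mapping.lookup m v))"

lemma mfact_nonzero [simp]: "mfact m \<noteq> 0" by (simp add: mfact_def)

text \<open>The multinomial theorem with denominators cleared. When one factor of the power is split
  off, each variable \<open>v\<close> contributes in proportion to its exponent in \<open>m\<close>,
  and the exponents add up to the degree \<open>Suc N\<close>.\<close>

lemma multinomial:
  fixes m :: "('v::finite) monomial"
  assumes "mdeg m = N"
  shows "mfact m * Poly_Mapping.lookup (linear_form a ^ N) m = fact N * monom_val a m"
  using assms
proof (induction N arbitrary: m)
  case 0
  then show ?case by (simp add: mdeg_eq_0 mfact_def)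
next
  case (Suc N)
  have summand: "mfact m * (a v * Poly_Mapping.lookup (Var v * linear_form a ^ N) m)
    = of_nat (Poly_Mapping.lookup m v) * (fact N * monom_val a m)" for v
  proof (cases "Poly_Mapping.lookup m v = 0")
    case False
    define m' where "m' = m - Poly_Mapping.single v 1"
    have m: "m = m' + Poly_Mapping.single v 1"
      using False by (intro poly_mapping_eqI) (auto simp: m'_def lookup_add lookup_minus lookup_single when_def)
    then have d: "mdeg m' = N" using Suc.prems by (simp add: mdeg_add)
    have "mfact m = of_nat (Poly_Mapping.lookup m v) * mfact m'"
    proof -
      have "mfact m = fact (Poly_Mapping.lookup m v) * (\<Prod>u\<in>UNIV - {v}. fact (Poly_Mapping.lookup m u))"
        unfolding mfact_def by (subst prod.remove[of _ v]) auto
      also have "(\<Prod>u\<in>UNIV - {v}. fact (Poly_Mapping.lookup m u)) = (\<Prod>u\<in>UNIV - {v}. fact (Poly_Mapping.lookup m' u) :: complex)"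
        by (intro prod.cong) (auto simp: m lookup_add lookup_single)
      also have "fact (Poly_Mapping.lookup m v) = of_nat (Poly_Mapping.lookup m v) * (fact (Poly_Mapping.lookup m' v) :: complex)"
        by (simp add: m lookup_add)
      finally show ?thesis
        unfolding mfact_def by (subst (2) prod.remove[of _ v]) auto
    qed
    then show ?thesis
      using False Suc.IH[OF d] by (simp add: lookup_Var_mult flip: m'_def) (simp add: m monom_val_add mult_ac)
  qed (simp add: lookup_Var_mult)
  have "mfact m * Poly_Mapping.lookup (linear_form a ^ Suc N) m
      = (\<Sum>v\<in>UNIV. mfact m * (a v * Poly_Mapping.lookup (Var v * linear_form a ^ N) m))"
    by (subst power_Suc, subst (1) linear_form_def)
       (simp add: sum_distrib_right sum_distrib_left lookup_sum mult.assoc lookup_const_mult)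
  also have "\<dots> = of_nat (\<Sum>v\<in>UNIV. Poly_Mapping.lookup m v) * (fact N * monom_val a m)"
    by (simp add: summand sum_distrib_right)
  also have "(\<Sum>v\<in>UNIV. Poly_Mapping.lookup m v) = Suc N"
    using Suc.prems by (simp add: mdeg_superset[of UNIV])
  finally show ?case by (simp add: algebra_simps)
qed

section \<open>Derivatives and the pairing in monomial coordinates\<close>

lemma lookup_partial:
  "Poly_Mapping.lookup (partial v p) m =
     of_nat (Suc (Poly_Mapping.lookup m v)) * Poly_Mapping.lookup p (m + Poly_Mapping.single v 1)"
proof -
  have *: "(of_nat (Poly_Mapping.lookup m' v) * c when m' - Poly_Mapping.single v 1 = m)
     = (if m' = m + Poly_Mapping.single v 1 then of_nat (Suc (Poly_Mapping.lookup m v)) * c else 0)" for m' and c :: complex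
  proof (cases "Poly_Mapping.lookup m' v = 0")
    case True
    then have "m' \<noteq> m + Poly_Mapping.single v 1" by (auto simp: lookup_add)
    then show ?thesis using True by simp
  next
    case False
    then have "m' - Poly_Mapping.single v 1 = m \<longleftrightarrow> m' = m + Poly_Mapping.single v 1"
      by (auto intro!: poly_mapping_eqI simp: lookup_add lookup_minus lookup_single when_def)
    then show ?thesis by (auto simp: lookup_add when_def)
  qed
  have "Poly_Mapping.lookup (partial v p) m =
    (\<Sum>m'\<in>Poly_Mapping.keys p. if m' = m + Poly_Mapping.single v 1 then of_nat (Suc (Poly_Mapping.lookup m v)) * Poly_Mapping.lookup p m' else 0)"
    unfolding partial_def lookup_sum lookup_single by (intro sum.cong refl *)
  then show ?thesis by (auto simp: in_keys_iff)
qed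

lemma lookup_partial_power:
  assumes "Poly_Mapping.lookup m v = 0"
  shows "Poly_Mapping.lookup ((partial v ^^ k) p) m = fact k * Poly_Mapping.lookup p (m + Poly_Mapping.single v k)"
  using assms
proof -
  \<comment> \<open>Stated for an arbitrary exponent \<open>i\<close> of \<open>v\<close>, because
    each derivative raises the exponent at which \<open>p\<close> is read.\<close>
  have "Poly_Mapping.lookup ((partial v ^^ k) p) (m + Poly_Mapping.single v i)
      = fact (i + k) / fact i * Poly_Mapping.lookup p (m + Poly_Mapping.single v (i + k))" for i
  proof (induction k arbitrary: i)
    case (Suc k)
    have "Poly_Mapping.lookup ((partial v ^^ Suc k) p) (m + Poly_Mapping.single v i)
       = of_nat (Suc i) * Poly_Mapping.lookup ((partial v ^^ k) p) (m + Poly_Mapping.single v (Suc i))"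
      using assms by (simp add: lookup_partial lookup_add add.assoc flip: single_add)
    then show ?case by (simp add: Suc.IH divide_simps del: of_nat_Suc)
  qed simp
  from this[of 0] show ?thesis by simp
qed

lemma lookup_monomial_diff_0:
  fixes m :: "('v::finite) monomial"
  shows "Poly_Mapping.lookup (monomial_diff m p) 0 = mfact m * Poly_Mapping.lookup p m"
proof -
  define f where "f v = partial v ^^ Poly_Mapping.lookup m v" for v :: 'v
  interpret comp_fun_commute f
  proof
    fix x y :: 'v
    have 1: "(partial y ^^ j) (partial x p) = partial x ((partial y ^^ j) p)" for j p
      by (induction j) (simp_all add: partial_commute[of y x])
    have "(partial y ^^ j) ((partial x ^^ k) p) = (partial x ^^ k) ((partial y ^^ j) p)" for j k p
      by (induction k) (simp_all add: 1)
    then show "f y \<circ> f x = f x \<circ> f y"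
      by (simp add: f_def fun_eq_iff)
  qed
  \<comment> \<open>Requiring \<open>m'\<close> to avoid \<open>A\<close> makes the one-variable
    formula applicable; the induction replaces \<open>m'\<close> by its product with a power of the
    new variable, which still avoids the rest of \<open>A\<close>.\<close>
  have "Poly_Mapping.lookup (Finite_Set.fold f p A) m' =
     (\<Prod>v\<in>A. fact (Poly_Mapping.lookup m v)) * Poly_Mapping.lookup p (m' + (\<Sum>v\<in>A. Poly_Mapping.single v (Poly_Mapping.lookup m v)))"
    if "finite A" "\<forall>v\<in>A. Poly_Mapping.lookup m' v = 0" for A m'
    using that
  proof (induction A arbitrary: m' rule: finite_induct)
    case (insert v A)
    have "Poly_Mapping.lookup (m' + Poly_Mapping.single v (Poly_Mapping.lookup m v)) u = 0" if "u \<in> A" for u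
      using that insert by (auto simp: lookup_add lookup_single when_def)
    then show ?case
      using insert by (simp add: f_def[of v] lookup_partial_power add.assoc)
  qed simp
  from this[of "Poly_Mapping.keys m" 0]
  have "Poly_Mapping.lookup (monomial_diff m p) 0 =
    (\<Prod>v\<in>Poly_Mapping.keys m. fact (Poly_Mapping.lookup m v)) * Poly_Mapping.lookup p (\<Sum>v\<in>Poly_Mapping.keys m. Poly_Mapping.single v (Poly_Mapping.lookup m v))"
    by (simp add: monomial_diff_def f_def[abs_def])
  also have "(\<Sum>v\<in>Poly_Mapping.keys m. Poly_Mapping.single v (Poly_Mapping.lookup m v)) = m"
    by (rule poly_mapping_eqI) (auto simp: lookup_sum lookup_single when_def in_keys_iff)
  also have "(\<Prod>v\<in>Poly_Mapping.keys m. fact (Poly_Mapping.lookup m v)) = mfact m"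
    unfolding mfact_def by (intro prod.mono_neutral_left) (auto simp: in_keys_iff)
  finally show ?thesis .
qed

text \<open>Only equal monomials pair nontrivially. The free choice of \<open>A\<close> allows sums
  over all monomials of a degree, whatever the support of \<open>p\<close>.\<close>

lemma pairing_eq:
  fixes p q :: "('v::finite) cpoly"
  assumes "finite A" "Poly_Mapping.keys p \<subseteq> A"
  shows "pairing p q = (\<Sum>m\<in>A. Poly_Mapping.lookup p m * (mfact m * Poly_Mapping.lookup q m))"
proof -
  have "pairing p q = (\<Sum>m\<in>Poly_Mapping.keys p. Poly_Mapping.lookup p m * (mfact m * Poly_Mapping.lookup q m))"
    by (simp add: pairing_def diff_op_def lookup_sum lookup_const_mult lookup_monomial_diff_0)
  also have "\<dots> = (\<Sum>m\<in>A. Poly_Mapping.lookup p m * (mfact m * Poly_Mapping.lookup q m))"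
    using assms by (intro sum.mono_neutral_left) (auto simp: in_keys_iff)
  finally show ?thesis .
qed

section \<open>Haar integrals over SU(n)\<close>

definition adjoint_matrix :: "complex^'n^'m \<Rightarrow> complex^'m^'n" where
  "adjoint_matrix A = (\<chi> i j. cnj (A $ j $ i))"

lemma adjoint_matrix_mult: "adjoint_matrix (A ** B) = adjoint_matrix B ** adjoint_matrix A"
  by (simp add: adjoint_matrix_def matrix_matrix_mult_def vec_eq_iff mult.commute)

lemma adjoint_adjoint_matrix [simp]: "adjoint_matrix (adjoint_matrix A) = A"
  by (simp add: adjoint_matrix_def vec_eq_iff)

lemma SU_iff: "A \<in> SU \<longleftrightarrow> A ** adjoint_matrix A = mat 1 \<and> det A = 1"
  by (simp add: SU_def adjoint_matrix_def)

lemma adjoint_in_SU: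
  assumes "A \<in> SU"
  shows "adjoint_matrix A \<in> SU"
proof -
  have *: "A ** adjoint_matrix A = mat 1" "det A = 1" using assms by (auto simp: SU_iff)
  then have "det A * det (adjoint_matrix A) = 1" by (metis det_I det_mul)
  with * show ?thesis by (simp add: SU_iff matrix_left_right_inverse)
qed

lemma SU_inverse: "A \<in> SU \<Longrightarrow> A ** adjoint_matrix A = mat 1" "A \<in> SU \<Longrightarrow> adjoint_matrix A ** A = mat 1"
  using adjoint_in_SU[of A] by (auto simp: SU_iff)

lemma SU_mult:
  assumes "A \<in> SU" "B \<in> SU"
  shows "A ** B \<in> SU"
proof -
  have "(A ** B) ** (adjoint_matrix B ** adjoint_matrix A) = A ** (B ** adjoint_matrix B) ** adjoint_matrix A"
    by (simp add: matrix_mul_assoc)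
  then show ?thesis
    using assms by (simp add: SU_iff adjoint_matrix_mult det_mul)
qed

lemma continuous_on_det:
  fixes f :: "'b::topological_space \<Rightarrow> complex^'n^'n"
  shows "(\<And>i j. continuous_on S (\<lambda>x. f x $ i $ j)) \<Longrightarrow> continuous_on S (\<lambda>x. det (f x))"
  unfolding det_def by (intro continuous_on_sum continuous_on_mult continuous_on_const continuous_on_prod)

text \<open>The diagonal entries of \<open>A ** adjoint_matrix A\<close> say that the rows are unit
  vectors.\<close>

lemma norm_SU_entry:
  assumes "A \<in> SU"
  shows "norm (A $ i $ j) \<le> 1"
proof -
  have "(A ** adjoint_matrix A) $ i $ i = 1" using assms by (simp add: SU_iff mat_def)
  then have "(\<Sum>k\<in>UNIV. complex_of_real ((norm (A $ i $ k))\<^sup>2)) = 1"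
    by (simp add: matrix_matrix_mult_def adjoint_matrix_def complex_norm_square[symmetric])
  then have *: "(\<Sum>k\<in>UNIV. (norm (A $ i $ k))\<^sup>2) = 1"
    by (metis of_real_1 of_real_eq_iff of_real_sum)
  have "(norm (A $ i $ j))\<^sup>2 \<le> (\<Sum>k\<in>UNIV. (norm (A $ i $ k))\<^sup>2)"
    by (rule member_le_sum) auto
  then show ?thesis using * by (simp add: power2_le_iff_abs_le abs_square_le_1)
qed

lemma compact_SU: "compact (SU :: (complex^'n^'n) set)"
proof (rule compact_eq_bounded_closed[THEN iffD2], intro conjI)
  have "norm A \<le> (\<Sum>i\<in>(UNIV::'n set). \<Sum>j\<in>(UNIV::'n set). 1)" if "A \<in> SU" for A :: "complex^'n^'n"
  proof -
    have "norm A \<le> (\<Sum>i\<in>UNIV. norm (A $ i))" unfolding norm_vec_def[of A] by (rule L2_set_le_sum) auto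
    also have "\<dots> \<le> (\<Sum>i\<in>UNIV. \<Sum>j\<in>UNIV. norm (A $ i $ j))"
      by (intro sum_mono) (simp add: norm_vec_def L2_set_le_sum)
    also have "\<dots> \<le> (\<Sum>i\<in>(UNIV::'n set). \<Sum>j\<in>(UNIV::'n set). 1)"
      by (intro sum_mono norm_SU_entry that)
    finally show ?thesis .
  qed
  then show "bounded (SU :: (complex^'n^'n) set)" unfolding bounded_iff by blast
  have c1: "closed {A :: complex^'n^'n. A ** adjoint_matrix A = mat 1}"
    unfolding adjoint_matrix_def matrix_matrix_mult_def
    by (intro closed_Collect_eq continuous_intros)
  have c2: "closed {A :: complex^'n^'n. det A = 1}"
    by (intro closed_Collect_eq continuous_on_det continuous_intros)
  have eq: "(SU :: (complex^'n^'n) set) = {A. A ** adjoint_matrix A = mat 1} \<inter> {A. det A = 1}"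
    by (auto simp: SU_iff)
  show "closed (SU :: (complex^'n^'n) set)" unfolding eq by (rule closed_Int[OF c1 c2])
qed

section \<open>Integration against Haar measure\<close>

locale SU_haar =
  fixes \<mu> :: "(complex^'n::finite^'n) measure"
  assumes haar: "haar_measure SU \<mu>"
begin

lemma sets_mu: "sets \<mu> = sets (restrict_space borel SU)"
  and space_mu: "space \<mu> = SU"
proof -
  show *: "sets \<mu> = sets (restrict_space borel SU)" using haar by (simp add: haar_measure_def)
  show "space \<mu> = SU" using sets_eq_imp_space_eq[OF *] by (simp add: space_restrict_space)
qed

sublocale finite_measure \<mu>
proof
  show "emeasure \<mu> (space \<mu>) \<noteq> \<infinity>"
    using haar compact_SU unfolding space_mu haar_measure_def by (metis order_less_irrefl subset_refl)
qed

lemma measure_SU: "measure \<mu> SU \<noteq> 0"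
  using haar by (simp add: haar_measure_def emeasure_eq_measure)

lemma measurable_cont:
  fixes f :: "_ \<Rightarrow> 'b::topological_space"
  shows "continuous_on SU f \<Longrightarrow> f \<in> borel_measurable \<mu>"
  using borel_measurable_continuous_on_restrict measurable_cong_sets[OF sets_mu refl] by blast

lemma integrable_cont:
  fixes f :: "_ \<Rightarrow> complex"
  assumes "continuous_on SU f"
  shows "integrable \<mu> f"
proof -
  have "bounded (f ` SU)" using assms compact_SU compact_continuous_image compact_imp_bounded by blast
  then obtain B where "\<forall>x\<in>SU. norm (f x) \<le> B" unfolding bounded_iff by auto
  then show ?thesis
    by (intro integrable_const_bound[of _ B] measurable_cont assms AE_I2) (simp add: space_mu)
qed

lemma integral_translate:
  fixes f :: "_ \<Rightarrow> complex"
  assumes h: "h \<in> SU" and f: "continuous_on SU f"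
  shows "(LINT g|\<mu>. f (h ** g)) = (LINT g|\<mu>. f g)"
proof -
  let ?T = "\<lambda>g. h ** g"
  have "continuous_on SU ?T"
    unfolding matrix_matrix_mult_def by (intro continuous_intros)
  then have "?T \<in> measurable \<mu> borel" by (rule measurable_cont)
  then have "?T \<in> measurable \<mu> (restrict_space borel SU)"
    using h by (intro measurable_restrict_space2) (auto simp: space_mu SU_mult)
  then have T: "?T \<in> measurable \<mu> \<mu>" using measurable_cong_sets[OF refl sets_mu] by blast
  have "distr \<mu> \<mu> ?T = \<mu>"
  proof (rule measure_eqI)
    fix A assume "A \<in> sets (distr \<mu> \<mu> ?T)"
    then have A: "A \<in> sets \<mu>" by simp
    then have sub: "A \<subseteq> SU" using sets.sets_into_space space_mu by auto
    \<comment> \<open>Haar invariance speaks of images, the push-forward of preimages; the preimage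
      under \<open>h\<close> is the image under its inverse, the adjoint.\<close>
    have "?T -` A \<inter> space \<mu> = (\<lambda>g. adjoint_matrix h ** g) ` A"
    proof (intro equalityI subsetI)
      fix x assume "x \<in> ?T -` A \<inter> space \<mu>"
      then have "h ** x \<in> A" "x = adjoint_matrix h ** (h ** x)"
        using h by (auto simp: matrix_mul_assoc SU_inverse)
      then show "x \<in> (\<lambda>g. adjoint_matrix h ** g) ` A" by blast
    next
      fix x assume "x \<in> (\<lambda>g. adjoint_matrix h ** g) ` A"
      then obtain g where g: "g \<in> A" "x = adjoint_matrix h ** g" by blast
      then have "h ** x = g" using h by (simp add: matrix_mul_assoc SU_inverse)
      then show "x \<in> ?T -` A \<inter> space \<mu>"
        using g sub h by (auto simp: space_mu intro: SU_mult adjoint_in_SU)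
    qed
    then have "emeasure (distr \<mu> \<mu> ?T) A = emeasure \<mu> ((\<lambda>g. adjoint_matrix h ** g) ` A)"
      using A T by (simp add: emeasure_distr)
    also have "\<dots> = emeasure \<mu> A"
      using haar A adjoint_in_SU[OF h] by (simp add: haar_measure_def)
    finally show "emeasure (distr \<mu> \<mu> ?T) A = emeasure \<mu> A" .
  qed simp
  then show ?thesis using integral_distr[OF T measurable_cont[OF f]] by simp
qed

end

text \<open>Multiplication by \<open>T\<close> acts on words in the matrix entries like a tensor
  power: the row word \<open>p\<close> is expanded with coefficients free of \<open>X\<close>, and
  the column word \<open>q\<close> stays fixed. Integrals over \<open>X\<close> thus pass to linear
  combinations.\<close>

lemma matrix_mult_word:
  fixes T X :: "complex^'n^'n" and p q :: "'a::finite \<Rightarrow> 'n"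
  shows "(\<Prod>a\<in>UNIV. (T ** X) $ p a $ q a)
    = (\<Sum>k\<in>UNIV. (\<Prod>a\<in>UNIV. T $ p a $ k a) * (\<Prod>a\<in>UNIV. X $ k a $ q a))"
proof -
  have "(\<Prod>a\<in>UNIV. (T ** X) $ p a $ q a) = (\<Prod>a\<in>UNIV. \<Sum>k\<in>UNIV. T $ p a $ k * X $ k $ q a)"
    by (simp add: matrix_matrix_mult_def)
  also have "\<dots> = (\<Sum>k\<in>UNIV. \<Prod>a\<in>UNIV. T $ p a $ k a * X $ k a $ q a)"
    by (subst prod_sum_PiE) auto
  finally show ?thesis by (simp add: prod.distrib)
qed

section \<open>Plane and diagonal matrices\<close>

definition plane_matrix :: "'n \<Rightarrow> 'n \<Rightarrow> complex \<Rightarrow> complex \<Rightarrow> complex \<Rightarrow> complex \<Rightarrow> complex^'n::finite^'n" where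
  "plane_matrix i j a b c d = (\<chi> m k. if m = i then (if k = i then a else if k = j then b else 0)
     else if m = j then (if k = i then c else if k = j then d else 0) else of_bool (m = k))"

lemma plane_matrix_mult:
  assumes "i \<noteq> j"
  shows "(plane_matrix i j a b c d ** X) $ m $ k =
    (if m = i then a * X $ i $ k + b * X $ j $ k else if m = j then c * X $ i $ k + d * X $ j $ k else X $ m $ k)"
proof -
  have "(plane_matrix i j a b c d ** X) $ m $ k = (\<Sum>l\<in>UNIV. plane_matrix i j a b c d $ m $ l * X $ l $ k)"
    by (simp add: matrix_matrix_mult_def)
  also have "\<dots> = (\<Sum>l\<in>{i, j, m}. plane_matrix i j a b c d $ m $ l * X $ l $ k)"
    by (intro sum.mono_neutral_right) (auto simp: plane_matrix_def)
  also have "\<dots> = (if m = i then a * X $ i $ k + b * X $ j $ k else if m = j then c * X $ i $ k + d * X $ j $ k else X $ m $ k)"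
    using assms by (auto simp: plane_matrix_def insert_commute)
  finally show ?thesis .
qed

lemma plane_matrix_mult_plane_matrix:
  assumes "i \<noteq> j"
  shows "plane_matrix i j a b c d ** plane_matrix i j a' b' c' d'
    = plane_matrix i j (a * a' + b * c') (a * b' + b * d') (c * a' + d * c') (c * b' + d * d')"
  using assms by (auto simp: vec_eq_iff plane_matrix_mult) (auto simp: plane_matrix_def)

lemma plane_matrix_one: "i \<noteq> j \<Longrightarrow> plane_matrix i j 1 0 0 1 = mat 1"
  by (auto simp: vec_eq_iff plane_matrix_def mat_def)

text \<open>Factorization into lower unitriangular, diagonal and upper unitriangular parts, with
  \<open>a\<close> as the pivot.\<close>

lemma det_plane_matrix:
  assumes "i \<noteq> j" "a \<noteq> 0"
  shows "det (plane_matrix i j a b c d) = a * d - b * c"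
proof -
  have up: "det (plane_matrix i j 1 t 0 1) = 1" if "i \<noteq> j" for i j :: 'a and t
  proof -
    have "plane_matrix i j 1 t 0 1 = (\<chi> k. if k = i then row i (mat 1) + t *s row j (mat 1) else row k (mat 1))"
      using that by (auto simp: vec_eq_iff plane_matrix_def row_def mat_def)
    then show ?thesis using det_row_operation[OF that, of "mat 1" t] by simp
  qed
  have low: "det (plane_matrix i j 1 0 t 1) = 1" for t
  proof -
    have "plane_matrix i j 1 0 t 1 = plane_matrix j i 1 t 0 1"
      using assms by (auto simp: vec_eq_iff plane_matrix_def)
    then show ?thesis using up assms by simp
  qed
  have "det (plane_matrix i j a 0 0 (d - b * c / a)) = (\<Prod>k\<in>UNIV. plane_matrix i j a 0 0 (d - b * c / a) $ k $ k)"
    using assms by (intro det_diagonal) (auto simp: plane_matrix_def)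
  also have "\<dots> = (\<Prod>k\<in>{i, j}. plane_matrix i j a 0 0 (d - b * c / a) $ k $ k)"
    by (intro prod.mono_neutral_right) (auto simp: plane_matrix_def)
  also have "\<dots> = a * d - b * c"
    using assms by (simp add: plane_matrix_def field_simps)
  finally have diag: "det (plane_matrix i j a 0 0 (d - b * c / a)) = a * d - b * c" .
  have "plane_matrix i j a b c d = plane_matrix i j 1 0 (c / a) 1 ** plane_matrix i j a 0 0 (d - b * c / a) ** plane_matrix i j 1 (b / a) 0 1"
    using assms by (simp add: plane_matrix_mult_plane_matrix)
  then show ?thesis using assms(1) by (simp add: det_mul up low diag)
qed

lemma rotation_in_SU:
  assumes "i \<noteq> j" "a \<noteq> 0" "a\<^sup>2 + b\<^sup>2 = 1"
  shows "plane_matrix i j (of_real a) (of_real b) (- of_real b) (of_real a) \<in> SU"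
proof -
  have ab: "complex_of_real a * of_real a + of_real b * of_real b = 1"
    using assms(3) by (metis of_real_1 of_real_add of_real_mult power2_eq_square)
  have "adjoint_matrix (plane_matrix i j (of_real a) (of_real b) (- of_real b) (of_real a))
     = plane_matrix i j (of_real a) (- of_real b) (of_real b) (of_real a)"
    using assms(1) by (auto simp: adjoint_matrix_def plane_matrix_def vec_eq_iff)
  then show ?thesis
    using assms ab by (simp add: SU_iff plane_matrix_mult_plane_matrix det_plane_matrix plane_matrix_one add.commute)
qed

definition diag_matrix :: "('n \<Rightarrow> complex) \<Rightarrow> complex^'n::finite^'n" where
  "diag_matrix d = (\<chi> i j. if i = j then d i else 0)"

lemma diag_matrix_mult: "(diag_matrix d ** X) $ i $ j = d i * X $ i $ j"
  by (simp add: diag_matrix_def matrix_matrix_mult_def if_distrib[of "\<lambda>x. x * _"] cong: if_cong)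

lemma mult_diag_matrix: "(X ** diag_matrix d) $ i $ j = X $ i $ j * d j"
  by (simp add: diag_matrix_def matrix_matrix_mult_def if_distrib[of "\<lambda>x. _ * x"] cong: if_cong)

lemma det_diag_matrix: "det (diag_matrix d) = (\<Prod>i\<in>UNIV. d i)"
  by (subst det_diagonal) (auto simp: diag_matrix_def)

lemma plane_matrix_diag: "i \<noteq> j \<Longrightarrow> plane_matrix i j a 0 0 d = diag_matrix (\<lambda>k. if k = i then a else if k = j then d else 1)"
  by (auto simp: plane_matrix_def diag_matrix_def vec_eq_iff)

lemma diag_in_SU:
  assumes "\<And>i. norm (d i) = 1" "(\<Prod>i\<in>UNIV. d i) = 1"
  shows "diag_matrix d \<in> SU"
proof -
  have "(diag_matrix d ** adjoint_matrix (diag_matrix d)) $ i $ j = mat 1 $ i $ j" for i j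
    unfolding diag_matrix_mult using assms(1)[of i]
    by (auto simp: adjoint_matrix_def diag_matrix_def mat_def complex_norm_square[symmetric])
  then have "diag_matrix d ** adjoint_matrix (diag_matrix d) = mat 1" by (simp add: vec_eq_iff)
  then show ?thesis using assms by (simp add: SU_iff det_diag_matrix)
qed

lemma prod_fibres:
  fixes p :: "'a::finite \<Rightarrow> 'n::finite" and d :: "'n \<Rightarrow> complex"
  shows "(\<Prod>a\<in>UNIV. d (p a)) = (\<Prod>i\<in>UNIV. d i ^ card {a. p a = i})"
proof -
  have "(\<Prod>a\<in>UNIV. d (p a)) = (\<Prod>i\<in>UNIV. \<Prod>a\<in>{a\<in>UNIV. p a = i}. d (p a))"
    by (rule prod.group[symmetric]) auto
  also have "\<dots> = (\<Prod>i\<in>UNIV. d i ^ card {a. p a = i})" by (intro prod.cong) auto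
  finally show ?thesis .
qed

section \<open>Behaviour of degree n^2 integrals under matrix multiplication\<close>

context SU_haar
begin

text \<open>Words indexed by \<open>'n \<times> 'n\<close> have length n^2. Requiring the identity
  for all words at once makes the property multiplicative in \<open>T\<close>.\<close>

definition semi_invariant :: "complex^'n^'n \<Rightarrow> bool" where
  "semi_invariant T \<longleftrightarrow> (\<forall>p q :: 'n \<times> 'n \<Rightarrow> 'n.
     (LINT g|\<mu>. (\<Prod>a\<in>UNIV. (T ** g) $ p a $ q a)) = det T ^ CARD('n) * (LINT g|\<mu>. (\<Prod>a\<in>UNIV. g $ p a $ q a)))"

lemma integrable_word: "integrable \<mu> (\<lambda>g. \<Prod>a\<in>UNIV. (T ** g) $ p a $ q a)"
  unfolding matrix_matrix_mult_def by (intro integrable_cont) (auto intro!: continuous_intros)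

lemma semi_invariant_mult:
  assumes "semi_invariant S" "semi_invariant T"
  shows "semi_invariant (S ** T)"
  unfolding semi_invariant_def
proof (intro allI)
  fix p q :: "'n \<times> 'n \<Rightarrow> 'n"
  have i: "integrable \<mu> (\<lambda>g. \<Prod>a\<in>UNIV. g $ k a $ q a)" for k :: "'n \<times> 'n \<Rightarrow> 'n"
    using integrable_word[of "mat 1" k q] by simp
  have "(LINT g|\<mu>. (\<Prod>a\<in>UNIV. (S ** T ** g) $ p a $ q a))
     = (\<Sum>k\<in>UNIV. (\<Prod>a\<in>UNIV. S $ p a $ k a) * (LINT g|\<mu>. (\<Prod>a\<in>UNIV. (T ** g) $ k a $ q a)))"
    by (simp add: matrix_mult_word[of S] integrable_word flip: matrix_mul_assoc)
  also have "\<dots> = det T ^ CARD('n) * (\<Sum>k\<in>UNIV. (\<Prod>a\<in>UNIV. S $ p a $ k a) * (LINT g|\<mu>. (\<Prod>a\<in>UNIV. g $ k a $ q a)))"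
    using assms by (simp add: semi_invariant_def sum_distrib_left mult_ac)
  also have "(\<Sum>k\<in>UNIV. (\<Prod>a\<in>UNIV. S $ p a $ k a) * (LINT g|\<mu>. (\<Prod>a\<in>UNIV. g $ k a $ q a)))
     = (LINT g|\<mu>. (\<Prod>a\<in>UNIV. (S ** g) $ p a $ q a))"
    by (simp add: matrix_mult_word[of S] i)
  finally show "(LINT g|\<mu>. (\<Prod>a\<in>UNIV. (S ** T ** g) $ p a $ q a)) = det (S ** T) ^ CARD('n) * (LINT g|\<mu>. (\<Prod>a\<in>UNIV. g $ p a $ q a))"
    using assms by (simp add: semi_invariant_def det_mul power_mult_distrib)
qed

lemma semi_invariant_SU: "h \<in> SU \<Longrightarrow> semi_invariant h"
  unfolding semi_invariant_def
  by (subst integral_translate) (auto simp: SU_iff intro!: continuous_intros)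

text \<open>Some diagonal element of SU(n), acting on the rows \<open>i\<close> and \<open>j\<close>
  only, multiplies the word by a scalar other than 1 but leaves the integral unchanged.\<close>

lemma word_integral_eq_0:
  fixes p q :: "'n \<times> 'n \<Rightarrow> 'n"
  assumes "card {a. p a = i} \<noteq> card {a. p a = j}"
  shows "(LINT g|\<mu>. (\<Prod>a\<in>UNIV. g $ p a $ q a)) = 0"
proof -
  define r where "r i = card {a. p a = i}" for i
  have cis_cancel: "cis a = cis b" if "cis a * cis (- b) = 1" for a b
  proof -
    have "cis a = cis a * (cis (- b) * cis b)" by (simp only: cis_mult) simp
    also have "\<dots> = cis b" by (simp only: mult.assoc[symmetric] that mult_1_left)
    finally show ?thesis .
  qed
  \<comment> \<open>The angle is small enough for both \<open>r i * \<theta>\<close> and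
    \<open>r j * \<theta>\<close> to lie in [0, \<pi>], where the cosine is injective; equal cosines
    therefore force equal counts.\<close>
  define \<theta> :: real where "\<theta> = pi / (real (r i) + real (r j) + 1)"
  have \<theta>_pos: "\<theta> > 0" unfolding \<theta>_def by (intro divide_pos_pos) auto
  define d where "d k = (if k = i then cis \<theta> else if k = j then cis (- \<theta>) else 1)" for k
  have ij: "i \<noteq> j" using assms by auto
  have prod_ij: "(\<Prod>k\<in>UNIV. f k) = f i * f j" if "\<And>k. k \<noteq> i \<Longrightarrow> k \<noteq> j \<Longrightarrow> f k = 1" for f :: "'n \<Rightarrow> complex"
  proof -
    have "(\<Prod>k\<in>UNIV. f k) = (\<Prod>k\<in>{i, j}. f k)" by (intro prod.mono_neutral_right) (auto simp: that)
    then show ?thesis using ij by simp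
  qed
  have "semi_invariant (diag_matrix d)"
    by (intro semi_invariant_SU diag_in_SU) (use ij in \<open>auto simp: d_def prod_ij cis_mult\<close>)
  then have "(\<Prod>a\<in>UNIV. d (p a)) * (LINT g|\<mu>. (\<Prod>a\<in>UNIV. g $ p a $ q a)) = (LINT g|\<mu>. (\<Prod>a\<in>UNIV. g $ p a $ q a))"
  proof -
    have "det (diag_matrix d) = 1" using ij by (auto simp: det_diag_matrix d_def prod_ij cis_mult)
    then have "(LINT g|\<mu>. (\<Prod>a\<in>UNIV. (diag_matrix d ** g) $ p a $ q a)) = (LINT g|\<mu>. (\<Prod>a\<in>UNIV. g $ p a $ q a))"
      using \<open>semi_invariant (diag_matrix d)\<close> by (simp add: semi_invariant_def)
    then show ?thesis by (simp add: diag_matrix_mult prod.distrib)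
  qed
  moreover have "(\<Prod>a\<in>UNIV. d (p a)) \<noteq> 1"
  proof
    assume "(\<Prod>a\<in>UNIV. d (p a)) = 1"
    moreover have "(\<Prod>a\<in>UNIV. d (p a)) = d i ^ r i * d j ^ r j"
      unfolding prod_fibres r_def by (rule prod_ij) (simp add: d_def)
    ultimately have "cis \<theta> ^ r i * cis (- \<theta>) ^ r j = 1"
      using ij by (simp add: d_def)
    then have "cis (real (r i) * \<theta>) * cis (- (real (r j) * \<theta>)) = 1"
      unfolding Complex.DeMoivre by (simp only: mult_minus_right)
    then have "cis (real (r i) * \<theta>) = cis (real (r j) * \<theta>)"
      using cis_cancel by blast
    then have cos_eq: "cos (real (r i) * \<theta>) = cos (real (r j) * \<theta>)" by (metis cis.sel(1))
    have bounds: "0 \<le> real (r k) * \<theta>" "real (r k) * \<theta> \<le> pi" if "k = i \<or> k = j" for k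
    proof -
      have "real (r k) * \<theta> \<le> (real (r i) + real (r j) + 1) * \<theta>"
        using that \<theta>_pos by (intro mult_right_mono) auto
      also have "\<dots> = pi" using \<theta>_pos by (simp add: \<theta>_def)
      finally show "real (r k) * \<theta> \<le> pi" .
      show "0 \<le> real (r k) * \<theta>" using \<theta>_pos by simp
    qed
    have "real (r i) * \<theta> = real (r j) * \<theta>"
      by (rule cos_inj_pi[OF bounds(1) bounds(2) bounds(1) bounds(2) cos_eq]) simp_all
    then show False using assms \<theta>_pos by (simp add: r_def)
  qed
  ultimately show ?thesis by simp
qed

text \<open>If the rows occur unequally often, the integral vanishes on both sides. Otherwise each
  of the n rows occurs n times among the n^2 letters, and the scalar is the determinant to the power
  n. This covers all diagonal matrices, also singular ones.\<close>

lemma semi_invariant_diag: "semi_invariant (diag_matrix d)"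
  unfolding semi_invariant_def
proof (intro allI)
  fix p q :: "'n \<times> 'n \<Rightarrow> 'n"
  show "(LINT g|\<mu>. (\<Prod>a\<in>UNIV. (diag_matrix d ** g) $ p a $ q a)) = det (diag_matrix d) ^ CARD('n) * (LINT g|\<mu>. (\<Prod>a\<in>UNIV. g $ p a $ q a))"
  proof (cases "\<forall>i j. card {a. p a = i} = card {a. p a = j}")
    case False
    then have "(LINT g|\<mu>. (\<Prod>a\<in>UNIV. g $ p a $ q a)) = 0" using word_integral_eq_0 by blast
    then show ?thesis by (simp add: diag_matrix_mult prod.distrib)
  next
    case True
    have c: "card {a. p a = i} = CARD('n)" for i
    proof -
      have "CARD('n \<times> 'n) = (\<Sum>j\<in>UNIV. card {a\<in>UNIV. p a = j})"
        using sum.group[of "UNIV :: ('n \<times> 'n) set" "UNIV :: 'n set" p "\<lambda>_. 1::nat"] by simp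
      also have "\<dots> = (\<Sum>j\<in>(UNIV::'n set). card {a. p a = i})" using True by (intro sum.cong) auto
      finally show ?thesis by simp
    qed
    have "(\<Prod>a\<in>UNIV. d (p a)) = det (diag_matrix d) ^ CARD('n)"
      by (simp add: prod_fibres c det_diag_matrix prod_power_distrib)
    then show ?thesis by (simp add: diag_matrix_mult prod.distrib)
  qed
qed

lemma semi_invariant_plane:
  assumes "i \<noteq> j"
  shows "semi_invariant (plane_matrix i j 0 1 1 0)" "semi_invariant (plane_matrix i j 1 1 0 1)"
proof -
  have diag: "semi_invariant (plane_matrix i j a 0 0 d)" for a d
    using assms by (simp add: plane_matrix_diag semi_invariant_diag)
  have rot: "semi_invariant (plane_matrix i j (of_real a) (of_real b) (- of_real b) (of_real a))"
    if "a \<noteq> 0" "a\<^sup>2 + b\<^sup>2 = 1" for a b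
    using that assms by (intro semi_invariant_SU rotation_in_SU)
  have rot34: "semi_invariant (plane_matrix i j (3/5) (4/5) (- 4/5) (3/5))"
    using rot[of "3/5" "4/5"] by (simp add: power2_eq_square)
  have rot43: "semi_invariant (plane_matrix i j (4/5) (3/5) (- 3/5) (4/5))"
    using rot[of "4/5" "3/5"] by (simp add: power2_eq_square)
  have rot43': "semi_invariant (plane_matrix i j (4/5) (- 3/5) (3/5) (4/5))"
    using rot[of "4/5" "- 3/5"] by (simp add: power2_eq_square)
  \<comment> \<open>\<open>rotation_in_SU\<close> asks for a nonzero cosine, so the quarter turn is
    composed of rotations by the two acute angles of the 3-4-5 triangle; a sign change of one row
    makes it the swap.\<close>
  have "plane_matrix i j 0 1 1 0 = plane_matrix i j 1 0 0 (- 1) ** (plane_matrix i j (3/5) (4/5) (- 4/5) (3/5) ** plane_matrix i j (4/5) (3/5) (- 3/5) (4/5))"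
    using assms by (simp add: plane_matrix_mult_plane_matrix)
  then show "semi_invariant (plane_matrix i j 0 1 1 0)"
    by (metis semi_invariant_mult diag rot34 rot43)
  \<comment> \<open>The three inner factors are the singular value decomposition of the transvection with entry
    \<open>7/12\<close>, chosen because all its entries are rational; the outer ones rescale the entry to \<open>1\<close>.\<close>
  have "plane_matrix i j 1 1 0 1 = plane_matrix i j (12/7) 0 0 1 **
     (plane_matrix i j (4/5) (- 3/5) (3/5) (4/5) ** (plane_matrix i j (4/3) 0 0 (3/4) **
      (plane_matrix i j (3/5) (4/5) (- 4/5) (3/5) ** plane_matrix i j (7/12) 0 0 1)))"
    using assms by (simp add: plane_matrix_mult_plane_matrix)
  then show "semi_invariant (plane_matrix i j 1 1 0 1)"
    by (metis semi_invariant_mult diag rot34 rot43')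
qed

text \<open>The determinant factor kills every word of \<open>T ** g\<close>, and multiplying by an
  arbitrary \<open>S\<close> only forms linear combinations of such words.\<close>

lemma semi_invariant_singular_factor:
  fixes p q :: "'n \<times> 'n \<Rightarrow> 'n"
  assumes "semi_invariant T" "det T = 0"
  shows "(LINT g|\<mu>. (\<Prod>a\<in>UNIV. (S ** T ** g) $ p a $ q a)) = 0"
  using assms
  by (simp add: matrix_mult_word[of S] integrable_word semi_invariant_def power_0_left flip: matrix_mul_assoc)

text \<open>Induction over products of diagonal matrices, swaps and transvections. The case of a
  zero row is excluded by the determinant, and both factors of a product inherit a nonzero
  determinant.\<close>

lemma semi_invariant_real_invertible: "det A \<noteq> 0 \<Longrightarrow> semi_invariant (\<chi> i j. of_real (A $ i $ j))"
proof (induction A rule: induct_matrix_elementary_alt)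
  case (1 A B)
  have "(\<chi> i j. complex_of_real ((A ** B) $ i $ j)) = (\<chi> i j. of_real (A $ i $ j)) ** (\<chi> i j. of_real (B $ i $ j))"
    by (simp add: matrix_matrix_mult_def vec_eq_iff)
  then show ?case using 1 semi_invariant_mult by (simp add: det_mul)
next
  case (2 A i)
  then show ?case by (simp add: det_zero_row(1)[of i A])
next
  case (3 A)
  have "(\<chi> i j. complex_of_real (A $ i $ j)) = diag_matrix (\<lambda>i. of_real (A $ i $ i))"
    using 3 by (auto simp: vec_eq_iff diag_matrix_def)
  then show ?case by (simp add: semi_invariant_diag)
next
  case (4 m n)
  have "(\<chi> i j. complex_of_real ((\<chi> i j. mat 1 $ i $ Transposition.transpose m n j) $ i $ j)) = plane_matrix m n 0 1 1 0"
    using 4(1) by (auto simp: vec_eq_iff plane_matrix_def mat_def Transposition.transpose_def)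
  then show ?case using semi_invariant_plane[OF 4(1)] by metis
next
  case (5 m n)
  have "(\<chi> i j. complex_of_real ((\<chi> i j. of_bool (i = m \<and> j = n \<or> i = j)) $ i $ j)) = plane_matrix m n 1 1 0 1"
    using 5(1) by (auto simp: vec_eq_iff plane_matrix_def)
  then show ?case using semi_invariant_plane[OF 5(1)] by metis
qed

lemma semi_invariant_real: "semi_invariant (\<chi> i j. of_real (A $ i $ j))"
proof (cases "det A = 0")
  case False
  then show ?thesis by (rule semi_invariant_real_invertible)
next
  case True
  let ?c = "\<lambda>B. \<chi> i j. complex_of_real (B $ i $ j)"
  have c_mult: "?c (B ** B') = ?c B ** ?c B'" for B B' :: "real^'n^'n"
    by (simp add: matrix_matrix_mult_def vec_eq_iff)
  obtain v where v: "v \<noteq> 0" "A *v v = 0" using True invertible_det_nz[of A] invertible_left_inverse[of A] matrix_left_invertible_ker[of A] by blast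
  then obtain k where k: "v $ k \<noteq> 0" by (auto simp: vec_eq_iff)
  \<comment> \<open>An invertible matrix sending the basis vector \<open>k\<close> to the kernel
    vector, so that \<open>A ** C\<close> has a zero column; by Cramer's lemma its determinant is
    the nonzero coordinate of \<open>v\<close>.\<close>
  define C :: "real^'n^'n" where "C = (\<chi> i j. if j = k then v $ i else mat 1 $ i $ j)"
  have det_C: "det C = v $ k"
  proof -
    have "det C = det (\<chi> i j. if j = k then ((mat 1 :: real^'n^'n) *v v) $ i else mat 1 $ i $ j)"
      by (simp only: C_def matrix_vector_mul_lid)
    also have "\<dots> = v $ k * det (mat 1 :: real^'n^'n)" by (rule cramer_lemma)
    finally show ?thesis by simp
  qed
  then obtain C' where C': "C ** C' = mat 1" using k invertible_det_nz[of C] by (auto simp: invertible_def)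
  then have "det C' \<noteq> 0" by (metis det_I det_mul mult_zero_right zero_neq_one)
  then have semi: "semi_invariant (?c C')" by (rule semi_invariant_real_invertible)
  define d where "d i = (if i = k then 0 else 1 :: complex)" for i
  have "(\<Sum>l\<in>UNIV. A $ i $ l * C $ l $ k) = (A *v v) $ i" for i
    by (simp add: C_def matrix_vector_mult_def)
  then have "(A ** C) $ i $ k = 0" for i using v by (simp add: matrix_matrix_mult_def)
  then have AC: "?c (A ** C) ** diag_matrix d = ?c (A ** C)"
    by (auto simp: vec_eq_iff mult_diag_matrix d_def)
  have "?c A = ?c (A ** C) ** ?c C'"
    using C' by (simp flip: c_mult matrix_mul_assoc)
  \<comment> \<open>As column \<open>k\<close> of \<open>A ** C\<close> vanishes, a singular diagonal factor can be inserted.\<close>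
  then have A: "?c A = ?c (A ** C) ** (diag_matrix d ** ?c C')"
    using AC by (simp add: matrix_mul_assoc)
  have d0: "det (diag_matrix d) = 0" by (auto simp: det_diag_matrix d_def intro!: prod_zero)
  then have "det (?c A) = 0" by (simp add: A det_mul)
  then show ?thesis
    unfolding semi_invariant_def A
    using semi_invariant_singular_factor[OF semi_invariant_mult[OF semi_invariant_diag[of d] semi]] d0
    by (simp add: det_mul)
qed

end

section \<open>Integrals as coefficients and the comparison with the pairing\<close>

definition entries :: "'a^'n^'m \<Rightarrow> 'm \<times> 'n \<Rightarrow> 'a" where
  "entries A = (\<lambda>(i, j). A $ i $ j)"

lemma of_int_const: "of_int z = const (of_int z)"
  by (simp add: const_def single_of_int)

lemma eval_det_generic_matrix: "eval_poly (entries T) (det generic_matrix) = det T"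
  by (simp add: det_def generic_matrix_def eval_poly_sum eval_poly_mult eval_poly_prod entries_def of_int_const)

lemma homogeneous_det_generic_matrix:
  "homogeneous (CARD('n) * CARD('n)) (det (generic_matrix :: ('n::finite \<times> 'n) cpoly^'n^'n) ^ CARD('n))"
proof -
  have "homogeneous (0 + CARD('n)) (of_int z * (\<Prod>i\<in>UNIV. (generic_matrix :: ('n \<times> 'n) cpoly^'n^'n) $ i $ p i))" for z p
  proof (rule homogeneous_mult)
    show "homogeneous 0 (of_int z :: ('n \<times> 'n) cpoly)"
      by (simp add: of_int_const homogeneous_const)
    show "homogeneous CARD('n) (\<Prod>i\<in>UNIV. (generic_matrix :: ('n \<times> 'n) cpoly^'n^'n) $ i $ p i)"
      using homogeneous_prod[of "UNIV :: 'n set" "\<lambda>_. 1" "\<lambda>i. (generic_matrix :: ('n \<times> 'n) cpoly^'n^'n) $ i $ p i"]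
      by (simp add: generic_matrix_def homogeneous_Var[unfolded One_nat_def])
  qed
  then show ?thesis unfolding det_def by (intro homogeneous_power homogeneous_sum) simp
qed

lemma sum_UNIV_pair: "(\<Sum>v\<in>(UNIV :: ('a::finite \<times> 'b::finite) set). f v) = (\<Sum>i\<in>UNIV. \<Sum>j\<in>UNIV. f (i, j))"
  by (simp add: sum.cartesian_product)

lemma sum_swap4:
  "(\<Sum>i\<in>A. \<Sum>j\<in>B. \<Sum>l\<in>C. \<Sum>k\<in>D. f i j l k) = (\<Sum>k\<in>D. \<Sum>l\<in>C. \<Sum>j\<in>B. \<Sum>i\<in>A. f i j l k)"
proof -
  have "(\<Sum>i\<in>A. \<Sum>j\<in>B. \<Sum>l\<in>C. \<Sum>k\<in>D. f i j l k) = (\<Sum>j\<in>B. \<Sum>i\<in>A. \<Sum>k\<in>D. \<Sum>l\<in>C. f i j l k)"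
    by (subst sum.swap) (intro sum.cong refl sum.swap)
  also have "\<dots> = (\<Sum>j\<in>B. \<Sum>k\<in>D. \<Sum>l\<in>C. \<Sum>i\<in>A. f i j l k)"
    by (intro sum.cong refl, subst sum.swap) (intro sum.cong refl sum.swap)
  also have "\<dots> = (\<Sum>k\<in>D. \<Sum>l\<in>C. \<Sum>j\<in>B. \<Sum>i\<in>A. f i j l k)"
    by (subst sum.swap) (intro sum.cong refl sum.swap)
  finally show ?thesis .
qed

text \<open>The sum over \<open>v\<close> is the trace form tr(A^T B), for which multiplication by a
  matrix on either side is adjoint to multiplication by its transpose.\<close>

lemma entries_pairing_mult:
  fixes X g W S :: "complex^'n^'n"
  shows "(\<Sum>v\<in>UNIV. entries (X ** g ** W) v * entries S v)
    = (\<Sum>v\<in>UNIV. entries g v * entries (transpose X ** S ** transpose W) v)"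
proof -
  have "(\<Sum>v\<in>UNIV. entries (X ** g ** W) v * entries S v)
     = (\<Sum>i\<in>UNIV. \<Sum>j\<in>UNIV. \<Sum>l\<in>UNIV. \<Sum>k\<in>UNIV. X $ i $ k * g $ k $ l * W $ l $ j * S $ i $ j)"
    by (simp add: entries_def sum_UNIV_pair
      matrix_matrix_mult_def sum_distrib_right)
  also have "\<dots> = (\<Sum>k\<in>UNIV. \<Sum>l\<in>UNIV. \<Sum>j\<in>UNIV. \<Sum>i\<in>UNIV. X $ i $ k * g $ k $ l * W $ l $ j * S $ i $ j)"
    by (rule sum_swap4)
  also have "\<dots> = (\<Sum>v\<in>UNIV. entries g v * entries (transpose X ** S ** transpose W) v)"
    by (simp add: entries_def sum_UNIV_pair
      matrix_matrix_mult_def sum_distrib_right sum_distrib_left transpose_def mult_ac)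
  finally show ?thesis .
qed

context SU_haar
begin

text \<open>A generating function: as a polynomial in the entries of \<open>T\<close>, its
  coefficients are the integrals of the degree n^2 monomials up to multinomial factors.\<close>

definition power_integral :: "complex^'n^'n \<Rightarrow> complex" where
  "power_integral T = (LINT g|\<mu>. (\<Sum>v\<in>UNIV. entries g v * entries T v) ^ (CARD('n) * CARD('n)))"

lemma continuous_entries [continuous_intros]: "continuous_on S (\<lambda>g :: complex^'n^'n. entries g v)"
  unfolding entries_def case_prod_beta by (intro continuous_intros)

lemma continuous_monom_val_entries: "continuous_on S (\<lambda>g :: complex^'n^'n. monom_val (entries g) m)"
  unfolding monom_val_def by (intro continuous_intros)

lemma integrable_power_sum: "integrable \<mu> (\<lambda>g. (\<Sum>v\<in>UNIV. entries g v * c v) ^ k)"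
  by (intro integrable_cont continuous_intros)

lemma power_integral_real:
  "power_integral (\<chi> i j. of_real (A $ i $ j)) = det (\<chi> i j. of_real (A $ i $ j)) ^ CARD('n) * power_integral (mat 1)"
proof -
  \<comment> \<open>The linear form is the trace of \<open>transpose T ** g\<close>; the power of a
    trace expands into words whose row and column indices coincide.\<close>
  have *: "power_integral T = (\<Sum>q\<in>UNIV. LINT g|\<mu>. (\<Prod>a\<in>(UNIV :: ('n \<times> 'n) set). (transpose T ** g) $ q a $ q a))" for T
  proof -
    have "(\<Sum>v\<in>UNIV. entries g v * entries T v) ^ (CARD('n) * CARD('n))
        = (\<Sum>q\<in>UNIV. \<Prod>a\<in>(UNIV :: ('n \<times> 'n) set). (transpose T ** g) $ q a $ q a)" for g
    proof -
      have "(\<Sum>v\<in>UNIV. entries g v * entries T v) = (\<Sum>i\<in>UNIV. \<Sum>j\<in>UNIV. g $ i $ j * T $ i $ j)"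
        by (simp add: entries_def sum_UNIV_pair)
      also have "\<dots> = (\<Sum>j\<in>UNIV. (transpose T ** g) $ j $ j)"
        by (subst sum.swap) (simp add: matrix_matrix_mult_def transpose_def mult.commute)
      finally have "(\<Sum>v\<in>UNIV. entries g v * entries T v) ^ (CARD('n) * CARD('n))
         = (\<Prod>a\<in>(UNIV :: ('n \<times> 'n) set). \<Sum>j\<in>UNIV. (transpose T ** g) $ j $ j)" by simp
      also have "\<dots> = (\<Sum>q\<in>UNIV. \<Prod>a\<in>(UNIV :: ('n \<times> 'n) set). (transpose T ** g) $ q a $ q a)"
        by (subst prod_sum_PiE) auto
      finally show ?thesis .
    qed
    then show ?thesis
      unfolding power_integral_def by (simp add: integrable_word)
  qed
  have t: "transpose (\<chi> i j. complex_of_real (A $ i $ j)) = (\<chi> i j. of_real (transpose A $ i $ j))"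
    by (simp add: transpose_def vec_eq_iff)
  show ?thesis
    using semi_invariant_real[of "transpose A"]
    by (simp add: * semi_invariant_def sum_distrib_left transpose_mat flip: t)
qed

text \<open>The coefficient functional reads a polynomial in \<open>T\<close> only at matrices with
  natural number entries, where \<open>power_integral_real\<close> applies; so the identity passes
  from real matrices to coefficients.\<close>

lemma monomial_integral:
  assumes "mdeg m = CARD('n) * CARD('n)"
  shows "(LINT g|\<mu>. Poly_Mapping.lookup (linear_form (entries g) ^ (CARD('n) * CARD('n))) m)
    = power_integral (mat 1) * Poly_Mapping.lookup (det generic_matrix ^ CARD('n)) m"
proof -
  let ?N = "CARD('n) * CARD('n)"
  obtain S :: "('n \<times> 'n \<Rightarrow> nat) set" and w where S: "finite S"
    "\<And>p. homogeneous ?N p \<Longrightarrow> Poly_Mapping.lookup p m = (\<Sum>s\<in>S. w s * eval_poly (\<lambda>v. of_nat (s v)) p)"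
    using ex_coeff_functional_homogeneous[of ?N m] by blast
  define M where "M s = (\<chi> i j. complex_of_real (((\<chi> i j. real (s (i, j))) :: real^'n^'n) $ i $ j))" for s :: "'n \<times> 'n \<Rightarrow> nat"
  have M: "(\<lambda>v. of_nat (s v)) = entries (M s)" for s
    by (simp add: M_def entries_def fun_eq_iff)
  have "homogeneous ?N (linear_form (entries g) ^ ?N)" for g :: "complex^'n^'n"
    using homogeneous_power[OF homogeneous_linear_form] by simp
  then have "(LINT g|\<mu>. Poly_Mapping.lookup (linear_form (entries g) ^ ?N) m) = (\<Sum>s\<in>S. w s * power_integral (M s))"
    by (simp add: S(2) M eval_poly_power eval_linear_form power_integral_def integrable_power_sum)
  also have "\<dots> = power_integral (mat 1) * (\<Sum>s\<in>S. w s * eval_poly (\<lambda>v. of_nat (s v)) (det generic_matrix ^ CARD('n)))"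
    unfolding M_def power_integral_real unfolding M_def[symmetric]
    by (simp add: sum_distrib_left M eval_poly_power eval_det_generic_matrix mult_ac)
  also have "\<dots> = power_integral (mat 1) * Poly_Mapping.lookup (det generic_matrix ^ CARD('n)) m"
    by (simp add: S(2) homogeneous_det_generic_matrix)
  finally show ?thesis .
qed

text \<open>With all coefficients known, the formula extends from real to complex
  \<open>T\<close>.\<close>

lemma power_integral_eq: "power_integral T = det T ^ CARD('n) * power_integral (mat 1)"
proof -
  let ?N = "CARD('n) * CARD('n)"
  have hom: "homogeneous ?N (linear_form (entries g) ^ ?N)" for g :: "complex^'n^'n"
    using homogeneous_power[OF homogeneous_linear_form] by simp
  have int: "integrable \<mu> (\<lambda>g. Poly_Mapping.lookup (linear_form (entries g) ^ ?N) m)" if "mdeg m = ?N" for m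
  proof -
    have "Poly_Mapping.lookup (linear_form (entries g) ^ ?N) m = fact ?N * monom_val (entries g) m / mfact m" for g :: "complex^'n^'n"
      using multinomial[OF that, of "entries g"] by (simp add: field_simps)
    then show ?thesis by (auto intro!: integrable_cont continuous_intros continuous_monom_val_entries)
  qed
  have "power_integral T = (LINT g|\<mu>. eval_poly (entries T) (linear_form (entries g) ^ ?N))"
    by (simp add: power_integral_def eval_poly_power eval_linear_form)
  also have "\<dots> = (LINT g|\<mu>. (\<Sum>m | mdeg m = ?N. Poly_Mapping.lookup (linear_form (entries g) ^ ?N) m * monom_val (entries T) m))"
    by (simp add: eval_poly_homogeneous[OF hom])
  also have "\<dots> = (\<Sum>m | mdeg m = ?N. power_integral (mat 1) * Poly_Mapping.lookup (det generic_matrix ^ CARD('n)) m * monom_val (entries T) m)"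
    by (simp add: int monomial_integral)
  also have "\<dots> = power_integral (mat 1) * eval_poly (entries T) (det generic_matrix ^ CARD('n))"
    by (simp add: eval_poly_homogeneous[OF homogeneous_det_generic_matrix] sum_distrib_left mult.assoc)
  finally show ?thesis by (simp add: eval_poly_power eval_det_generic_matrix)
qed

text \<open>Polarization writes a monomial as a combination of powers of linear forms. The matrices
  \<open>X\<close> and \<open>W\<close> move onto the linear form, where
  \<open>power_integral_eq\<close> produces their determinants.\<close>

lemma integral_monom_val_translate:
  assumes m: "mdeg m = CARD('n) * CARD('n)"
  shows "(LINT g|\<mu>. monom_val (entries (X ** g ** W)) m)
    = det X ^ CARD('n) * det W ^ CARD('n) * (LINT g|\<mu>. monom_val (entries g) m)"
proof -
  let ?N = "CARD('n) * CARD('n)"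
  obtain S :: "('n \<times> 'n \<Rightarrow> nat) set" and w where S: "finite S"
    "\<And>p. homogeneous ?N p \<Longrightarrow> Poly_Mapping.lookup p m = (\<Sum>s\<in>S. w s * eval_poly (\<lambda>v. of_nat (s v)) p)"
    using ex_coeff_functional_homogeneous[of ?N m] by blast
  define M where "M s = ((\<chi> i j. of_nat (s (i, j))) :: complex^'n^'n)" for s :: "'n \<times> 'n \<Rightarrow> nat"
  have M: "(\<lambda>v. of_nat (s v)) = entries (M s)" for s
    by (simp add: M_def entries_def fun_eq_iff)
  have hom: "homogeneous ?N (linear_form (entries g) ^ ?N)" for g :: "complex^'n^'n"
    using homogeneous_power[OF homogeneous_linear_form] by simp
  have polarize: "monom_val (entries g) m = mfact m / fact ?N * (\<Sum>s\<in>S. w s * (\<Sum>v\<in>UNIV. entries g v * entries (M s) v) ^ ?N)" for g :: "complex^'n^'n"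
    using multinomial[OF m, of "entries g"]
    by (simp add: S(2)[OF hom] M eval_poly_power eval_linear_form field_simps)
  have *: "(LINT g|\<mu>. monom_val (entries (X ** g ** W)) m)
    = mfact m / fact ?N * (\<Sum>s\<in>S. w s * power_integral (transpose X ** M s ** transpose W))" for X W
    by (simp add: polarize entries_pairing_mult integrable_power_sum power_integral_def)
  show ?thesis
    using *[of X W] *[of "mat 1" "mat 1"]
    by (simp add: power_integral_eq[of "_ ** _"] power_integral_eq[of "M _"] transpose_mat det_mul power_mult_distrib sum_distrib_left mult_ac)
qed

definition haar_const :: complex where
  "haar_const = power_integral (mat 1) / fact (CARD('n) * CARD('n))"

text \<open>By linearity it suffices to treat monomials; the factorial weights of the pairing are
  those of the multinomial theorem.\<close>

lemma integral_eq_pairing: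
  assumes f: "homogeneous (CARD('n) * CARD('n)) f"
  shows "(LINT g|\<mu>. eval_poly (entries g) f) = haar_const * pairing f (det generic_matrix ^ CARD('n))"
proof -
  let ?N = "CARD('n) * CARD('n)"
  have *: "(LINT g|\<mu>. monom_val (entries g) m) = haar_const * (mfact m * Poly_Mapping.lookup (det generic_matrix ^ CARD('n)) m)"
    if m: "mdeg m = ?N" for m
  proof -
    have "monom_val (entries g) m = mfact m / fact ?N * Poly_Mapping.lookup (linear_form (entries g) ^ ?N) m" for g :: "complex^'n^'n"
      using multinomial[OF m, of "entries g"] by (simp add: field_simps)
    then show ?thesis by (simp add: monomial_integral[OF m] haar_const_def)
  qed
  have "(LINT g|\<mu>. eval_poly (entries g) f) = (\<Sum>m | mdeg m = ?N. Poly_Mapping.lookup f m * (LINT g|\<mu>. monom_val (entries g) m))"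
    by (simp add: eval_poly_homogeneous[OF f] integrable_cont continuous_monom_val_entries)
  also have "\<dots> = haar_const * (\<Sum>m | mdeg m = ?N. Poly_Mapping.lookup f m * (mfact m * Poly_Mapping.lookup (det generic_matrix ^ CARD('n)) m))"
    by (simp add: * sum_distrib_left mult_ac)
  also have "(\<Sum>m | mdeg m = ?N. Poly_Mapping.lookup f m * (mfact m * Poly_Mapping.lookup (det generic_matrix ^ CARD('n)) m))
    = pairing f (det generic_matrix ^ CARD('n))"
    using f by (intro pairing_eq[symmetric] finite_mdeg) (auto simp: homogeneous_def)
  finally show ?thesis .
qed

text \<open>The test polynomial det^n is 1 on SU(n), so its integral is the total mass.\<close>

lemma haar_const_nonzero: "haar_const \<noteq> 0"
proof
  assume 0: "haar_const = 0"
  have "(LINT g|\<mu>. eval_poly (entries g) (det generic_matrix ^ CARD('n))) = (LINT g|\<mu>. 1)"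
    by (intro Bochner_Integration.integral_cong refl)
       (simp add: space_mu SU_iff eval_poly_power eval_det_generic_matrix)
  also have "\<dots> \<noteq> 0" using measure_SU by (simp add: space_mu)
  finally show False using integral_eq_pairing[OF homogeneous_det_generic_matrix] 0 by simp
qed

end

section \<open>Latin squares, determinant and permanent\<close>

definition ones :: "('v::finite) monomial" where
  "ones = (\<Sum>v\<in>UNIV. Poly_Mapping.single v 1)"

lemma lookup_ones [simp]: "Poly_Mapping.lookup ones v = 1"
  by (simp add: ones_def lookup_sum lookup_single when_def)

lemma mdeg_ones: "mdeg (ones :: ('v::finite) monomial) = CARD('v)"
  by (simp add: ones_def mdeg_sum)

lemma monom_val_ones: "monom_val a ones = (\<Prod>v\<in>UNIV. a v)"
  by (simp add: ones_def monom_val_sum)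

lemma eq_ones_iff: "m = ones \<longleftrightarrow> (\<forall>v. Poly_Mapping.lookup m v = 1)"
  by (auto intro: poly_mapping_eqI)

lemma prod_single: "(\<Prod>x\<in>A. Poly_Mapping.single (f x) (c x)) = Poly_Mapping.single (\<Sum>x\<in>A. f x) (\<Prod>x\<in>A. c x :: complex)"
  by (induction A rule: infinite_finite_induct) (auto simp: mult_single)

lemma lookup_sum_single:
  "Poly_Mapping.lookup (\<Sum>x\<in>A. Poly_Mapping.single (f x) (c x)) m = (\<Sum>x\<in>A. if f x = m then c x else 0)"
  by (simp add: lookup_sum lookup_single when_def)

lemma bij_iff_fibres:
  fixes f :: "'a::finite \<Rightarrow> 'a"
  shows "bij f \<longleftrightarrow> (\<forall>b. card {a. f a = b} = 1)"
proof
  assume "bij f"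
  have "{a. f a = b} = {inv_into UNIV f b}" for b
  proof -
    have "f a = b \<longleftrightarrow> a = inv_into UNIV f b" for a
      using bij_inv_eq_iff[OF \<open>bij f\<close>, of a b] by (simp only:)
    then show ?thesis by simp
  qed
  then show "\<forall>b. card {a. f a = b} = 1" by simp
next
  assume f: "\<forall>b. card {a. f a = b} = 1"
  have "surj f"
    unfolding surj_def
  proof
    fix b show "\<exists>a. b = f a" 
    proof -
      obtain a where "{a. f a = b} = {a}" using f[rule_format, of b] by (rule card_1_singletonE)
      then have "a \<in> {a. f a = b}" by (simp only: singletonI)
      then show ?thesis by blast
    qed
  qed
  then show "bij f" by (simp add: bij_def finite_UNIV_surj_inj)
qed

lemma permutes_UNIV_iff: "p permutes UNIV \<longleftrightarrow> bij p"
proof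
  show "p permutes UNIV \<Longrightarrow> bij p" by (rule permutes_bij)
  show "bij p \<Longrightarrow> p permutes UNIV" by (rule bij_imp_permutes) simp_all
qed

lemma sum_when_card: "(\<Sum>a\<in>UNIV. 1 when P a) = card {a :: 'a::finite. P a}"
  by (simp add: when_def flip: sum.inter_filter)

lemma const_mult_single: "const c * Poly_Mapping.single m d = Poly_Mapping.single m (c * d)"
  by (simp add: const_def mult_single)

lemma det_generic_matrix:
  "det (generic_matrix :: ('n::finite \<times> 'n) cpoly^'n^'n)
    = (\<Sum>s | s permutes UNIV. Poly_Mapping.single (\<Sum>i\<in>UNIV. Poly_Mapping.single (i, s i) 1) (of_int (sign s)))"
  by (simp add: det_def generic_matrix_def Var_def prod_single of_int_const const_mult_single)

definition row_sign :: "('n::finite)^'n^'n \<Rightarrow> int" where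
  "row_sign L = (\<Prod>i\<in>UNIV. sign (\<lambda>j. L $ i $ j))"

text \<open>A term of the expanded power is a choice of a permutation \<open>s k\<close> in each
  factor k. The exponent of the variable (i, j) counts the k with \<open>s k i = j\<close>, so all
  exponents are 1 exactly if the permutations are the rows of a Latin square; the sign of the term
  is the row sign.\<close>

lemma coeff_det_power:
  "Poly_Mapping.lookup (det (generic_matrix :: ('n::finite \<times> 'n) cpoly^'n^'n) ^ CARD('n)) ones
    = of_int (\<Sum>L | latin_square (L :: 'n^'n^'n). row_sign L)"
proof -
  let ?M = "\<lambda>s :: 'n \<Rightarrow> 'n. \<Sum>i\<in>UNIV. Poly_Mapping.single (i, s i) (1::nat)"
  let ?P = "{s :: 'n \<Rightarrow> 'n. s permutes UNIV}"
  have lookup_M: "Poly_Mapping.lookup (\<Sum>k\<in>(UNIV :: 'n set). ?M (s k)) (i, j) = card {k. s k i = j}" for s :: "'n \<Rightarrow> 'n \<Rightarrow> 'n" and i j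
  proof -
    have "Poly_Mapping.lookup (\<Sum>k\<in>(UNIV :: 'n set). ?M (s k)) (i, j) = (\<Sum>k\<in>UNIV. \<Sum>i'\<in>UNIV. if i' = i then (1 when s k i = j) else 0)"
      unfolding lookup_sum lookup_single by (intro sum.cong) (auto simp: when_def)
    then show ?thesis by (simp add: sum_when_card[unfolded One_nat_def])
  qed
  have "det (generic_matrix :: ('n \<times> 'n) cpoly^'n^'n) ^ CARD('n)
     = (\<Prod>k\<in>(UNIV :: 'n set). \<Sum>s\<in>?P. Poly_Mapping.single (?M s) (of_int (sign s)))"
    by (simp add: det_generic_matrix)
  also have "\<dots> = (\<Sum>s\<in>UNIV \<rightarrow>\<^sub>E ?P. Poly_Mapping.single (\<Sum>k\<in>(UNIV :: 'n set). ?M (s k)) (\<Prod>k\<in>UNIV. of_int (sign (s k))))"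
    by (subst prod_sum_PiE) (auto simp: prod_single)
  finally have "Poly_Mapping.lookup (det (generic_matrix :: ('n \<times> 'n) cpoly^'n^'n) ^ CARD('n)) ones
     = (\<Sum>s\<in>UNIV \<rightarrow>\<^sub>E ?P. if (\<Sum>k\<in>(UNIV :: 'n set). ?M (s k)) = ones then (\<Prod>k\<in>UNIV. of_int (sign (s k))) else 0)"
    by (simp only: lookup_sum_single)
  also have "\<dots> = (\<Sum>s\<in>{s \<in> UNIV \<rightarrow>\<^sub>E ?P. (\<Sum>k\<in>(UNIV :: 'n set). ?M (s k)) = ones}. (\<Prod>k\<in>UNIV. of_int (sign (s k))))"
    by (subst sum.inter_filter) (simp_all add: finite_PiE)
  also have "{s \<in> UNIV \<rightarrow>\<^sub>E ?P. (\<Sum>k\<in>(UNIV :: 'n set). ?M (s k)) = ones} = {s. (\<forall>k. bij (s k)) \<and> (\<forall>i. bij (\<lambda>k. s k i))}"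
  proof -
    have "(\<Sum>k\<in>UNIV. ?M (s k)) = ones \<longleftrightarrow> (\<forall>i. bij (\<lambda>k. s k i))" for s :: "'n \<Rightarrow> 'n \<Rightarrow> 'n"
      by (simp only: eq_ones_iff split_paired_All lookup_M bij_iff_fibres)
    then show ?thesis by (auto simp: permutes_UNIV_iff PiE_UNIV_domain)
  qed
  also have "(\<Sum>s\<in>\<dots>. (\<Prod>k\<in>UNIV. complex_of_int (sign (s k)))) = (\<Sum>L | latin_square (L :: 'n^'n^'n). complex_of_int (row_sign L))"
    by (intro sum.reindex_bij_witness[of _ "\<lambda>L k i. L $ k $ i" "\<lambda>s. \<chi> k i. s k i"])
       (simp_all add: latin_square_def row_sign_def vec_lambda_inverse)
  finally show ?thesis by (simp only: of_int_sum)
qed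

section \<open>Row, column and symbol signs\<close>

lemma sign_fibrewise_single:
  fixes r :: "'n::finite \<Rightarrow> 'n" and i :: "'a::finite"
  assumes "r permutes UNIV"
  shows "bij (\<lambda>(a, b). (a, if a = i then r b else b)) \<and> sign (\<lambda>(a, b). (a, if a = i then r b else b)) = sign r"
proof -
  have "finite (UNIV :: 'n set)" by simp
  from assms this show ?thesis
  proof (induction r rule: permutes_induct)
    case id
    have "(\<lambda>(a :: 'a, b :: 'n). (a, if a = i then id b else b)) = id" by auto
    then show ?case by (simp only: bij_id sign_id)
  next
    case (swap c d p)
    show ?case
    proof (cases "c = d")
      case True
      then show ?thesis using swap by simp
    next
      case False
      let ?F = "\<lambda>p :: 'n \<Rightarrow> 'n. (\<lambda>(a, b). (a, if a = i then p b else b))"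
      \<comment> \<open>Inside the fibre over \<open>i\<close>, a transposition lifts to a
        transposition of two pairs, so the parity is preserved at each step of the
        induction.\<close>
      have eq: "?F (Transposition.transpose c d \<circ> p) = Transposition.transpose (i, c) (i, d) \<circ> ?F p"
        by (auto simp: fun_eq_iff Transposition.transpose_def)
      have F: "bij (?F p)" "sign (?F p) = sign p" using swap.IH by blast+
      have perms: "permutation (Transposition.transpose (i, c) (i, d))" "permutation (?F p)"
        "permutation (Transposition.transpose c d)" "permutation p"
        using F(1) swap.hyps by (simp_all add: permutation permutes_UNIV_iff)
      have "bij (Transposition.transpose (i, c) (i, d) \<circ> ?F p)"
        using F(1) by (intro bij_comp) simp_all
      moreover have "sign (Transposition.transpose (i, c) (i, d) \<circ> ?F p) = sign (Transposition.transpose c d \<circ> p)"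
        using False by (simp only: sign_compose[OF perms(1,2)] sign_compose[OF perms(3,4)] F(2) sign_swap_id prod.inject) simp
      ultimately show ?thesis unfolding eq by blast
    qed
  qed
qed

text \<open>The map is the composition of its restrictions to single fibres, extended by the
  identity. Products of row signs thereby become the sign of one permutation of pairs.\<close>

lemma sign_fibrewise:
  fixes r :: "'a::finite \<Rightarrow> 'n::finite \<Rightarrow> 'n"
  assumes "\<And>a. bij (r a)"
  shows "bij (\<lambda>(a, b). (a, r a b))" "sign (\<lambda>(a, b). (a, r a b)) = (\<Prod>a\<in>UNIV. sign (r a))"
proof -
  let ?F = "\<lambda>A. (\<lambda>(a, b). (a, if a \<in> A then r a b else b))"
  have "bij (?F A) \<and> sign (?F A) = (\<Prod>a\<in>A. sign (r a))" if "finite A" for A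
    using that
  proof (induction A rule: finite_induct)
    case empty
    show ?case by (simp add: bij_id[unfolded id_def])
  next
    case (insert i A)
    let ?G = "\<lambda>(a, b). (a, if a = i then r i b else b)"
    have G: "bij ?G" "sign ?G = sign (r i)"
      using sign_fibrewise_single[of "r i" i] bij_imp_permutes[of "r i" UNIV] assms by simp_all
    have eq: "?F (insert i A) = ?G \<circ> ?F A" using insert.hyps by (auto simp: fun_eq_iff)
    have F: "bij (?F A)" "sign (?F A) = (\<Prod>a\<in>A. sign (r a))" using insert.IH by blast+
    have "bij (?G \<circ> ?F A)" using F(1) G(1) by (rule bij_comp)
    moreover have "sign (?G \<circ> ?F A) = sign (r i) * (\<Prod>a\<in>A. sign (r a))"
      unfolding F(2)[symmetric] G(2)[symmetric] using F(1) G(1) by (intro sign_compose) (simp_all add: permutation)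
    ultimately show ?case unfolding eq prod.insert[OF insert.hyps] by blast
  qed
  from this[of UNIV] show "bij (\<lambda>(a, b). (a, r a b))" "sign (\<lambda>(a, b). (a, r a b)) = (\<Prod>a\<in>UNIV. sign (r a))"
    by simp_all
qed

text \<open>The entry \<open>(k, i)\<close> of the conjugate is the column of the symbol \<open>k\<close> in row \<open>i\<close>.\<close>

definition conjugate_square :: "('n::finite)^'n^'n \<Rightarrow> 'n^'n^'n" where
  "conjugate_square L = (\<chi> k i. inv_into UNIV (\<lambda>j. L $ i $ j) k)"

lemma conjugate_square_eq_iff:
  "latin_square L \<Longrightarrow> conjugate_square L $ k $ i = j \<longleftrightarrow> L $ i $ j = k"
  unfolding latin_square_def conjugate_square_def using bij_inv_eq_iff[of "\<lambda>j. L $ i $ j" j k] by auto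

lemma latin_square_conjugate:
  assumes L: "latin_square L"
  shows "latin_square (conjugate_square L)"
  unfolding latin_square_def
proof (intro conjI allI)
  fix k
  have "inj (\<lambda>i. conjugate_square L $ k $ i)"
  proof (rule injI)
    fix i i' assume "conjugate_square L $ k $ i = conjugate_square L $ k $ i'"
    then obtain j where "conjugate_square L $ k $ i = j" "conjugate_square L $ k $ i' = j" by blast
    then have "L $ i $ j = k" "L $ i' $ j = k" using conjugate_square_eq_iff[OF L] by auto
    moreover have "inj (\<lambda>i. L $ i $ j)" using L by (simp add: latin_square_def bij_def)
    ultimately show "i = i'" by (simp add: inj_def)
  qed
  then show "bij (\<lambda>i. conjugate_square L $ k $ i)" by (simp add: bij_def finite_UNIV_inj_surj)
next
  fix i
  have "bij (\<lambda>j. L $ i $ j)" using L by (simp add: latin_square_def)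
  then show "bij (\<lambda>k. conjugate_square L $ k $ i)"
    unfolding conjugate_square_def by (simp add: bij_imp_bij_inv)
qed

lemma finite_latin: "finite {L :: ('n::finite)^'n^'n. latin_square L}"
  by (rule finite_subset[OF subset_UNIV]) simp

text \<open>An injective map of the finite set of Latin squares to itself is bijective; injectivity
  holds because a square can be read off from its conjugate.\<close>

lemma sum_conjugate:
  "(\<Sum>L | latin_square (L :: ('n::finite)^'n^'n). f (conjugate_square L)) = (\<Sum>L | latin_square L. f L)"
proof -
  let ?S = "{L :: 'n^'n^'n. latin_square L}"
  have inj: "inj_on conjugate_square ?S"
  proof (rule inj_onI)
    fix L M :: "'n^'n^'n" assume *: "L \<in> ?S" "M \<in> ?S" "conjugate_square L = conjugate_square M"
    show "L = M"
      unfolding vec_eq_iff using * conjugate_square_eq_iff by (metis mem_Collect_eq)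
  qed
  have "conjugate_square ` ?S = ?S"
    using inj latin_square_conjugate by (intro endo_inj_surj finite_latin) auto
  then have "bij_betw conjugate_square ?S ?S" using inj by (simp add: bij_betw_def)
  then show ?thesis by (rule sum.reindex_bij_betw)
qed

text \<open>The products of the row signs, of the column signs and of the symbol signs are signs of
  single permutations of \<open>'n \<times> 'n\<close>. These are linked through the coordinate
  swap, so multiplicativity of the sign yields the relation, with a factor that depends only on
  n.\<close>

lemma latin_sign_conjugate:
  assumes L: "latin_square (L :: ('n::finite)^'n^'n)"
  shows "latin_sign L = sign (\<lambda>(a, b). (b :: 'n, a :: 'n)) * row_sign (conjugate_square L)"
proof -
  let ?\<tau> = "\<lambda>(a, b). (b :: 'n, a :: 'n)"
  let ?R = "\<lambda>(i, j). (i, L $ i $ j)"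
  let ?C = "\<lambda>(j, i). (j, L $ i $ j)"
  let ?S = "\<lambda>(k, i). (k, conjugate_square L $ k $ i)"
  have R: "bij ?R" "sign ?R = row_sign L"
    using L sign_fibrewise[of "\<lambda>i j. L $ i $ j"] by (auto simp: latin_square_def row_sign_def)
  have C: "bij ?C" "sign ?C = (\<Prod>j\<in>UNIV. sign (\<lambda>i. L $ i $ j))"
    using L sign_fibrewise[of "\<lambda>j i. L $ i $ j"] by (auto simp: latin_square_def)
  have S: "bij ?S" "sign ?S = row_sign (conjugate_square L)"
    using latin_square_conjugate[OF L] sign_fibrewise[of "\<lambda>i j. conjugate_square L $ i $ j"]
    by (auto simp: latin_square_def row_sign_def)
  have \<tau>: "bij ?\<tau>" by (rule bijI') auto
  \<comment> \<open>Both sides send \<open>(i, j)\<close> to \<open>(j, k)\<close>, where \<open>k\<close> is the symbol at \<open>(i, j)\<close>.\<close>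
  have eq: "?C \<circ> ?\<tau> = ?\<tau> \<circ> (?S \<circ> (?\<tau> \<circ> ?R))"
    by (auto simp: fun_eq_iff) (metis conjugate_square_eq_iff[OF L])
  have "sign (?C \<circ> ?\<tau>) = sign ?C * sign ?\<tau>"
    using C \<tau> by (intro sign_compose) (simp_all add: permutation)
  moreover have "sign (?\<tau> \<circ> (?S \<circ> (?\<tau> \<circ> ?R))) = sign ?\<tau> * (sign ?S * (sign ?\<tau> * sign ?R))"
    using R S \<tau> by (simp add: sign_compose permutation bij_comp)
  ultimately have "sign ?C * sign ?\<tau> = sign ?\<tau> * (sign ?S * (sign ?\<tau> * sign ?R))"
    using eq by simp
  then have "sign ?C * (sign ?\<tau> * sign ?\<tau>) * sign ?R = sign ?\<tau> * sign ?\<tau> * (sign ?R * sign ?R) * (sign ?S * sign ?\<tau>)"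
    by (simp add: mult_ac)
  then have "sign ?C * sign ?R = sign ?S * sign ?\<tau>" by (simp add: sign_idempotent)
  then show ?thesis
    by (simp add: latin_sign_def R(2) C(2) S(2) mult.commute row_sign_def)
qed

text \<open>The difference of the two counts is the sum of all signs. Conjugation permutes the Latin
  squares, which turns this sum into a fixed sign times the sum of the row signs.\<close>

lemma alon_tarsi_iff:
  "card {L :: ('n::finite)^'n^'n. latin_square L \<and> latin_sign L = -1} \<noteq> card {L :: 'n^'n^'n. latin_square L \<and> latin_sign L = 1}
   \<longleftrightarrow> Poly_Mapping.lookup (det (generic_matrix :: ('n \<times> 'n) cpoly^'n^'n) ^ CARD('n)) ones \<noteq> 0"
proof -
  let ?S = "{L :: 'n^'n^'n. latin_square L}"
  let ?e = "sign (\<lambda>(a, b). (b :: 'n, a :: 'n))"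
  have pm: "latin_sign L = 1 \<or> latin_sign L = - 1" for L :: "'n^'n^'n"
  proof -
    have "\<bar>latin_sign L\<bar> = 1" by (simp add: latin_sign_def abs_mult abs_prod)
    then show ?thesis by linarith
  qed
  have "(\<Sum>L\<in>?S. latin_sign L) = (\<Sum>L\<in>?S. of_bool (latin_sign L = 1) - of_bool (latin_sign L = -1))"
    using pm by (intro sum.cong) force+
  also have "\<dots> = int (card {L :: 'n^'n^'n. latin_square L \<and> latin_sign L = 1}) - int (card {L :: 'n^'n^'n. latin_square L \<and> latin_sign L = -1})"
  proof -
    have "(\<Sum>L\<in>?S. of_bool (P L)) = int (card {L :: 'n^'n^'n. latin_square L \<and> P L})" for P
      by (simp add: of_bool_def sum.If_cases finite_latin Collect_conj_eq)
    then show ?thesis by (simp only: sum_subtractf)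
  qed
  finally have "card {L :: 'n^'n^'n. latin_square L \<and> latin_sign L = -1} \<noteq> card {L :: 'n^'n^'n. latin_square L \<and> latin_sign L = 1}
    \<longleftrightarrow> (\<Sum>L\<in>?S. latin_sign L) \<noteq> 0" by auto
  also have "(\<Sum>L\<in>?S. latin_sign L) = ?e * (\<Sum>L\<in>?S. row_sign L)"
    by (simp add: latin_sign_conjugate sum_conjugate flip: sum_distrib_left)
  finally show ?thesis unfolding coeff_det_power by (simp only: of_int_eq_0_iff mult_eq_0_iff sign_nz) simp
qed

text \<open>The polynomial is the product of all entries of \<open>g\<close> times a generic matrix.
  Its terms choose an index \<open>s k i\<close> for every position (i, k), and all exponents are 1
  exactly if each \<open>s k\<close> is a permutation; every column k then contributes one
  permanent.\<close>

lemma coeff_perm: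
  fixes g :: "complex^'n::finite^'n"
  shows "Poly_Mapping.lookup (\<Prod>k\<in>(UNIV :: 'n set). \<Prod>i\<in>UNIV. \<Sum>j\<in>UNIV. Poly_Mapping.single (Poly_Mapping.single (j, k) 1) (g $ i $ j)) ones
    = perm g ^ CARD('n)"
proof -
  let ?P = "{s :: 'n \<Rightarrow> 'n. s permutes UNIV}"
  let ?M = "\<lambda>s :: 'n \<Rightarrow> 'n \<Rightarrow> 'n. \<Sum>k\<in>UNIV. \<Sum>i\<in>UNIV. Poly_Mapping.single (s k i, k) (1::nat)"
  have lookup_M: "Poly_Mapping.lookup (?M s) (j, k) = card {i. s k i = j}" for s :: "'n \<Rightarrow> 'n \<Rightarrow> 'n" and k j
  proof -
    have "Poly_Mapping.lookup (?M s) (j, k) = (\<Sum>k'\<in>UNIV. if k' = k then (\<Sum>i\<in>UNIV. 1 when s k i = j) else 0)"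
      unfolding lookup_sum lookup_single by (intro sum.cong) (auto simp: when_def)
    then show ?thesis by (simp add: sum_when_card[unfolded One_nat_def])
  qed
  have "(\<Prod>k\<in>(UNIV :: 'n set). \<Prod>i\<in>UNIV. \<Sum>j\<in>UNIV. Poly_Mapping.single (Poly_Mapping.single (j, k) (1::nat)) (g $ i $ j))
    = (\<Prod>k\<in>UNIV. \<Sum>h\<in>UNIV. Poly_Mapping.single (\<Sum>i\<in>UNIV. Poly_Mapping.single (h i, k) 1) (\<Prod>i\<in>UNIV. g $ i $ h i))"
    by (subst prod_sum_PiE) (auto simp: prod_single)
  also have "\<dots> = (\<Sum>s\<in>UNIV. Poly_Mapping.single (?M s) (\<Prod>k\<in>UNIV. \<Prod>i\<in>UNIV. g $ i $ s k i))"
    by (subst prod_sum_PiE) (auto simp: prod_single)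
  finally have "Poly_Mapping.lookup (\<Prod>k\<in>(UNIV :: 'n set). \<Prod>i\<in>UNIV. \<Sum>j\<in>UNIV. Poly_Mapping.single (Poly_Mapping.single (j, k) 1) (g $ i $ j)) ones
    = (\<Sum>s\<in>UNIV. if ?M s = ones then (\<Prod>k\<in>UNIV. \<Prod>i\<in>UNIV. g $ i $ s k i) else 0)"
    by (simp only: lookup_sum_single)
  also have "\<dots> = (\<Sum>s | ?M s = ones. \<Prod>k\<in>UNIV. \<Prod>i\<in>UNIV. g $ i $ s k i)"
    by (simp flip: sum.inter_filter)
  also have "{s. ?M s = ones} = (UNIV \<rightarrow>\<^sub>E ?P)"
  proof -
    have "?M s = ones \<longleftrightarrow> (\<forall>k. bij (s k))" for s :: "'n \<Rightarrow> 'n \<Rightarrow> 'n"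
      by (simp only: eq_ones_iff split_paired_All lookup_M bij_iff_fibres) (rule all_comm)
    then show ?thesis by (auto simp: permutes_UNIV_iff PiE_UNIV_domain)
  qed
  also have "(\<Sum>s\<in>(UNIV \<rightarrow>\<^sub>E ?P). \<Prod>k\<in>(UNIV :: 'n set). \<Prod>i\<in>UNIV. g $ i $ s k i) = (\<Prod>k\<in>(UNIV::'n set). \<Sum>s\<in>?P. \<Prod>i\<in>UNIV. g $ i $ s i)"
    by (subst prod_sum_PiE) auto
  finally show ?thesis by (simp add: perm_def)
qed

section \<open>Integrals of the product of entries and of the permanent\<close>

context SU_haar
begin

definition entry_integral :: complex where
  "entry_integral = (LINT g|\<mu>. (\<Prod>i\<in>UNIV. \<Prod>j\<in>UNIV. g $ i $ j))"

lemma monom_val_entries_ones: "monom_val (entries g) ones = (\<Prod>i\<in>UNIV. \<Prod>j\<in>UNIV. g $ i $ j)"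
  by (simp add: monom_val_ones entries_def prod.cartesian_product)

lemma integral_entries_translate:
  "(LINT g|\<mu>. (\<Prod>i\<in>UNIV. \<Prod>j\<in>UNIV. (X ** g ** W) $ i $ j)) = det X ^ CARD('n) * det W ^ CARD('n) * entry_integral"
  using integral_monom_val_translate[of ones X W]
  by (simp add: mdeg_ones monom_val_entries_ones entry_integral_def)

lemma entry_integral_eq:
  "entry_integral = haar_const * Poly_Mapping.lookup (det (generic_matrix :: ('n \<times> 'n) cpoly^'n^'n) ^ CARD('n)) ones"
  "entry_integral = haar_const * pairing (\<Prod>i\<in>UNIV. \<Prod>j\<in>UNIV. (generic_matrix :: ('n \<times> 'n) cpoly^'n^'n) $ i $ j) (det generic_matrix ^ CARD('n))"
proof -
  have eq: "(\<Prod>i\<in>UNIV. \<Prod>j\<in>UNIV. (generic_matrix :: ('n \<times> 'n) cpoly^'n^'n) $ i $ j) = Poly_Mapping.single ones 1"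
    by (simp add: generic_matrix_def Var_def prod_single ones_def sum_UNIV_pair)
  have "entry_integral = (LINT g|\<mu>. eval_poly (entries g) (Poly_Mapping.single ones 1))"
    by (simp add: entry_integral_def eval_poly_single monom_val_entries_ones)
  also have "\<dots> = haar_const * pairing (Poly_Mapping.single ones 1) (det (generic_matrix :: ('n \<times> 'n) cpoly^'n^'n) ^ CARD('n))"
    by (intro integral_eq_pairing homogeneous_single) (simp add: mdeg_ones)
  finally show *: "entry_integral = haar_const * pairing (\<Prod>i\<in>UNIV. \<Prod>j\<in>UNIV. (generic_matrix :: ('n \<times> 'n) cpoly^'n^'n) $ i $ j) (det generic_matrix ^ CARD('n))"
    by (simp add: eq)
  have "pairing (Poly_Mapping.single ones 1) q = Poly_Mapping.lookup q ones" for q :: "('n \<times> 'n) cpoly"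
    using pairing_eq[of "{ones}" "Poly_Mapping.single ones 1" q] by (simp add: mfact_def)
  then show "entry_integral = haar_const * Poly_Mapping.lookup (det (generic_matrix :: ('n \<times> 'n) cpoly^'n^'n) ^ CARD('n)) ones"
    using * by (simp add: eq)
qed

lemma perm_integral_eq:
  "(LINT g|\<mu>. perm g ^ CARD('n)) = haar_const * pairing (perm (generic_matrix :: ('n \<times> 'n) cpoly^'n^'n) ^ CARD('n)) (det generic_matrix ^ CARD('n))"
proof -
  have h: "homogeneous CARD('n) (perm (generic_matrix :: ('n \<times> 'n) cpoly^'n^'n))"
    unfolding perm_def
  proof (intro homogeneous_sum)
    fix p
    show "homogeneous CARD('n) (\<Prod>i\<in>UNIV. (generic_matrix :: ('n \<times> 'n) cpoly^'n^'n) $ i $ p i)"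
      using homogeneous_prod[of "UNIV :: 'n set" "\<lambda>_. 1" "\<lambda>i. (generic_matrix :: ('n \<times> 'n) cpoly^'n^'n) $ i $ p i"]
      by (simp add: generic_matrix_def homogeneous_Var[unfolded One_nat_def])
  qed
  have e: "eval_poly (entries g) (perm generic_matrix) = perm g" for g :: "complex^'n^'n"
    by (simp add: perm_def generic_matrix_def eval_poly_sum eval_poly_prod entries_def)
  show ?thesis
    using integral_eq_pairing[OF homogeneous_power[OF h, of "CARD('n)"]] by (simp add: e eval_poly_power)
qed

text \<open>Extracting the coefficient of \<open>ones\<close> is a finite combination of values and
  commutes with the integral. At a matrix T the product of the entries of \<open>g ** T\<close>
  integrates to \<open>det T ^ CARD('n) * entry_integral\<close>, so what remains is the coefficient
  in det^n.\<close>

lemma perm_integral: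
  "(LINT g|\<mu>. perm g ^ CARD('n)) = Poly_Mapping.lookup (det (generic_matrix :: ('n \<times> 'n) cpoly^'n^'n) ^ CARD('n)) ones * entry_integral"
proof -
  let ?N = "CARD('n) * CARD('n)"
  let ?G = "\<lambda>g :: complex^'n^'n. \<Prod>k\<in>UNIV. \<Prod>i\<in>UNIV. \<Sum>j\<in>UNIV. Poly_Mapping.single (Poly_Mapping.single (j, k :: 'n) (1::nat)) (g $ i $ j)"
  obtain S :: "('n \<times> 'n \<Rightarrow> nat) set" and w where S: "finite S"
    "\<And>p. homogeneous ?N p \<Longrightarrow> Poly_Mapping.lookup p ones = (\<Sum>s\<in>S. w s * eval_poly (\<lambda>v. of_nat (s v)) p)"
    using ex_coeff_functional_homogeneous[of ?N ones] by blast
  define M where "M s = ((\<chi> i j. of_nat (s (i, j))) :: complex^'n^'n)" for s :: "'n \<times> 'n \<Rightarrow> nat"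
  have M: "(\<lambda>v. of_nat (s v)) = entries (M s)" for s
    by (simp add: M_def entries_def fun_eq_iff)
  have hom: "homogeneous ?N (?G g)" for g
  proof -
    have "homogeneous (\<Sum>k\<in>(UNIV::'n set). \<Sum>i\<in>(UNIV::'n set). 1) (?G g)"
      by (intro homogeneous_prod homogeneous_sum homogeneous_single) auto
    then show ?thesis by simp
  qed
  have eval: "eval_poly (entries T) (?G g) = (\<Prod>i\<in>UNIV. \<Prod>k\<in>UNIV. (mat 1 ** g ** T) $ i $ k)" for T g :: "complex^'n^'n"
    unfolding matrix_mul_lid by (subst prod.swap) (simp add: eval_poly_prod eval_poly_sum eval_poly_single entries_def matrix_matrix_mult_def)
  have int: "integrable \<mu> (\<lambda>g. \<Prod>i\<in>UNIV. \<Prod>k\<in>UNIV. (mat 1 ** g ** T) $ i $ k)" for T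
    unfolding matrix_matrix_mult_def by (intro integrable_cont) (auto intro!: continuous_intros)
  have "(LINT g|\<mu>. perm g ^ CARD('n)) = (LINT g|\<mu>. (\<Sum>s\<in>S. w s * (\<Prod>i\<in>UNIV. \<Prod>k\<in>UNIV. (mat 1 ** g ** M s) $ i $ k)))"
    unfolding coeff_perm[symmetric] S(2)[OF hom] M eval ..
  also have "\<dots> = (\<Sum>s\<in>S. w s * (LINT g|\<mu>. (\<Prod>i\<in>UNIV. \<Prod>k\<in>UNIV. (mat 1 ** g ** M s) $ i $ k)))"
    by (subst Bochner_Integration.integral_sum) (simp_all only: int integrable_mult_right integral_mult_right_zero)
  also have "\<dots> = (\<Sum>s\<in>S. w s * eval_poly (\<lambda>v. of_nat (s v)) (det generic_matrix ^ CARD('n))) * entry_integral"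
    by (simp only: integral_entries_translate M eval_poly_power eval_det_generic_matrix) (simp add: sum_distrib_left mult_ac)
  also have "(\<Sum>s\<in>S. w s * eval_poly (\<lambda>v. of_nat (s v)) (det generic_matrix ^ CARD('n)))
     = Poly_Mapping.lookup (det (generic_matrix :: ('n \<times> 'n) cpoly^'n^'n) ^ CARD('n)) ones"
    by (simp add: S(2) homogeneous_det_generic_matrix)
  finally show ?thesis .
qed

end

section \<open>The Schur module\<close>

text \<open>The Levi-Civita symbol, which is zero at maps that are not bijective; hence sums over
  permutations may be taken over all maps.\<close>

definition eps :: "('n::finite \<Rightarrow> 'n) \<Rightarrow> complex" where
  "eps v = det (\<chi> a b. of_bool (v a = b))"

lemma eps_bij:
  fixes v :: "'n::finite \<Rightarrow> 'n"
  assumes "bij v"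
  shows "eps v = of_int (sign v)"
proof -
  have "(\<chi> a b. of_bool (v a = b)) = ((\<chi> a. (mat 1 :: complex^'n^'n) $ v a) :: complex^'n^'n)"
    by (simp add: vec_eq_iff mat_def of_bool_def)
  then show ?thesis
    using det_permute_rows[of v "mat 1 :: complex^'n^'n"] assms by (simp add: eps_def permutes_UNIV_iff)
qed

lemma eps_not_inj:
  assumes "v a = v b" "a \<noteq> b"
  shows "eps v = 0"
  unfolding eps_def using assms by (intro det_identical_rows[of a b]) (auto simp: row_def)

lemma eps_not_bij: "\<not> bij v \<Longrightarrow> eps v = 0"
  using eps_not_inj unfolding bij_def by (metis finite_UNIV_inj_surj injI finite)

lemma det_eq_sum_eps:
  fixes A :: "complex^'n::finite^'n"
  shows "(\<Sum>v\<in>UNIV. (\<Prod>a\<in>UNIV. A $ a $ v a) * eps v) = det A"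
proof -
  have "(\<Sum>v\<in>UNIV. (\<Prod>a\<in>UNIV. A $ a $ v a) * eps v) = (\<Sum>v | v permutes UNIV. (\<Prod>a\<in>UNIV. A $ a $ v a) * eps v)"
    by (intro sum.mono_neutral_right) (auto simp: permutes_UNIV_iff eps_not_bij)
  also have "\<dots> = det A"
    by (auto simp: det_def permutes_UNIV_iff eps_bij intro!: sum.cong)
  finally show ?thesis .
qed

text \<open>Selecting rows of \<open>g\<close> along \<open>u\<close> is multiplication from the
  left by the 0-1 matrix of \<open>u\<close>. For tensors this says that \<open>eps\<close> spans a
  determinant line in the n-th tensor power.\<close>

lemma sum_minor_eps:
  fixes g :: "complex^'n::finite^'n"
  shows "(\<Sum>v\<in>UNIV. (\<Prod>a\<in>UNIV. g $ u a $ v a) * eps v) = det g * eps u"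
proof -
  have "(\<chi> a b. of_bool (u a = b)) ** g = (\<chi> a b. g $ u a $ b)"
    by (simp add: matrix_matrix_mult_def vec_eq_iff of_bool_def if_distrib[of "\<lambda>x. x * _"] cong: if_cong)
  then have "det (\<chi> a b. g $ u a $ b) = eps u * det g"
    by (metis eps_def det_mul)
  then show ?thesis
    using det_eq_sum_eps[of "\<chi> a b. g $ u a $ b"] by simp
qed

section \<open>Tensors of square shape\<close>

locale cell_coordinates =
  fixes \<beta> :: "nat \<Rightarrow> 'n::finite" and shape :: "nat list"
  assumes bij_beta: "bij_betw \<beta> {..<CARD('n)} UNIV"
    and shape: "shape = replicate (CARD('n)) (CARD('n))"
begin

text \<open>The column label comes first, so that column permutations act on the second component.\<close>

definition cell :: "'n \<times> 'n \<Rightarrow> nat \<times> nat" where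
  "cell = (\<lambda>(a, b). (inv_into {..<CARD('n)} \<beta> b, inv_into {..<CARD('n)} \<beta> a))"

text \<open>Translates maps on \<open>'n \<times> 'n\<close> into basis maps; outside the shape the
  value has to be \<open>undefined\<close>, as for every extensional function.\<close>

definition filling :: "('n \<times> 'n \<Rightarrow> 'n) \<Rightarrow> nat \<times> nat \<Rightarrow> 'n" where
  "filling F c = (if c \<in> cells shape then F (\<beta> (snd c), \<beta> (fst c)) else undefined)"

lemma cells_shape: "cells shape = {..<CARD('n)} \<times> {..<CARD('n)}"
  by (auto simp: cells_def shape)

lemma beta_inv: "\<beta> (inv_into {..<CARD('n)} \<beta> b) = b" "inv_into {..<CARD('n)} \<beta> b < CARD('n)"
  "i < CARD('n) \<Longrightarrow> inv_into {..<CARD('n)} \<beta> (\<beta> i) = i"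
  using bij_beta bij_betw_inv_into_left[OF bij_beta, of i] bij_betw_inv_into_right[OF bij_beta, of b]
    bij_betwE[OF bij_betw_inv_into[OF bij_beta]]
  by auto

lemma bij_cell: "bij_betw cell UNIV (cells shape)"
  by (rule bij_betw_byWitness[of _ "\<lambda>(i, j). (\<beta> j, \<beta> i)"]) (auto simp: cell_def cells_shape beta_inv)

lemma cell_in_cells: "cell v \<in> cells shape"
  using bij_cell by (auto simp: bij_betw_def)

lemma filling_cell: "filling F (cell v) = F v"
  using cell_in_cells[of v] by (auto simp: filling_def cell_def beta_inv case_prod_beta)

lemma filling_comp_cell: "filling F \<circ> cell = F"
  by (simp add: fun_eq_iff filling_cell)

lemma basis_maps_eq: "(basis_maps shape :: (nat \<times> nat \<Rightarrow> 'n) set) = range filling"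
proof (intro equalityI subsetI)
  fix f :: "nat \<times> nat \<Rightarrow> 'n" assume f: "f \<in> basis_maps shape"
  have "f = filling (f \<circ> cell)"
  proof
    fix c show "f c = filling (f \<circ> cell) c"
    proof (cases "c \<in> cells shape")
      case True
      then obtain v where "c = cell v" using bij_cell by (metis bij_betw_imp_surj_on imageE)
      then show ?thesis by (simp add: filling_cell)
    next
      case False
      then show ?thesis using PiE_arb[OF f] by (simp add: filling_def)
    qed
  qed
  then show "f \<in> range filling" by blast
qed (auto simp: filling_def)

lemma inj_filling: "inj filling"
  by (metis filling_comp_cell injI)

text \<open>The coefficients of the n-th tensor power of the volume element, one factor for each
  column.\<close>

definition vol :: "('n \<times> 'n \<Rightarrow> 'n) \<Rightarrow> complex" where
  "vol F = (\<Prod>a\<in>UNIV. eps (\<lambda>b. F (a, b)))"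

text \<open>The tableau with constant rows, each holding its own index, so that every column lists
  all indices in order.\<close>

definition std :: "nat \<times> nat \<Rightarrow> 'n" where
  "std = filling snd"

lemma vol_snd: "vol snd = 1"
  using eps_bij[of "\<lambda>b :: 'n. b"] by (simp add: vol_def bij_id[unfolded id_def])

text \<open>If every column of \<open>F\<close> is bijective, \<open>F\<close> arises from
  \<open>std\<close> by a column permutation whose sign is \<open>vol F\<close>. Otherwise a column
  repeats a value; exchanging the two cells fixes the filling and reverses the sign, so both sides
  vanish.\<close>

lemma alternating_eq_vol:
  fixes S :: "'n tensor"
  assumes alt: "\<And>f q. q \<in> column_group shape \<Longrightarrow> S (f \<circ> q) = of_int (sign q) * S f"
  shows "S (filling F) = S std * vol F"
proof (cases "\<forall>a. bij (\<lambda>b. F (a, b))")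
  case True
  define r where "r = (\<lambda>(a :: 'n, b). (a, F (a, b)))"
  define q where "q = map_permutation UNIV cell r"
  have r: "bij r" "sign r = (\<Prod>a\<in>UNIV. sign (\<lambda>b. F (a, b)))"
    unfolding r_def using sign_fibrewise[of "\<lambda>a b. F (a, b)"] True by auto
  have inj: "inj cell" using bij_cell by (simp add: bij_betw_def)
  have q: "q permutes cells shape" "sign q = sign r"
    unfolding q_def using map_permutation_permutes[OF bij_cell] sign_map_permutation[OF inj] r
    by (auto simp: permutes_UNIV_iff)
  have q_cell: "q (cell v) = cell (r v)" for v
    unfolding q_def by (rule map_permutation_apply[OF inj]) simp
  have "snd (q c) = snd c" if c: "c \<in> cells shape" for c
  proof -
    obtain v where "c = cell v" using bij_cell c by (metis bij_betw_imp_surj_on imageE)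
    then show ?thesis by (simp add: q_cell) (simp add: cell_def r_def case_prod_beta)
  qed
  then have "q \<in> column_group shape" using q by (simp add: column_group_def)
  moreover have "filling F = std \<circ> q"
  proof
    fix c show "filling F c = (std \<circ> q) c"
    proof (cases "c \<in> cells shape")
      case True
      then obtain v where "c = cell v" using bij_cell by (metis bij_betw_imp_surj_on imageE)
      then show ?thesis by (simp add: q_cell std_def filling_cell) (simp add: r_def case_prod_beta)
    next
      case False
      then show ?thesis using permutes_not_in[OF q(1)] by (simp add: std_def filling_def)
    qed
  qed
  ultimately have "S (filling F) = of_int (sign q) * S std" by (simp add: alt)
  also have "of_int (sign q) = vol F" using True by (simp add: q r vol_def eps_bij)
  finally show ?thesis by simp
next
  case False
  then obtain a where "\<not> bij (\<lambda>b. F (a, b))" by blast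
  then have "\<not> inj (\<lambda>b. F (a, b))" using finite_UNIV_inj_surj[of "\<lambda>b. F (a, b)"] by (simp add: bij_def)
  then obtain b b' where b: "F (a, b) = F (a, b')" "b \<noteq> b'" by (auto simp: inj_def)
  define q where "q = Transposition.transpose (cell (a, b)) (cell (a, b'))"
  have ne: "cell (a, b) \<noteq> cell (a, b')" using b bij_cell by (auto simp: bij_betw_def inj_def)
  have "q permutes cells shape"
    unfolding q_def by (intro permutes_swap_id cell_in_cells)
  moreover have "snd (q c) = snd c" for c
    by (auto simp: q_def Transposition.transpose_def cell_def)
  ultimately have "q \<in> column_group shape" by (simp add: column_group_def)
  then have "S (filling F \<circ> q) = - S (filling F)"
    using alt ne by (simp add: q_def sign_swap_id)
  moreover have "filling F \<circ> q = filling F"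
    using b by (auto simp: fun_eq_iff q_def Transposition.transpose_def filling_cell)
  ultimately have "S (filling F) = 0" by (simp add: eq_neg_iff_add_eq_0 flip: mult_2)
  moreover have "vol F = 0"
    unfolding vol_def using eps_not_inj[of "\<lambda>b. F (a, b)", OF b] by (intro prod_zero) auto
  ultimately show ?thesis by simp
qed

definition vol_tensor :: "'n tensor" where
  "vol_tensor f = (if f \<in> basis_maps shape then vol (f \<circ> cell) else 0)"

lemma vol_tensor_filling: "vol_tensor (filling F) = vol F"
  by (simp add: vol_tensor_def basis_maps_eq filling_comp_cell)

text \<open>The sum over fillings factors over the n columns, and by \<open>sum_minor_eps\<close>
  each column contributes a determinant of \<open>g\<close>.\<close>

lemma tensor_act_vol:
  assumes T: "T = (\<lambda>f. s * vol_tensor f)"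
  shows "tensor_act shape g T = (\<lambda>f. det g ^ CARD('n) * T f)"
proof
  fix f :: "nat \<times> nat \<Rightarrow> 'n"
  show "tensor_act shape g T f = det g ^ CARD('n) * T f"
  proof (cases "f \<in> basis_maps shape")
    case False
    then show ?thesis by (simp add: tensor_act_def T vol_tensor_def)
  next
    case True
    then obtain F where f: "f = filling F" by (auto simp: basis_maps_eq)
    have "tensor_act shape g T f = (\<Sum>h\<in>range filling. (\<Prod>c\<in>cells shape. g $ f c $ h c) * T h)"
      using True by (simp add: tensor_act_def flip: basis_maps_eq)
    also have "\<dots> = (\<Sum>G\<in>UNIV. (\<Prod>c\<in>cells shape. g $ f c $ filling G c) * T (filling G))"
      by (subst sum.reindex[OF inj_filling]) simp
    also have "\<dots> = (\<Sum>G\<in>UNIV. s * ((\<Prod>v\<in>UNIV. g $ F v $ G v) * vol G))"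
    proof (intro sum.cong refl)
      fix G :: "'n \<times> 'n \<Rightarrow> 'n"
      have "(\<Prod>c\<in>cells shape. g $ f c $ filling G c) = (\<Prod>v\<in>UNIV. g $ F v $ G v)"
        by (subst prod.reindex_bij_betw[OF bij_cell, symmetric]) (simp add: f filling_cell)
      then show "(\<Prod>c\<in>cells shape. g $ f c $ filling G c) * T (filling G) = s * ((\<Prod>v\<in>UNIV. g $ F v $ G v) * vol G)"
        by (simp add: T vol_tensor_filling)
    qed
    also have "\<dots> = s * (\<Sum>G\<in>UNIV. \<Prod>a\<in>UNIV. ((\<Prod>b\<in>UNIV. g $ F (a, b) $ G (a, b)) * eps (\<lambda>b. G (a, b))))"
      by (simp add: sum_distrib_left vol_def prod.distrib prod.cartesian_product)
    also have "(\<Sum>G\<in>UNIV. \<Prod>a\<in>UNIV. ((\<Prod>b\<in>UNIV. g $ F (a, b) $ G (a, b)) * eps (\<lambda>b. G (a, b))))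
       = (\<Sum>G\<in>UNIV. \<Prod>a\<in>(UNIV :: 'n set). ((\<Prod>b\<in>UNIV. g $ F (a, b) $ G a b) * eps (G a)))"
      by (rule sum.reindex_bij_witness[of _ case_prod curry]) (auto simp: curry_def)
    also have "\<dots> = (\<Prod>a\<in>(UNIV :: 'n set). \<Sum>v\<in>UNIV. (\<Prod>b\<in>UNIV. g $ F (a, b) $ v b) * eps v)"
      by (subst prod_sum_PiE) auto
    also have "\<dots> = det g ^ CARD('n) * vol F"
      by (simp add: sum_minor_eps prod.distrib vol_def)
    finally show ?thesis by (simp add: T f vol_tensor_filling)
  qed
qed

section \<open>The image of the Young symmetrizer\<close>

lemma group_permutes_cells:
  "p \<in> row_group shape \<Longrightarrow> p permutes cells shape" "p \<in> column_group shape \<Longrightarrow> p permutes cells shape"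
  by (auto simp: row_group_def column_group_def)

lemma finite_cells: "finite (cells shape)" by (simp add: cells_shape)

lemma finite_groups: "finite (row_group shape)" "finite (column_group shape)"
  by (rule finite_subset[OF _ finite_permutations[OF finite_cells]]; auto simp: row_group_def column_group_def)+

text \<open>The column sum is outermost, so composing with \<open>r\<close> reindexes it.\<close>

lemma young_symmetrizer_alternating:
  fixes T :: "'n tensor"
  assumes r: "r \<in> column_group shape"
  shows "young_symmetrizer shape T (f \<circ> r) = of_int (sign r) * young_symmetrizer shape T f"
proof -
  have rc: "r permutes cells shape" "\<And>c. c \<in> cells shape \<Longrightarrow> snd (r c) = snd c" using r by (auto simp: column_group_def)
  have comp: "p \<circ> q \<in> column_group shape" if "p \<in> column_group shape" "q \<in> column_group shape" for p q
    using that by (auto simp: column_group_def permutes_compose permutes_in_image)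
  have inv: "inv_into UNIV r \<in> column_group shape"
  proof -
    have "snd (inv_into UNIV r c) = snd c" if "c \<in> cells shape" for c
      using rc(2)[of "inv_into UNIV r c"] permutes_in_image[OF permutes_inv[OF rc(1)], of c] permutes_inverses(1)[OF rc(1), of c] that
      by simp
    then show ?thesis using permutes_inv[OF rc(1)] by (simp add: column_group_def)
  qed
  have perm: "permutation q" if "q \<in> column_group shape" for q
    using that group_permutes_cells finite_cells permutation_permutes by blast
  have "young_symmetrizer shape T (f \<circ> r) = (\<Sum>q\<in>column_group shape. \<Sum>p\<in>row_group shape. of_int (sign q) * T (f \<circ> (r \<circ> q) \<circ> p))"
    by (simp add: young_symmetrizer_def o_assoc)
  also have "\<dots> = (\<Sum>q\<in>column_group shape. \<Sum>p\<in>row_group shape. of_int (sign r * sign q) * T (f \<circ> q \<circ> p))"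
  proof (rule sum.reindex_bij_witness[of _ "\<lambda>q. inv_into UNIV r \<circ> q" "\<lambda>q. r \<circ> q"])
    fix q assume q: "q \<in> column_group shape"
    show "inv_into UNIV r \<circ> (r \<circ> q) = q" "r \<circ> (inv_into UNIV r \<circ> q) = q"
      using permutes_inv_o[OF rc(1)] by (simp_all add: o_assoc)
    show "r \<circ> q \<in> column_group shape" "inv_into UNIV r \<circ> q \<in> column_group shape" using r inv q comp by auto
    have "sign r * sign (r \<circ> q) = sign q" using perm[OF r] perm[OF q] by (simp add: sign_compose)
    then show "(\<Sum>p\<in>row_group shape. of_int (sign r * sign (r \<circ> q)) * T (f \<circ> (r \<circ> q) \<circ> p))
       = (\<Sum>p\<in>row_group shape. of_int (sign q) * T (f \<circ> (r \<circ> q) \<circ> p))" by simp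
  qed
  also have "\<dots> = of_int (sign r) * young_symmetrizer shape T f"
    by (simp add: young_symmetrizer_def sum_distrib_left mult.assoc)
  finally show ?thesis .
qed

lemma young_symmetrizer_supported:
  assumes "T \<in> tensors shape" "f \<notin> basis_maps shape"
  shows "young_symmetrizer shape T f = 0"
proof -
  have "T (f \<circ> q \<circ> p) = 0" if "q \<in> column_group shape" "p \<in> row_group shape" for q p
  proof -
    \<comment> \<open>With all of \<open>'n\<close> allowed as values, a map fails to be a basis map
      only by being defined at some point outside the shape, and such points are fixed by
      \<open>p\<close> and \<open>q\<close>.\<close>
    obtain c where c: "c \<notin> cells shape" "f c \<noteq> undefined"
      using assms(2) by (auto simp: PiE_def extensional_def)
    have "(f \<circ> q \<circ> p) c = f c"
      using permutes_not_in[OF group_permutes_cells(1)[OF that(2)] c(1)] permutes_not_in[OF group_permutes_cells(2)[OF that(1)] c(1)]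
      by simp
    then have "f \<circ> q \<circ> p \<notin> basis_maps shape"
      using c by (metis PiE_arb)
    then show ?thesis using assms(1) by (simp add: tensors_def)
  qed
  then show ?thesis by (simp add: young_symmetrizer_def)
qed

lemma young_symmetrizer_eq_vol:
  assumes "T \<in> tensors shape"
  shows "young_symmetrizer shape T = (\<lambda>f. young_symmetrizer shape T std * vol_tensor f)"
proof
  fix f show "young_symmetrizer shape T f = young_symmetrizer shape T std * vol_tensor f"
  proof (cases "f \<in> basis_maps shape")
    case True
    then obtain F where "f = filling F" by (auto simp: basis_maps_eq)
    then show ?thesis
      using alternating_eq_vol[of "young_symmetrizer shape T", OF young_symmetrizer_alternating]
      by (simp add: vol_tensor_filling)
  next
    case False
    then show ?thesis using young_symmetrizer_supported[OF assms] by (simp add: vol_tensor_def)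
  qed
qed

text \<open>Shows that the symmetrizer does not vanish. The rows of \<open>std\<close> are constant,
  so every row permutation fixes it, while a column permutation compatible with it must also
  preserve rows and is the identity. Hence nothing cancels.\<close>

lemma young_symmetrizer_std: "young_symmetrizer shape (\<lambda>f. of_bool (f = std)) std = of_nat (card (row_group shape))"
proof -
  have std_eq: "std c = \<beta> (fst c)" if "c \<in> cells shape" for c
    using that by (simp add: std_def filling_def)
  have inj: "fst c = fst d" if "c \<in> cells shape" "d \<in> cells shape" "\<beta> (fst c) = \<beta> (fst d)" for c d
    using that bij_beta by (auto simp: cells_shape bij_betw_def inj_on_def)
  have "std \<circ> q \<circ> p = std \<longleftrightarrow> q = id" if q: "q \<in> column_group shape" and p: "p \<in> row_group shape" for q p
  proof
    have pc: "p permutes cells shape" and qc: "q permutes cells shape" using p q group_permutes_cells by auto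
    assume eq: "std \<circ> q \<circ> p = std"
    have "q c = c" if c: "c \<in> cells shape" for c
    proof -
      obtain d where d: "d \<in> cells shape" "c = p d"
        using c permutes_image[OF pc] by (metis imageE)
      have qc': "q c \<in> cells shape" using c permutes_in_image[OF qc] by simp
      have "std (q c) = std d" using eq d by (metis o_apply)
      then have "fst (q c) = fst d" using inj qc' d by (simp add: std_eq)
      also have "fst d = fst c" using p d by (simp add: row_group_def)
      finally show ?thesis using q c by (simp add: column_group_def prod_eq_iff)
    qed
    then show "q = id" using permutes_not_in[OF qc] by (metis eq_id_iff)
  next
    assume "q = id"
    moreover have "std (p c) = std c" for c
    proof (cases "c \<in> cells shape")
      case True
      then show ?thesis using p permutes_in_image[OF group_permutes_cells(1)[OF p], of c]
        by (simp add: std_eq row_group_def)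
    next
      case False
      then show ?thesis using permutes_not_in[OF group_permutes_cells(1)[OF p]] by simp
    qed
    ultimately show "std \<circ> q \<circ> p = std" by (intro ext) simp
  qed
  then have "young_symmetrizer shape (\<lambda>f. of_bool (f = std)) std
     = (\<Sum>q\<in>column_group shape. \<Sum>p\<in>row_group shape. of_int (sign q) * of_bool (q = id))"
    by (simp add: young_symmetrizer_def)
  also have "\<dots> = (\<Sum>q\<in>column_group shape. if q = id then of_nat (card (row_group shape)) else 0)"
    by (intro sum.cong) auto
  also have "id \<in> column_group shape" by (simp add: column_group_def permutes_id)
  then have "(\<Sum>q\<in>column_group shape. if q = id then of_nat (card (row_group shape)) else 0) = (of_nat (card (row_group shape)) :: complex)"
    by (simp add: finite_groups)
  finally show ?thesis .
qed

lemma schur_vecs: "vecs (schur_module shape :: ('n, 'n tensor) gmodule) = {(\<lambda>f. s * vol_tensor f) | s. True}"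
proof (intro equalityI subsetI)
  fix T :: "'n tensor" assume "T \<in> vecs (schur_module shape)"
  then obtain T' where "T' \<in> tensors shape" "T = young_symmetrizer shape T'" by (auto simp: schur_module_def)
  then show "T \<in> {(\<lambda>f. s * vol_tensor f) | s. True}" using young_symmetrizer_eq_vol by blast
next
  fix T :: "'n tensor" assume "T \<in> {(\<lambda>f. s * vol_tensor f) | s. True}"
  then obtain s where T: "T = (\<lambda>f. s * vol_tensor f)" by blast
  define c where "c = s / of_nat (card (row_group shape))"
  define T' where "T' = (\<lambda>f. c * of_bool (f = std))"
  have "id \<in> row_group shape" by (simp add: row_group_def permutes_id)
  then have "card (row_group shape) \<noteq> 0" using finite_groups by auto
  moreover have "young_symmetrizer shape T' std = c * young_symmetrizer shape (\<lambda>f. of_bool (f = std)) std"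
    by (simp add: T'_def young_symmetrizer_def sum_distrib_left mult_ac)
  ultimately have "young_symmetrizer shape T' std = s"
    by (simp add: young_symmetrizer_std c_def)
  moreover have T': "T' \<in> tensors shape" by (auto simp: tensors_def T'_def std_def basis_maps_eq)
  ultimately have "T = young_symmetrizer shape T'" using young_symmetrizer_eq_vol[OF T'] by (simp add: T)
  then show "T \<in> vecs (schur_module shape)" using T' by (auto simp: schur_module_def)
qed

end

text \<open>Frees the result from the enumeration of the cells. Evaluation at
  \<open>f\<^sub>0\<close> reads off the coordinate of a vector on the line.\<close>

lemma schur_module_line:
  obtains e :: "('n::finite) tensor" and f\<^sub>0 where
    "e f\<^sub>0 = 1" "vecs (schur_module (replicate (CARD('n)) (CARD('n)))) = {(\<lambda>f. s * e f) | s. True}"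
    "\<And>g s. tensor_act (replicate (CARD('n)) (CARD('n))) g (\<lambda>f. s * e f) = (\<lambda>f. det g ^ CARD('n) * (s * e f))"
proof -
  obtain \<beta> :: "nat \<Rightarrow> 'n" where "bij_betw \<beta> {..<CARD('n)} UNIV"
    using ex_bij_betw_nat_finite[of "UNIV :: 'n set"] by (auto simp: atLeast0LessThan)
  then interpret cell_coordinates \<beta> "replicate (CARD('n)) (CARD('n))" by unfold_locales simp_all
  show ?thesis
    using that[of vol_tensor std] schur_vecs tensor_act_vol
    by (simp add: std_def vol_tensor_filling vol_snd)
qed

section \<open>The coordinate ring of the Chow variety\<close>

definition vars_in :: "'v set \<Rightarrow> 'v cpoly \<Rightarrow> bool" where
  "vars_in V p \<longleftrightarrow> (\<forall>m\<in>Poly_Mapping.keys p. Poly_Mapping.keys m \<subseteq> V)"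

lemma vars_in_UNIV [simp]: "vars_in UNIV p" by (simp add: vars_in_def)

lemma vars_in_0 [simp]: "vars_in V 0" by (simp add: vars_in_def)

lemma vars_in_add: "vars_in V p \<Longrightarrow> vars_in V q \<Longrightarrow> vars_in V (p + q)"
  using Poly_Mapping.keys_add[of p q] by (auto simp: vars_in_def)

lemma vars_in_uminus: "vars_in V p \<Longrightarrow> vars_in V (- p)"
  by (simp add: vars_in_def)

lemma vars_in_mult:
  assumes "vars_in V p" "vars_in V q"
  shows "vars_in V (p * q)"
  unfolding vars_in_def
proof
  fix m assume "m \<in> Poly_Mapping.keys (p * q)"
  then obtain a b where "m = a + b" "a \<in> Poly_Mapping.keys p" "b \<in> Poly_Mapping.keys q"
    using Poly_Mapping.keys_mult[of p q] by blast
  then show "Poly_Mapping.keys m \<subseteq> V"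
    using assms Poly_Mapping.keys_add[of a b] unfolding vars_in_def by blast
qed

lemma vars_in_const [simp]: "vars_in V (const c)"
  by (simp add: vars_in_def const_def)

lemma vars_in_one [simp]: "vars_in V 1"
  using vars_in_const[of V 1] by (simp add: const_def)

lemma vars_in_Var: "v \<in> V \<Longrightarrow> vars_in V (Var v)"
  by (simp add: vars_in_def Var_def)

lemma vars_in_sum: "(\<And>x. x \<in> A \<Longrightarrow> vars_in V (f x)) \<Longrightarrow> vars_in V (\<Sum>x\<in>A. f x)"
  by (induction A rule: infinite_finite_induct) (auto intro: vars_in_add)

lemma vars_in_prod: "(\<And>x. x \<in> A \<Longrightarrow> vars_in V (f x)) \<Longrightarrow> vars_in V (\<Prod>x\<in>A. f x)"
  by (induction A rule: infinite_finite_induct) (auto intro: vars_in_mult)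

lemma vars_in_power: "vars_in V p \<Longrightarrow> vars_in V (p ^ k)"
  by (induction k) (auto intro: vars_in_mult)

lemma vars_in_subst:
  assumes "\<And>v. vars_in V (s v)"
  shows "vars_in V (subst_poly s p)"
  unfolding subst_poly_def
  by (intro vars_in_sum vars_in_mult vars_in_prod vars_in_power vars_in_const assms)

lemma eval_poly_cong:
  assumes "vars_in V p" "\<And>v. v \<in> V \<Longrightarrow> a v = b v"
  shows "eval_poly a p = eval_poly b p"
proof -
  have "a v = b v" if "m \<in> Poly_Mapping.keys p" "v \<in> Poly_Mapping.keys m" for m v
    using assms that unfolding vars_in_def by blast
  then show ?thesis unfolding eval_poly_def by simp
qed

text \<open>Coefficients are combinations of values. The finite set \<open>V\<close> makes this
  available for polynomials whose variables are themselves monomials, of which there are infinitely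
  many.\<close>

lemma eval_poly_inject:
  assumes V: "finite V" and p: "vars_in V p" and q: "vars_in V q"
    and eq: "\<And>a. eval_poly a p = eval_poly a q"
  shows "p = q"
proof (rule poly_mapping_eqI)
  fix m
  show "Poly_Mapping.lookup p m = Poly_Mapping.lookup q m"
  proof (cases "Poly_Mapping.keys m \<subseteq> V")
    case True
    define d where "d = (\<Sum>m'\<in>Poly_Mapping.keys p \<union> Poly_Mapping.keys q. mdeg m')"
    have d: "Poly_Mapping.lookup m' v \<le> d" if "m' \<in> Poly_Mapping.keys p \<union> Poly_Mapping.keys q" for m' v
      using lookup_le_mdeg[of m' v] member_le_sum[of m' "Poly_Mapping.keys p \<union> Poly_Mapping.keys q" mdeg] that
      by (auto simp: d_def)
    obtain S :: "('a \<Rightarrow> nat) set" and w where S: "\<And>p. \<forall>m'\<in>Poly_Mapping.keys p. Poly_Mapping.keys m' \<subseteq> V \<and> (\<forall>v. Poly_Mapping.lookup m' v \<le> d) \<Longrightarrow>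
       Poly_Mapping.lookup p m = (\<Sum>s\<in>S. w s * eval_poly (\<lambda>v. of_nat (s v)) p)"
      using ex_coeff_functional[OF V True, of d] by blast
    show ?thesis using S[of p] S[of q] p q d eq by (simp add: vars_in_def)
  next
    case False
    then have "m \<notin> Poly_Mapping.keys p" "m \<notin> Poly_Mapping.keys q" using p q by (auto simp: vars_in_def)
    then show ?thesis by (simp add: in_keys_iff)
  qed
qed

lemma eval_poly_uminus: "eval_poly a (- p) = - eval_poly a p"
  using eval_poly_add[of a p "- p"] by (simp add: eq_neg_iff_add_eq_0 add.commute)

lemma monom_val_scale: "monom_val (\<lambda>v. c * a v) m = c ^ mdeg m * monom_val a m"
  by (simp add: monom_val_def mdeg_def power_mult_distrib prod.distrib power_sum)

lemma eval_poly_scale: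
  fixes p :: "('v::finite) cpoly"
  assumes "homogeneous d p"
  shows "eval_poly (\<lambda>v. c * a v) p = c ^ d * eval_poly a p"
  by (simp add: eval_poly_homogeneous[OF assms] monom_val_scale sum_distrib_left mult_ac)

section \<open>Linear substitutions and products of linear forms\<close>

lemma homogeneous_subst:
  assumes "homogeneous d p" "\<And>v. homogeneous 1 (s v)"
  shows "homogeneous d (subst_poly s p)"
  unfolding subst_poly_def
proof (intro homogeneous_sum homogeneous_const_mult)
  fix m assume m: "m \<in> Poly_Mapping.keys p"
  have "homogeneous (\<Sum>v\<in>Poly_Mapping.keys m. Poly_Mapping.lookup m v * 1) (\<Prod>v\<in>Poly_Mapping.keys m. s v ^ Poly_Mapping.lookup m v)"
    by (intro homogeneous_prod homogeneous_power assms) simp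
  then show "homogeneous d (\<Prod>v\<in>Poly_Mapping.keys m. s v ^ Poly_Mapping.lookup m v)"
    using assms(1) m by (simp add: homogeneous_def mdeg_def)
qed

lemma homogeneous_form_comp: "homogeneous d z \<Longrightarrow> homogeneous d (form_comp z g)"
  unfolding form_comp_def
  by (intro homogeneous_subst homogeneous_sum homogeneous_const_mult homogeneous_Var)

lemma form_comp_mult: "form_comp (form_comp z g) h = form_comp z (g ** h)"
proof (rule eval_poly_inject[of UNIV])
  fix a
  have "(\<Sum>k\<in>UNIV. g $ j $ k * (\<Sum>l\<in>UNIV. h $ k $ l * a l)) = (\<Sum>l\<in>UNIV. (g ** h) $ j $ l * a l)" for j
    by (simp add: matrix_matrix_mult_def sum_distrib_left sum_distrib_right mult.assoc) (rule sum.swap)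
  then show "eval_poly a (form_comp (form_comp z g) h) = eval_poly a (form_comp z (g ** h))"
    by (simp add: eval_form_comp)
qed simp_all

lemma form_comp_one: "form_comp z (mat 1) = z"
  by (rule eval_poly_inject[of UNIV])
     (simp_all add: eval_form_comp mat_def if_distrib[of "\<lambda>x. x * _"] cong: if_cong)

lemma form_comp_prod: "form_comp (\<Prod>x\<in>A. w x) g = (\<Prod>x\<in>A. form_comp (w x) g)"
  by (rule eval_poly_inject[of UNIV]) (simp_all add: eval_form_comp eval_poly_prod)

lemma form_comp_diag:
  assumes "homogeneous d (z :: ('n::finite) cpoly)"
  shows "form_comp z (diag_matrix (\<lambda>_. c)) = const (c ^ d) * z"
proof (rule eval_poly_inject[of UNIV])
  fix a :: "'n \<Rightarrow> complex"
  have "(\<Sum>k\<in>UNIV. diag_matrix (\<lambda>_. c) $ j $ k * a k) = c * a j" for j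
    by (simp add: diag_matrix_def if_distrib[of "\<lambda>x. x * _"] cong: if_cong)
  then show "eval_poly a (form_comp z (diag_matrix (\<lambda>_. c))) = eval_poly a (const (c ^ d) * z)"
    by (simp add: eval_form_comp eval_poly_scale[OF assms] eval_poly_mult)
qed simp_all

lemma eval_poly_homogeneous_1:
  fixes w :: "('n::finite) cpoly"
  assumes "homogeneous 1 w"
  shows "eval_poly x w = (\<Sum>k\<in>UNIV. Poly_Mapping.lookup w (Poly_Mapping.single k 1) * x k)"
proof -
  have eq: "{m :: 'n monomial. mdeg m = 1} = range (\<lambda>k. Poly_Mapping.single k 1)"
  proof (intro equalityI subsetI)
    fix m :: "'n monomial" assume "m \<in> {m. mdeg m = 1}"
    then show "m \<in> range (\<lambda>k. Poly_Mapping.single k 1)" using ex_monomial_word[of "{()}" m] by auto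
  qed auto
  have inj: "inj (\<lambda>k :: 'n. Poly_Mapping.single k (1::nat))"
    by (rule injI) (metis lookup_single_eq lookup_single_not_eq zero_neq_one)
  have "eval_poly x w = (\<Sum>m\<in>range (\<lambda>k. Poly_Mapping.single k 1). Poly_Mapping.lookup w m * monom_val x m)"
    by (simp only: eval_poly_homogeneous[OF assms] eq)
  also have "\<dots> = (\<Sum>k\<in>UNIV. Poly_Mapping.lookup w (Poly_Mapping.single k 1) * x k)"
    by (subst sum.reindex[OF inj]) simp
  finally show ?thesis .
qed

text \<open>Row j holds the coefficients of the j-th linear factor; a linear substitution then
  becomes right multiplication of \<open>W\<close>.\<close>

definition factor_matrix :: "('n::finite) cpoly \<Rightarrow> complex^'n^'n \<Rightarrow> bool" where
  "factor_matrix z W \<longleftrightarrow> (\<forall>x. eval_poly x z = (\<Prod>j\<in>UNIV. \<Sum>k\<in>UNIV. W $ j $ k * x k))"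

lemma chow_cone_factor_matrix:
  assumes "(z :: ('n::finite) cpoly) \<in> chow_cone"
  obtains W where "factor_matrix z W"
proof -
  obtain w where w: "\<And>j. homogeneous 1 (w j)" "z = (\<Prod>j\<in>(UNIV::'n set). w j)"
    using assms by (auto simp: chow_cone_def)
  have "factor_matrix z (\<chi> j k. Poly_Mapping.lookup (w j) (Poly_Mapping.single k 1))"
    by (simp add: factor_matrix_def w eval_poly_prod eval_poly_homogeneous_1[OF w(1), unfolded One_nat_def])
  then show ?thesis by (rule that)
qed

lemma factor_matrix_form_comp:
  assumes "factor_matrix z W"
  shows "factor_matrix (form_comp z g) (W ** g)"
proof -
  have "(\<Sum>k\<in>UNIV. W $ j $ k * (\<Sum>l\<in>UNIV. g $ k $ l * x l)) = (\<Sum>l\<in>UNIV. (W ** g) $ j $ l * x l)" for j x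
    by (simp add: matrix_matrix_mult_def sum_distrib_left sum_distrib_right mult.assoc) (rule sum.swap)
  then show ?thesis using assms by (simp add: factor_matrix_def eval_form_comp)
qed

lemma chow_cone_homogeneous: "(z :: ('n::finite) cpoly) \<in> chow_cone \<Longrightarrow> homogeneous CARD('n) z"
  using homogeneous_prod[of "UNIV :: 'n set" "\<lambda>_. 1"] by (auto simp: chow_cone_def)

lemma chow_cone_form_comp:
  assumes "(z :: ('n::finite) cpoly) \<in> chow_cone"
  shows "form_comp z g \<in> chow_cone"
proof -
  obtain w where w: "\<And>j. homogeneous 1 (w j)" "z = (\<Prod>j\<in>(UNIV::'n set). w j)"
    using assms by (auto simp: chow_cone_def)
  then show ?thesis
    unfolding chow_cone_def
    by (intro CollectI exI[of _ "\<lambda>j. form_comp (w j) g"]) (simp add: form_comp_prod homogeneous_form_comp[of 1, unfolded One_nat_def])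
qed

section \<open>The coordinate ring as functions on the cone\<close>

lemma carrier_iff: "F \<in> carrier (form_sym_algebra :: ('n::finite) monomial cpoly ring) \<longleftrightarrow> vars_in {m. mdeg m = CARD('n)} F"
  by (auto simp: form_sym_algebra_def vars_in_def)

lemma form_sym_algebra_simps [simp]:
  "mult form_sym_algebra = (*)" "one form_sym_algebra = 1" "zero form_sym_algebra = 0" "add form_sym_algebra = (+)"
  by (simp_all add: form_sym_algebra_def)

lemma cring_form_sym_algebra: "cring (form_sym_algebra :: ('n::finite) monomial cpoly ring)"
proof (rule cringI)
  show "abelian_group (form_sym_algebra :: 'n monomial cpoly ring)"
  proof (rule abelian_groupI)
    fix x :: "'n monomial cpoly" assume "x \<in> carrier form_sym_algebra"
    then show "\<exists>y\<in>carrier form_sym_algebra. y \<oplus>\<^bsub>form_sym_algebra\<^esub> x = \<zero>\<^bsub>form_sym_algebra\<^esub>"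
      by (intro bexI[of _ "- x"]) (auto simp: carrier_iff vars_in_uminus)
  qed (auto simp: carrier_iff vars_in_add add_ac)
  show "comm_monoid (form_sym_algebra :: 'n monomial cpoly ring)"
    by (rule comm_monoidI) (auto simp: carrier_iff vars_in_mult mult_ac)
qed (auto simp: distrib_right)

lemma ideal_chow_ideal: "ideal (chow_ideal :: ('n::finite) monomial cpoly set) form_sym_algebra"
proof (rule idealI)
  interpret cring "form_sym_algebra :: 'n monomial cpoly ring" by (rule cring_form_sym_algebra)
  show "ring (form_sym_algebra :: 'n monomial cpoly ring)" by (rule ring_axioms)
  show "subgroup chow_ideal (add_monoid (form_sym_algebra :: 'n monomial cpoly ring))"
  proof (rule add.subgroupI)
    show "chow_ideal \<subseteq> carrier (form_sym_algebra :: 'n monomial cpoly ring)" by (auto simp: chow_ideal_def)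
    have "0 \<in> (chow_ideal :: 'n monomial cpoly set)" by (simp add: chow_ideal_def carrier_iff eval_at_form_def)
    then show "chow_ideal \<noteq> ({} :: 'n monomial cpoly set)" by blast
    fix a :: "'n monomial cpoly" assume a: "a \<in> chow_ideal"
    then have "- a \<in> carrier form_sym_algebra" by (simp add: chow_ideal_def carrier_iff vars_in_uminus)
    then have "\<ominus>\<^bsub>form_sym_algebra\<^esub> a = - a"
      using a by (intro minus_equality) (auto simp: chow_ideal_def)
    then show "\<ominus>\<^bsub>form_sym_algebra\<^esub> a \<in> chow_ideal"
      using a by (auto simp: chow_ideal_def carrier_iff vars_in_uminus eval_at_form_def eval_poly_uminus)
    fix b :: "'n monomial cpoly" assume "b \<in> chow_ideal"
    then show "a \<oplus>\<^bsub>form_sym_algebra\<^esub> b \<in> chow_ideal"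
      using a by (auto simp: chow_ideal_def carrier_iff vars_in_add eval_at_form_def eval_poly_add)
  qed
qed (auto simp: chow_ideal_def carrier_iff vars_in_mult eval_at_form_def eval_poly_mult)

definition chow_class :: "('n::finite) monomial cpoly \<Rightarrow> 'n monomial cpoly set" where
  "chow_class F = chow_ideal +>\<^bsub>form_sym_algebra\<^esub> F"

text \<open>The ideal consists of all polynomials vanishing on the cone, so a coset amounts to a
  function on the cone.\<close>

lemma chow_class_eq:
  fixes F :: "('n::finite) monomial cpoly"
  assumes F: "F \<in> carrier form_sym_algebra"
  shows "chow_class F = {G \<in> carrier form_sym_algebra. \<forall>z\<in>chow_cone. eval_at_form z G = eval_at_form z F}"
proof (intro equalityI subsetI)
  fix G assume "G \<in> chow_class F"
  then obtain h where h: "h \<in> chow_ideal" "G = h + F" by (auto simp: chow_class_def a_r_coset_def')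
  then show "G \<in> {G \<in> carrier form_sym_algebra. \<forall>z\<in>chow_cone. eval_at_form z G = eval_at_form z F}"
    using F by (auto simp: chow_ideal_def carrier_iff vars_in_add eval_at_form_def eval_poly_add)
next
  fix G assume G: "G \<in> {G \<in> carrier form_sym_algebra. \<forall>z\<in>chow_cone. eval_at_form z G = eval_at_form z F}"
  then have "G + (- F) \<in> chow_ideal"
    using F by (auto simp: chow_ideal_def carrier_iff vars_in_add vars_in_uminus eval_at_form_def eval_poly_add eval_poly_uminus
      simp del: add_uminus_conv_diff)
  moreover have "G = (G + (- F)) + F" by simp
  ultimately show "G \<in> chow_class F" unfolding chow_class_def a_r_coset_def' form_sym_algebra_simps by blast
qed

lemma vecs_chow_module: "vecs (chow_module :: ('n::finite, 'n monomial cpoly set) gmodule) = chow_class ` carrier form_sym_algebra"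
  by (auto simp: chow_module_def chow_ring_def FactRing_def A_RCOSETS_def' chow_class_def)

lemma vadd_chow_module:
  "F \<in> carrier form_sym_algebra \<Longrightarrow> G \<in> carrier form_sym_algebra \<Longrightarrow>
    vadd chow_module (chow_class F) (chow_class G) = chow_class (F + G)"
  using ideal.a_rcos_sum[OF ideal_chow_ideal]
  by (simp add: chow_module_def chow_ring_def FactRing_def chow_class_def)

lemma const_in_carrier: "const c \<in> carrier form_sym_algebra"
  by (simp add: carrier_iff)

lemma const_mult_in_carrier: "F \<in> carrier form_sym_algebra \<Longrightarrow> const c * F \<in> carrier form_sym_algebra"
  by (simp add: carrier_iff vars_in_mult)

lemma vscale_chow_module:
  "F \<in> carrier form_sym_algebra \<Longrightarrow> vscale chow_module c (chow_class F) = chow_class (const c * F)"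
  using ideal.rcoset_mult_add[OF ideal_chow_ideal const_in_carrier]
  by (simp add: chow_module_def chow_ring_def FactRing_def chow_class_def)

lemma gact_chow_module: "gact chow_module g X = sym_act g ` X"
  by (simp add: chow_module_def)

lemma sym_act_in_carrier: "sym_act g F \<in> carrier (form_sym_algebra :: ('n::finite) monomial cpoly ring)"
  unfolding carrier_iff sym_act_def
  by (intro vars_in_subst vars_in_sum vars_in_mult vars_in_const vars_in_Var)

text \<open>Every assignment of values to the variables in the carrier is the coefficient vector of
  a form, so the values at forms decide equality.\<close>

lemma form_sym_algebra_eqI:
  fixes F G :: "('n::finite) monomial cpoly"
  assumes "F \<in> carrier form_sym_algebra" "G \<in> carrier form_sym_algebra"
    and eq: "\<And>z. homogeneous CARD('n) z \<Longrightarrow> eval_at_form z F = eval_at_form z G"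
  shows "F = G"
proof (rule eval_poly_inject)
  let ?V = "{m :: 'n monomial. mdeg m = CARD('n)}"
  show "finite ?V" by (rule finite_mdeg)
  show F: "vars_in ?V F" and G: "vars_in ?V G" using assms by (simp_all add: carrier_iff)
  fix a :: "'n monomial \<Rightarrow> complex"
  define z where "z = (\<Sum>m\<in>?V. Poly_Mapping.single m (a m))"
  have "homogeneous CARD('n) z"
    unfolding z_def by (intro homogeneous_sum homogeneous_single) auto
  moreover have "Poly_Mapping.lookup z m = a m" if "m \<in> ?V" for m
    using that by (simp add: z_def lookup_sum_single finite_mdeg)
  ultimately show "eval_poly a F = eval_poly a G"
    using eq[of z] eval_poly_cong[OF F, of a "Poly_Mapping.lookup z"] eval_poly_cong[OF G, of a "Poly_Mapping.lookup z"]
    by (simp add: eval_at_form_def)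
qed

lemma sym_act_inverse:
  fixes F :: "('n::finite) monomial cpoly"
  assumes "F \<in> carrier form_sym_algebra" "g ** h = mat 1"
  shows "sym_act g (sym_act h F) = F"
proof (rule form_sym_algebra_eqI[OF sym_act_in_carrier assms(1)])
  fix z :: "'n cpoly" assume z: "homogeneous CARD('n) z"
  show "eval_at_form z (sym_act g (sym_act h F)) = eval_at_form z F"
    by (simp add: eval_sym_act z homogeneous_form_comp form_comp_mult assms(2) form_comp_one)
qed

lemma eval_sym_act_chow:
  "z \<in> chow_cone \<Longrightarrow> eval_at_form z (sym_act g F) = eval_at_form (form_comp z g) F"
  by (rule eval_sym_act[OF chow_cone_homogeneous])

text \<open>The action on cosets is by images, so the reverse inclusion has to exhibit preimages;
  these come from the inverse of \<open>g\<close>.\<close>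

lemma sym_act_chow_class:
  fixes F :: "('n::finite) monomial cpoly"
  assumes F: "F \<in> carrier form_sym_algebra" and g: "g \<in> GL"
    and semi: "\<And>z g. z \<in> chow_cone \<Longrightarrow> g \<in> GL \<Longrightarrow> eval_at_form (form_comp z g) F = det g ^ CARD('n) * eval_at_form z F"
  shows "sym_act g ` chow_class F = chow_class (const (det g ^ CARD('n)) * F)"
proof -
  obtain h where h: "g ** h = mat 1" using g by (auto simp: GL_def invertible_def)
  then have "h \<in> GL" by (auto simp: GL_def invertible_def matrix_left_right_inverse)
  have "det g * det h = 1" using h by (metis det_I det_mul)
  then have gh: "det g ^ CARD('n) * det h ^ CARD('n) = 1" by (simp flip: power_mult_distrib)
  show ?thesis
  proof (intro equalityI subsetI)
    fix G assume "G \<in> sym_act g ` chow_class F"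
    then obtain H where H: "H \<in> carrier form_sym_algebra" "\<forall>z\<in>chow_cone. eval_at_form z H = eval_at_form z F" "G = sym_act g H"
      by (auto simp: chow_class_eq[OF F])
    then show "G \<in> chow_class (const (det g ^ CARD('n)) * F)"
      by (auto simp: chow_class_eq const_mult_in_carrier F sym_act_in_carrier eval_sym_act_chow chow_cone_form_comp semi[OF _ g]
        eval_at_form_def[of _ "_ * _"] eval_poly_mult) (simp add: eval_at_form_def)
  next
    fix G assume "G \<in> chow_class (const (det g ^ CARD('n)) * F)"
    then have G: "G \<in> carrier form_sym_algebra" "\<And>z. z \<in> chow_cone \<Longrightarrow> eval_at_form z G = det g ^ CARD('n) * eval_at_form z F"
      by (auto simp: chow_class_eq const_mult_in_carrier F eval_at_form_def eval_poly_mult)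
    have "sym_act h G \<in> chow_class F"
      using gh by (auto simp: chow_class_eq F sym_act_in_carrier eval_sym_act_chow chow_cone_form_comp G(2) semi[OF _ \<open>h \<in> GL\<close>] mult.assoc[symmetric])
    moreover have "G = sym_act g (sym_act h G)" by (simp add: sym_act_inverse[OF G(1) h])
    ultimately show "G \<in> sym_act g ` chow_class F" by blast
  qed
qed

lemma const_mult_const: "const a * (const b * F) = const (a * b) * F"
  by (simp add: const_def mult_single flip: mult.assoc)

lemma chow_class_eq_iff:
  fixes F G :: "('n::finite) monomial cpoly"
  assumes "F \<in> carrier form_sym_algebra" "G \<in> carrier form_sym_algebra"
  shows "chow_class F = chow_class G \<longleftrightarrow> (\<forall>z\<in>chow_cone. eval_at_form z F = eval_at_form z G)"
  using assms by (auto simp: chow_class_eq)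

text \<open>As the Schur module is a line, an embedding is determined by a representative
  \<open>F\<close> of the image of its generator: equivariance makes \<open>F\<close> transform by
  det^n on the cone, and injectivity means that \<open>F\<close> does not vanish identically
  there.\<close>

lemma occurs_in_chow_iff:
  "occurs_in (GL :: (complex^'n::finite^'n) set) (schur_module (replicate (CARD('n)) (CARD('n)))) chow_module
   \<longleftrightarrow> (\<exists>F\<in>carrier (form_sym_algebra :: 'n monomial cpoly ring).
      (\<forall>z\<in>chow_cone. \<forall>g\<in>GL. eval_at_form (form_comp z g) F = det g ^ CARD('n) * eval_at_form z F) \<and>
      (\<exists>z\<in>chow_cone. eval_at_form z F \<noteq> 0))" (is "?L \<longleftrightarrow> ?R")
proof -
  define \<pi> where "\<pi> = replicate (CARD('n)) (CARD('n))"
  obtain e :: "'n tensor" and f\<^sub>0 where e: "e f\<^sub>0 = 1"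
    "vecs (schur_module \<pi>) = {(\<lambda>f. s * e f) | s. True}"
    "\<And>g s. tensor_act \<pi> g (\<lambda>f. s * e f) = (\<lambda>f. det g ^ CARD('n) * (s * e f))"
    unfolding \<pi>_def by (rule schur_module_line) blast
  have ops: "vadd (schur_module \<pi> :: ('n, 'n tensor) gmodule) = (\<lambda>S T f. S f + T f)"
    "vscale (schur_module \<pi> :: ('n, 'n tensor) gmodule) = (\<lambda>c T f. c * T f)"
    "gact (schur_module \<pi> :: ('n, 'n tensor) gmodule) = tensor_act \<pi>"
    by (simp_all add: schur_module_def)
  show ?thesis
  proof
    assume ?L
    then obtain \<phi> where \<phi>: "\<phi> \<in> vecs (schur_module \<pi>) \<rightarrow> vecs chow_module" "inj_on \<phi> (vecs (schur_module \<pi>))"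
      "\<And>c u. u \<in> vecs (schur_module \<pi>) \<Longrightarrow> \<phi> (\<lambda>f. c * u f) = vscale chow_module c (\<phi> u)"
      "\<And>g u. g \<in> (GL :: (complex^'n^'n) set) \<Longrightarrow> u \<in> vecs (schur_module \<pi>) \<Longrightarrow> \<phi> (tensor_act \<pi> g u) = gact chow_module g (\<phi> u)"
      unfolding occurs_in_def \<pi>_def[symmetric] ops by blast
    have mem: "(\<lambda>f. s * e f) \<in> vecs (schur_module \<pi>)" for s using e(2) by blast
    have "\<phi> (\<lambda>f. 1 * e f) \<in> vecs chow_module" using \<phi>(1) mem by blast
    then obtain F where F: "F \<in> carrier form_sym_algebra" "\<phi> (\<lambda>f. 1 * e f) = chow_class F"
      unfolding vecs_chow_module by blast
    have scale: "\<phi> (\<lambda>f. c * e f) = chow_class (const c * F)" for c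
      using \<phi>(3)[OF mem[of 1], of c] F by (simp add: vscale_chow_module)
    have "eval_at_form (form_comp z g) F = det g ^ CARD('n) * eval_at_form z F" if g: "g \<in> GL" and z: "z \<in> chow_cone" for g z
    proof -
      have "sym_act g ` chow_class F = chow_class (const (det g ^ CARD('n)) * F)"
        using \<phi>(4)[OF g mem[of 1]] F(2) unfolding e(3) gact_chow_module by (simp add: scale)
      moreover have "F \<in> chow_class F" using F(1) by (simp add: chow_class_eq)
      ultimately have "sym_act g F \<in> chow_class (const (det g ^ CARD('n)) * F)" by blast
      then have "eval_at_form z (sym_act g F) = eval_at_form z (const (det g ^ CARD('n)) * F)"
        using z F(1) by (simp add: chow_class_eq const_mult_in_carrier)
      then show ?thesis using z by (simp add: eval_sym_act_chow) (simp add: eval_at_form_def eval_poly_mult)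
    qed
    moreover have "\<exists>z\<in>chow_cone. eval_at_form z F \<noteq> 0"
    proof (rule ccontr)
      assume "\<not> (\<exists>z\<in>chow_cone. eval_at_form z F \<noteq> 0)"
      then have "chow_class F = chow_class (const 0 * F)"
        using F(1) by (simp add: chow_class_eq_iff const_mult_in_carrier) (simp add: eval_at_form_def eval_poly_mult)
      then have "\<phi> (\<lambda>f. 1 * e f) = \<phi> (\<lambda>f. 0 * e f)" using F(2) scale[of 0] by simp
      then have "(\<lambda>f. 1 * e f) = (\<lambda>f. 0 * e f)" using inj_onD[OF \<phi>(2) _ mem mem] by blast
      then show False using e(1) by (metis mult_1 mult_zero_left zero_neq_one)
    qed
    ultimately show ?R using F(1) by blast
  next
    assume ?R
    then obtain F z where F: "F \<in> carrier (form_sym_algebra :: 'n monomial cpoly ring)"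
      "\<And>z g. z \<in> chow_cone \<Longrightarrow> g \<in> GL \<Longrightarrow> eval_at_form (form_comp z g) F = det g ^ CARD('n) * eval_at_form z F"
      and z: "z \<in> chow_cone" "eval_at_form z F \<noteq> 0" by blast
    \<comment> \<open>The generator goes to the class of \<open>F\<close>;
      \<open>T f\<^sub>0\<close> is the coordinate of \<open>T\<close> on the line.\<close>
    define \<phi> where "\<phi> T = chow_class (const (T f\<^sub>0) * F)" for T :: "'n tensor"
    have vecs_eq: "T = (\<lambda>f. T f\<^sub>0 * e f)" if "T \<in> vecs (schur_module \<pi>)" for T
      using that e(1) unfolding e(2) by auto
    have carr: "const c * F \<in> carrier form_sym_algebra" for c using F(1) by (rule const_mult_in_carrier)
    have act: "\<phi> (tensor_act \<pi> g T) = gact chow_module g (\<phi> T)" if g: "g \<in> GL" and T: "T \<in> vecs (schur_module \<pi>)" for g T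
    proof -
      have "tensor_act \<pi> g T f\<^sub>0 = det g ^ CARD('n) * T f\<^sub>0"
        using e(3)[of g "T f\<^sub>0"] vecs_eq[OF T] e(1) by simp
      moreover have "sym_act g ` chow_class (const c * F) = chow_class (const (det g ^ CARD('n) * c) * F)" for c
      proof -
        have "eval_at_form (form_comp z h) (const c * F) = det h ^ CARD('n) * eval_at_form z (const c * F)"
          if "z \<in> chow_cone" "h \<in> GL" for z :: "'n cpoly" and h
          using F(2)[OF that] by (simp add: eval_at_form_def eval_poly_mult)
        then have "sym_act g ` chow_class (const c * F) = chow_class (const (det g ^ CARD('n)) * (const c * F))"
          by (intro sym_act_chow_class carr g)
        then show ?thesis by (simp add: const_mult_const)
      qed
      ultimately show ?thesis by (simp add: \<phi>_def gact_chow_module)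
    qed
    have "inj_on \<phi> (vecs (schur_module \<pi>))"
    proof (rule inj_onI)
      fix S T assume ST: "S \<in> vecs (schur_module \<pi>)" "T \<in> vecs (schur_module \<pi>)" "\<phi> S = \<phi> T"
      then have "eval_at_form z (const (S f\<^sub>0) * F) = eval_at_form z (const (T f\<^sub>0) * F)"
        using z(1) unfolding \<phi>_def chow_class_eq_iff[OF carr carr] by blast
      then have "S f\<^sub>0 = T f\<^sub>0" using z(2) by (simp add: eval_at_form_def eval_poly_mult)
      then show "S = T" using vecs_eq[OF ST(1)] vecs_eq[OF ST(2)] by simp
    qed
    moreover have "\<phi> \<in> vecs (schur_module \<pi>) \<rightarrow> vecs chow_module"
      using carr by (auto simp: \<phi>_def vecs_chow_module)
    moreover have "const (a + b) * F = const a * F + const b * F" for a b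
      by (simp add: const_def single_add distrib_right)
    ultimately show ?L
      unfolding occurs_in_def \<pi>_def[symmetric] ops
      using act by (intro exI[of _ \<phi>]) (simp add: \<phi>_def vadd_chow_module vscale_chow_module carr const_mult_const)
  qed
qed

section \<open>Averages over SU(n) of functions on the cone\<close>

context SU_haar
begin

text \<open>The j-th factor at the a-th column of \<open>g\<close> is the entry (j, a) of
  \<open>W ** g\<close>, so the integrand is the product of all entries of a translate.\<close>

lemma integral_factor_matrix:
  fixes z :: "'n cpoly"
  assumes "factor_matrix z W"
  shows "(LINT g|\<mu>. (\<Prod>a\<in>UNIV. eval_poly (\<lambda>k. g $ k $ a) z)) = det W ^ CARD('n) * entry_integral"
proof -
  have "(\<Prod>a\<in>UNIV. eval_poly (\<lambda>k. g $ k $ a) z) = (\<Prod>i\<in>UNIV. \<Prod>j\<in>UNIV. (W ** g ** mat 1) $ i $ j)" for g :: "complex^'n^'n"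
    using assms unfolding factor_matrix_def matrix_mul_rid
    by (subst prod.swap) (simp add: matrix_matrix_mult_def)
  then show ?thesis using integral_entries_translate[of W "mat 1"] by simp
qed

text \<open>
  As a function of the form \<open>z\<close>, this is the average over \<open>SU(n)\<close> of the product of the values of \<open>z\<close> at
  the columns of the matrix.
\<close>

definition invariant_form :: "'n monomial cpoly" where
  "invariant_form = (\<Sum>m\<in>(UNIV :: 'n set) \<rightarrow>\<^sub>E {m. mdeg m = CARD('n)}.
     const (LINT g|\<mu>. (\<Prod>a\<in>UNIV. monom_val (\<lambda>k. g $ k $ a) (m a))) * (\<Prod>a\<in>UNIV. Var (m a)))"

lemma invariant_form_in_carrier: "invariant_form \<in> carrier form_sym_algebra"
  unfolding carrier_iff invariant_form_def
  by (intro vars_in_sum vars_in_mult vars_in_const vars_in_prod vars_in_Var) auto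

lemma eval_invariant_form:
  assumes z: "homogeneous CARD('n) (z :: 'n cpoly)"
  shows "eval_at_form z invariant_form = (LINT g|\<mu>. (\<Prod>a\<in>UNIV. eval_poly (\<lambda>k. g $ k $ a) z))"
proof -
  let ?V = "{m :: 'n monomial. mdeg m = CARD('n)}"
  have int: "integrable \<mu> (\<lambda>g. \<Prod>a\<in>UNIV. monom_val (\<lambda>k. g $ k $ a) (m a))" for m :: "'n \<Rightarrow> 'n monomial"
    unfolding monom_val_def by (intro integrable_cont continuous_intros)
  have "(\<Prod>a\<in>UNIV. eval_poly (\<lambda>k. g $ k $ a) z)
     = (\<Sum>m\<in>UNIV \<rightarrow>\<^sub>E ?V. (\<Prod>a\<in>UNIV. Poly_Mapping.lookup z (m a)) * (\<Prod>a\<in>UNIV. monom_val (\<lambda>k. g $ k $ a) (m a)))" for g :: "complex^'n^'n"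
    unfolding eval_poly_homogeneous[OF z] by (subst prod_sum_PiE) (auto simp: finite_mdeg prod.distrib)
  then have "(LINT g|\<mu>. (\<Prod>a\<in>UNIV. eval_poly (\<lambda>k. g $ k $ a) z))
     = (\<Sum>m\<in>UNIV \<rightarrow>\<^sub>E ?V. (\<Prod>a\<in>UNIV. Poly_Mapping.lookup z (m a)) * (LINT g|\<mu>. (\<Prod>a\<in>UNIV. monom_val (\<lambda>k. g $ k $ a) (m a))))"
    by (simp add: int)
  then show ?thesis
    by (simp add: eval_at_form_def invariant_form_def eval_poly_sum eval_poly_mult eval_poly_prod mult.commute)
qed

lemma occurs_if_entry_integral_nonzero:
  assumes "entry_integral \<noteq> 0"
  shows "occurs_in (GL :: (complex^'n^'n) set) (schur_module (replicate (CARD('n)) (CARD('n)))) chow_module"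
  unfolding occurs_in_chow_iff
proof (intro bexI[OF _ invariant_form_in_carrier] conjI ballI)
  fix z :: "'n cpoly" and g :: "complex^'n^'n" assume z: "z \<in> chow_cone"
  obtain W where W: "factor_matrix z W" using chow_cone_factor_matrix[OF z] .
  show "eval_at_form (form_comp z g) invariant_form = det g ^ CARD('n) * eval_at_form z invariant_form"
    using integral_factor_matrix[OF W] integral_factor_matrix[OF factor_matrix_form_comp[OF W]]
    by (simp add: eval_invariant_form chow_cone_homogeneous[OF z] homogeneous_form_comp det_mul power_mult_distrib)
next
  \<comment> \<open>The product of the coordinates has the identity as factor matrix, where the
    average is \<open>entry_integral\<close> itself.\<close>
  define z where "z = (\<Prod>j\<in>(UNIV :: 'n set). Var j)"
  have z: "z \<in> chow_cone" unfolding chow_cone_def z_def using homogeneous_Var by blast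
  have "factor_matrix z (mat 1)"
    by (simp add: factor_matrix_def z_def eval_poly_prod mat_def if_distrib[of "\<lambda>x. x * _"] cong: if_cong)
  then have "eval_at_form z invariant_form \<noteq> 0"
    using assms by (simp add: eval_invariant_form chow_cone_homogeneous[OF z] integral_factor_matrix)
  then show "\<exists>z\<in>chow_cone. eval_at_form z invariant_form \<noteq> 0" using z by blast
qed

text \<open>
  Comparing the action of the scalar matrices shows that only the degree \<open>n\<close> component of \<open>F\<close>
  contributes on the cone.
\<close>

lemma eval_degree_component:
  fixes F :: "'n monomial cpoly"
  assumes semi: "\<And>z g. z \<in> chow_cone \<Longrightarrow> g \<in> GL \<Longrightarrow> eval_at_form (form_comp z g) F = det g ^ CARD('n) * eval_at_form z F"
    and z: "z \<in> chow_cone"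
  shows "eval_at_form z F = (\<Sum>\<nu>\<in>{\<nu>\<in>Poly_Mapping.keys F. mdeg \<nu> = CARD('n)}. Poly_Mapping.lookup F \<nu> * monom_val (Poly_Mapping.lookup z) \<nu>)"
proof -
  let ?n = "CARD('n)"
  \<comment> \<open>Bounds n^2 and all exponents \<open>?n * mdeg \<nu>\<close> of the scalar, so
    that \<open>u\<close> isolates the terms with \<open>?n * mdeg \<nu> = ?n * ?n\<close>, that is,
    of degree n.\<close>
  define d where "d = ?n * ?n + ?n * (\<Sum>\<nu>\<in>Poly_Mapping.keys F. mdeg \<nu>)"
  obtain u :: "nat \<Rightarrow> complex" where u: "\<And>k. k \<le> d \<Longrightarrow> (\<Sum>t\<in>{1..Suc d}. u t * of_nat t ^ k) = of_bool (k = ?n * ?n)"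
    using ex_power_functional[of d "?n * ?n"] by blast
  have "(\<Sum>\<nu>\<in>Poly_Mapping.keys F. Poly_Mapping.lookup F \<nu> * (of_nat t ^ (?n * mdeg \<nu>) * monom_val (Poly_Mapping.lookup z) \<nu>))
     = of_nat t ^ (?n * ?n) * eval_at_form z F" if "t \<ge> 1" for t
  proof -
    let ?D = "diag_matrix (\<lambda>_. of_nat t) :: complex^'n^'n"
    have det: "det ?D = of_nat t ^ ?n" by (simp add: det_diag_matrix)
    then have "det ?D \<noteq> 0" using that by simp
    then have "?D \<in> GL" by (simp add: GL_def invertible_det_nz)
    then have "of_nat t ^ (?n * ?n) * eval_at_form z F = eval_at_form (form_comp z ?D) F"
      using semi[OF z] by (simp add: det power_mult)
    also have "\<dots> = (\<Sum>\<nu>\<in>Poly_Mapping.keys F. Poly_Mapping.lookup F \<nu> * monom_val (\<lambda>m. of_nat t ^ ?n * Poly_Mapping.lookup z m) \<nu>)"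
      by (simp add: eval_at_form_def form_comp_diag[OF chow_cone_homogeneous[OF z]] lookup_const_mult[abs_def] eval_poly_superset[OF finite_keys subset_refl])
    finally show ?thesis by (simp add: monom_val_scale power_mult)
  qed
  then have "(\<Sum>t\<in>{1..Suc d}. u t * (\<Sum>\<nu>\<in>Poly_Mapping.keys F. Poly_Mapping.lookup F \<nu> * (of_nat t ^ (?n * mdeg \<nu>) * monom_val (Poly_Mapping.lookup z) \<nu>)))
     = (\<Sum>t\<in>{1..Suc d}. u t * of_nat t ^ (?n * ?n)) * eval_at_form z F"
    unfolding sum_distrib_right by (intro sum.cong refl) (simp add: mult.assoc)
  also have "\<dots> = eval_at_form z F" by (subst u) (auto simp: d_def)
  also have "(\<Sum>t\<in>{1..Suc d}. u t * (\<Sum>\<nu>\<in>Poly_Mapping.keys F. Poly_Mapping.lookup F \<nu> * (of_nat t ^ (?n * mdeg \<nu>) * monom_val (Poly_Mapping.lookup z) \<nu>)))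
     = (\<Sum>\<nu>\<in>Poly_Mapping.keys F. (\<Sum>t\<in>{1..Suc d}. u t * of_nat t ^ (?n * mdeg \<nu>)) * (Poly_Mapping.lookup F \<nu> * monom_val (Poly_Mapping.lookup z) \<nu>))"
    unfolding sum_distrib_left sum_distrib_right by (subst sum.swap) (simp add: mult_ac)
  also have "\<dots> = (\<Sum>\<nu>\<in>Poly_Mapping.keys F. if mdeg \<nu> = ?n then Poly_Mapping.lookup F \<nu> * monom_val (Poly_Mapping.lookup z) \<nu> else 0)"
  proof (intro sum.cong refl)
    fix \<nu> assume \<nu>: "\<nu> \<in> Poly_Mapping.keys F"
    have "mdeg \<nu> \<le> (\<Sum>\<nu>\<in>Poly_Mapping.keys F. mdeg \<nu>)" using \<nu> by (intro member_le_sum) auto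
    then have "?n * mdeg \<nu> \<le> d" unfolding d_def by (intro trans_le_add2 mult_le_mono2)
    then show "(\<Sum>t\<in>{1..Suc d}. u t * of_nat t ^ (?n * mdeg \<nu>)) * (Poly_Mapping.lookup F \<nu> * monom_val (Poly_Mapping.lookup z) \<nu>)
      = (if mdeg \<nu> = ?n then Poly_Mapping.lookup F \<nu> * monom_val (Poly_Mapping.lookup z) \<nu> else 0)"
      by (subst u) auto
  qed
  also have "\<dots> = (\<Sum>\<nu>\<in>{\<nu>\<in>Poly_Mapping.keys F. mdeg \<nu> = ?n}. Poly_Mapping.lookup F \<nu> * monom_val (Poly_Mapping.lookup z) \<nu>)"
    by (rule sum.inter_filter[symmetric]) simp
  finally show ?thesis by simp
qed

text \<open>Written as a word, \<open>\<nu>\<close> is a product of n coefficients of the form, each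
  a combination of values at integer vectors. Taking one vector per factor as the rows of a matrix
  turns each summand into the product of all entries of
  \<open>X \<sigma> ** g ** transpose W\<close>, whose integral is a multiple of
  \<open>entry_integral\<close>. The transpose in the statement puts \<open>g\<close> itself in the
  middle.\<close>

lemma integral_monomial_form_comp:
  fixes z :: "'n cpoly"
  assumes W: "factor_matrix z W" and z: "homogeneous CARD('n) z" and \<nu>: "mdeg \<nu> = CARD('n)"
    and 0: "entry_integral = 0"
  shows "integrable \<mu> (\<lambda>g. monom_val (Poly_Mapping.lookup (form_comp z (transpose g))) \<nu>)"
    "(LINT g|\<mu>. monom_val (Poly_Mapping.lookup (form_comp z (transpose g))) \<nu>) = 0"
proof -
  let ?n = "CARD('n)"
  obtain w :: "'n \<Rightarrow> 'n monomial" where w: "\<nu> = (\<Sum>a\<in>UNIV. Poly_Mapping.single (w a) 1)"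
    using ex_monomial_word[of "UNIV :: 'n set" \<nu>] \<nu> by auto
  obtain S :: "'n monomial \<Rightarrow> ('n \<Rightarrow> nat) set" and c where S: "\<And>m. finite (S m)"
    "\<And>m p. homogeneous ?n p \<Longrightarrow> Poly_Mapping.lookup p m = (\<Sum>s\<in>S m. c m s * eval_poly (\<lambda>v. of_nat (s v)) p)"
    using ex_coeff_functional_homogeneous[of ?n, where 'v = 'n] by metis
  define X where "X \<sigma> = ((\<chi> a k. of_nat (\<sigma> a k)) :: complex^'n^'n)" for \<sigma> :: "'n \<Rightarrow> 'n \<Rightarrow> nat"
  define G where "G \<sigma> g = (\<Prod>a\<in>UNIV. \<Prod>j\<in>UNIV. (X \<sigma> ** g ** transpose W) $ a $ j)" for \<sigma> :: "'n \<Rightarrow> 'n \<Rightarrow> nat" and g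
  define P where "P = (UNIV :: 'n set) \<rightarrow>\<^sub>E (\<Union>a. S (w a))"
  have eval: "eval_poly (\<lambda>v. of_nat (\<sigma> a v)) (form_comp z (transpose g)) = (\<Prod>j\<in>UNIV. (X \<sigma> ** g ** transpose W) $ a $ j)"
    for \<sigma> a and g :: "complex^'n^'n"
  proof -
    have "(\<Sum>k\<in>UNIV. (W ** transpose g) $ j $ k * of_nat (\<sigma> a k)) = (X \<sigma> ** g ** transpose W) $ a $ j" for j
    proof -
      have "X \<sigma> ** g ** transpose W = transpose (W ** transpose g ** transpose (X \<sigma>))"
        by (simp add: matrix_transpose_mul matrix_mul_assoc)
      then show ?thesis by (simp add: transpose_def X_def matrix_matrix_mult_def[of _ "\<chi> i j. _ i j"])
    qed
    then show ?thesis using factor_matrix_form_comp[OF W, of "transpose g"] by (simp add: factor_matrix_def)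
  qed
  have expand: "monom_val (Poly_Mapping.lookup (form_comp z (transpose g))) \<nu>
     = (\<Sum>\<sigma>\<in>PiE UNIV (\<lambda>a. S (w a)). (\<Prod>a\<in>UNIV. c (w a) (\<sigma> a)) * G \<sigma> g)" for g :: "complex^'n^'n"
  proof -
    have "monom_val (Poly_Mapping.lookup (form_comp z (transpose g))) \<nu>
       = (\<Prod>a\<in>UNIV. \<Sum>s\<in>S (w a). c (w a) s * eval_poly (\<lambda>v. of_nat (s v)) (form_comp z (transpose g)))"
      by (simp add: w monom_val_sum S(2)[OF homogeneous_form_comp[OF z]])
    also have "\<dots> = (\<Sum>\<sigma>\<in>PiE UNIV (\<lambda>a. S (w a)). \<Prod>a\<in>UNIV. c (w a) (\<sigma> a) * eval_poly (\<lambda>v. of_nat (\<sigma> a v)) (form_comp z (transpose g)))"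
      using S(1) by (subst prod_sum_PiE) auto
    finally show ?thesis by (simp add: eval G_def prod.distrib)
  qed
  have int: "integrable \<mu> (G \<sigma>)" for \<sigma>
    unfolding G_def matrix_matrix_mult_def by (intro integrable_cont) (auto intro!: continuous_intros)
  have G0: "(LINT g|\<mu>. G \<sigma> g) = 0" for \<sigma>
    unfolding G_def by (simp add: integral_entries_translate 0)
  show "integrable \<mu> (\<lambda>g. monom_val (Poly_Mapping.lookup (form_comp z (transpose g))) \<nu>)"
    unfolding expand by (intro Bochner_Integration.integrable_sum integrable_mult_right int)
  show "(LINT g|\<mu>. monom_val (Poly_Mapping.lookup (form_comp z (transpose g))) \<nu>) = 0"
    unfolding expand by (simp add: int G0)
qed

text \<open>A semi-invariant \<open>F\<close> is constant along the forms
  \<open>form_comp z (transpose g)\<close> with \<open>g\<close> in SU(n), where determinants are 1.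
  Averaging reproduces its value times the nonzero total mass, yet the average of its degree n part
  is zero if \<open>entry_integral\<close> is.\<close>

lemma entry_integral_nonzero_if_occurs:
  assumes "occurs_in (GL :: (complex^'n^'n) set) (schur_module (replicate (CARD('n)) (CARD('n)))) chow_module"
  shows "entry_integral \<noteq> 0"
proof
  assume 0: "entry_integral = 0"
  obtain F :: "'n monomial cpoly" and z where
    semi: "\<And>z g. z \<in> chow_cone \<Longrightarrow> g \<in> GL \<Longrightarrow> eval_at_form (form_comp z g) F = det g ^ CARD('n) * eval_at_form z F"
    and z: "z \<in> chow_cone" "eval_at_form z F \<noteq> 0"
    using assms unfolding occurs_in_chow_iff by blast
  obtain W where W: "factor_matrix z W" using chow_cone_factor_matrix[OF z(1)] .
  let ?K = "{\<nu>\<in>Poly_Mapping.keys F. mdeg \<nu> = CARD('n)}"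
  have "eval_at_form z F = (\<Sum>\<nu>\<in>?K. Poly_Mapping.lookup F \<nu> * monom_val (Poly_Mapping.lookup (form_comp z (transpose g))) \<nu>)"
    if g: "g \<in> SU" for g
  proof -
    have det: "det (transpose g) = 1" using g by (simp add: SU_iff det_transpose)
    then have "transpose g \<in> GL" by (simp add: GL_def invertible_det_nz)
    then have "eval_at_form z F = eval_at_form (form_comp z (transpose g)) F"
      using semi[OF z(1)] det by simp
    then show ?thesis
      using eval_degree_component[OF semi chow_cone_form_comp[OF z(1)]] by simp
  qed
  then have "(LINT g|\<mu>. eval_at_form z F)
      = (LINT g|\<mu>. (\<Sum>\<nu>\<in>?K. Poly_Mapping.lookup F \<nu> * monom_val (Poly_Mapping.lookup (form_comp z (transpose g))) \<nu>))"
    by (intro Bochner_Integration.integral_cong refl) (simp add: space_mu)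
  also have "\<dots> = (\<Sum>\<nu>\<in>?K. Poly_Mapping.lookup F \<nu> * (LINT g|\<mu>. monom_val (Poly_Mapping.lookup (form_comp z (transpose g))) \<nu>))"
    using integral_monomial_form_comp(1)[OF W chow_cone_homogeneous[OF z(1)] _ 0] by simp
  also have "\<dots> = 0"
    using integral_monomial_form_comp(2)[OF W chow_cone_homogeneous[OF z(1)] _ 0] by simp
  finally show False using z(2) measure_SU by (simp add: space_mu)
qed

end

section \<open>Assembling the equivalences\<close>

theorem proposition7p27:
  fixes \<mu> :: "(complex^'n::finite^'n) measure"
  assumes "even CARD('n)"
    and "haar_measure SU \<mu>"
  shows
    "let n = CARD('n);
         s1 = card {L :: 'n^'n^'n. latin_square L \<and> latin_sign L = -1}
                \<noteq> card {L :: 'n^'n^'n. latin_square L \<and> latin_sign L = 1};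
         s2 = occurs_in (GL :: (complex^'n^'n) set) (schur_module (replicate n n)) chow_module;
         s3 = (LINT g|\<mu>. perm g ^ n) \<noteq> 0;
         s4 = pairing (perm (generic_matrix :: (('n \<times> 'n) cpoly)^'n^'n) ^ n)
                (det generic_matrix ^ n) \<noteq> 0;
         si = (LINT g|\<mu>. (\<Prod>i\<in>UNIV. \<Prod>j\<in>UNIV. g $ i $ j)) \<noteq> 0;
         sii = pairing (\<Prod>i\<in>UNIV. \<Prod>j\<in>UNIV. (generic_matrix :: (('n \<times> 'n) cpoly)^'n^'n) $ i $ j)
                (det generic_matrix ^ n) \<noteq> 0
     in (s1 \<longleftrightarrow> s2) \<and> (s1 \<longleftrightarrow> s3) \<and> (s1 \<longleftrightarrow> s4) \<and>
        (si \<longleftrightarrow> sii) \<and> (si \<longrightarrow> s1 \<and> s2 \<and> s3 \<and> s4)"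
proof -
  interpret SU_haar \<mu> using assms(2) by unfold_locales
  let ?c = "Poly_Mapping.lookup (det (generic_matrix :: ('n \<times> 'n) cpoly^'n^'n) ^ CARD('n)) ones"
  have si: "(LINT g|\<mu>. (\<Prod>i\<in>UNIV. \<Prod>j\<in>UNIV. g $ i $ j)) = haar_const * ?c"
    using entry_integral_eq(1) by (simp add: entry_integral_def)
  have s1: "card {L :: 'n^'n^'n. latin_square L \<and> latin_sign L = -1} \<noteq> card {L :: 'n^'n^'n. latin_square L \<and> latin_sign L = 1}
      \<longleftrightarrow> ?c \<noteq> 0" by (rule alon_tarsi_iff)
  have s2: "occurs_in (GL :: (complex^'n^'n) set) (schur_module (replicate (CARD('n)) (CARD('n)))) chow_module \<longleftrightarrow> ?c \<noteq> 0"
    using occurs_if_entry_integral_nonzero entry_integral_nonzero_if_occurs entry_integral_eq(1) haar_const_nonzero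
    by auto
  \<comment> \<open>The permanent integral is quadratic in \<open>?c\<close>: it equals
    \<open>haar_const * ?c ^ 2\<close> and so vanishes together with \<open>?c\<close>.\<close>
  have s3: "(LINT g|\<mu>. perm g ^ CARD('n)) \<noteq> 0 \<longleftrightarrow> ?c \<noteq> 0"
    using haar_const_nonzero by (simp add: perm_integral entry_integral_eq(1))
  have s4: "pairing (perm (generic_matrix :: (('n \<times> 'n) cpoly)^'n^'n) ^ CARD('n)) (det generic_matrix ^ CARD('n)) \<noteq> 0 \<longleftrightarrow> ?c \<noteq> 0"
    using s3 haar_const_nonzero by (simp add: perm_integral_eq)
  have sii: "pairing (\<Prod>i\<in>UNIV. \<Prod>j\<in>UNIV. (generic_matrix :: (('n \<times> 'n) cpoly)^'n^'n) $ i $ j) (det generic_matrix ^ CARD('n)) = ?c"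
    using entry_integral_eq haar_const_nonzero by (metis mult_cancel_left)
  show ?thesis
    unfolding Let_def s1 s2 s3 s4 si sii using haar_const_nonzero by simp
qed

end
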